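(* Let $k\ge4$ be an even integer such that every plane graph $H$ with $\Delta^*(H)\le k$ has a cyclic colouring using at most $\frac32 k$ colours. Then, if $G$ is a planar graph with maximum degree $\Delta(G)$ satisfying $\chi_k(G)\le\bigl\lfloor\frac{\Delta(G)-1}{k}\bigr\rfloor+3$, we also have $\chi(G^2)=\chi_1(G)\le\bigl\lfloor\frac32\,\Delta(G)\bigr\rfloor+\frac92 k-1$.
   Context: All graphs are finite and simple. A plane graph is a planar graph with a prescribed planar embedding; $\Delta^*(H)$ denotes the size (number of vertices on its boundary) of a largest face of the plane graph $H$. A cyclic colouring of a plane graph is a vertex colouring in which any two vertices incident to a common face receive distinct colours. $G^2$ is the graph on $V(G)$ with an edge between any two distinct vertices at distance at most two in $G$, and $\chi$ denotes the chromatic number. For an integer $k\ge1$, a $k$-frugal colouring of $G$ is a proper vertex colouring such that no colour appears more than $k$ times in the neighbourhood of any vertex; $\chi_k(G)$ is the least number of colours in a $k$-frugal colouring of $G$. *)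

theory Defs
  imports "HOL-Analysis.Analysis" "HOL-Library.Extended_Nat"
begin

section \<open>Finite simple graphs\<close>

text \<open>A graph is given by its vertex set and its set of edges, an edge being a two-element set of
  vertices.  The graph without vertices is allowed.\<close>

definition simple_graph :: "'a set \<Rightarrow> 'a set set \<Rightarrow> bool" where
  "simple_graph V E \<longleftrightarrow> finite V \<and> (\<forall>e\<in>E. e \<subseteq> V \<and> card e = 2)"

definition neighbourhood :: "'a set set \<Rightarrow> 'a \<Rightarrow> 'a set" where
  "neighbourhood E v = {u. {u, v} \<in> E}"

text \<open>The inserted 0 only matters for the graph without vertices.\<close>

definition max_degree :: "'a set \<Rightarrow> 'a set set \<Rightarrow> nat" where
  "max_degree V E = Max (insert 0 ((\<lambda>v. card (neighbourhood E v)) ` V))"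

definition walks :: "'a set \<Rightarrow> 'a set set \<Rightarrow> 'a \<Rightarrow> 'a \<Rightarrow> 'a list set" where
  "walks V E u v = {p. p \<noteq> [] \<and> set p \<subseteq> V \<and> hd p = u \<and> last p = v \<and>
                       successively (\<lambda>x y. {x, y} \<in> E) p}"

text \<open>A walk is recorded by its list of vertices, so it has one edge fewer than the list has
  entries.  The distance is infinite if there is no walk.\<close>

definition graph_dist :: "'a set \<Rightarrow> 'a set set \<Rightarrow> 'a \<Rightarrow> 'a \<Rightarrow> enat" where
  "graph_dist V E u v = (INF p\<in>walks V E u v. enat (length p - 1))"

definition square_edges :: "'a set \<Rightarrow> 'a set set \<Rightarrow> 'a set set" where
  "square_edges V E = {{u, v} | u v. u \<in> V \<and> v \<in> V \<and> u \<noteq> v \<and> graph_dist V E u v \<le> 2}"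

section \<open>Colourings\<close>

definition proper_colouring :: "'a set set \<Rightarrow> ('a \<Rightarrow> nat) \<Rightarrow> bool" where
  "proper_colouring E c \<longleftrightarrow> (\<forall>u v. {u, v} \<in> E \<longrightarrow> c u \<noteq> c v)"

definition chromatic_number :: "'a set \<Rightarrow> 'a set set \<Rightarrow> nat" where
  "chromatic_number V E = (LEAST n. \<exists>c. proper_colouring E c \<and> card (c ` V) = n)"

definition frugal_colouring :: "nat \<Rightarrow> 'a set \<Rightarrow> 'a set set \<Rightarrow> ('a \<Rightarrow> nat) \<Rightarrow> bool" where
  "frugal_colouring k V E c \<longleftrightarrow>
     proper_colouring E c \<and> (\<forall>v\<in>V. \<forall>i. card {u \<in> neighbourhood E v. c u = i} \<le> k)"

definition frugal_chromatic_number :: "nat \<Rightarrow> 'a set \<Rightarrow> 'a set set \<Rightarrow> nat" where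
  "frugal_chromatic_number k V E = (LEAST n. \<exists>c. frugal_colouring k V E c \<and> card (c ` V) = n)"

section \<open>Plane and planar graphs\<close>

text \<open>The plane is represented by the type \<^typ>\<open>complex\<close>.  The vertices of a plane graph are
  points, its edges are arcs, regarded as sets of points.  An arc meets the vertex set precisely in
  its two end points, so the ends of an edge \<open>a\<close> are \<open>a \<inter> V\<close>; two distinct edges meet at most in
  vertices.  The last condition excludes parallel edges; loops are excluded because arcs are
  injective.\<close>

definition plane_graph :: "complex set \<Rightarrow> complex set set \<Rightarrow> bool" where
  "plane_graph V A \<longleftrightarrow>
     finite V \<and>
     (\<forall>a\<in>A. \<exists>g. arc g \<and> path_image g = a \<and> a \<inter> V = {pathstart g, pathfinish g}) \<and>
     (\<forall>a\<in>A. \<forall>b\<in>A. a \<noteq> b \<longrightarrow> a \<inter> b \<subseteq> V \<and> a \<inter> V \<noteq> b \<inter> V)"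

definition faces :: "complex set \<Rightarrow> complex set set \<Rightarrow> complex set set" where
  "faces V A = components (- (V \<union> \<Union>A))"

definition face_vertices :: "complex set \<Rightarrow> complex set \<Rightarrow> complex set" where
  "face_vertices V F = V \<inter> frontier F"

definition max_face_size :: "complex set \<Rightarrow> complex set set \<Rightarrow> nat" where
  "max_face_size V A = Max ((\<lambda>F. card (face_vertices V F)) ` faces V A)"

definition cyclic_colouring :: "complex set \<Rightarrow> complex set set \<Rightarrow> (complex \<Rightarrow> nat) \<Rightarrow> bool" where
  "cyclic_colouring V A c \<longleftrightarrow> (\<forall>F\<in>faces V A. inj_on c (face_vertices V F))"

definition planar_graph :: "'a set \<Rightarrow> 'a set set \<Rightarrow> bool" where
  "planar_graph V E \<longleftrightarrow>
     simple_graph V E \<and>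
     (\<exists>f A. inj_on f V \<and> plane_graph (f ` V) A \<and> (\<lambda>e. f ` e) ` E = (\<lambda>a. a \<inter> f ` V) ` A)"

end

theory Submission
  imports Defs
begin

text \<open>Fix a \<open>k\<close>-frugal colouring with \<open>\<chi>\<^sub>k\<close> colours.  Each colour class \<open>C\<close> is recoloured with
  \<open>3k/2\<close> colours so that vertices of \<open>C\<close> with a common neighbour differ; pairing both colours gives
  a colouring of the square with at most \<open>3k/2 * \<chi>\<^sub>k\<close> colours.  To recolour \<open>C\<close>, keep only the edges
  that meet \<open>C\<close>, so that each vertex outside \<open>C\<close> is the centre of a star with at most \<open>k\<close> leaves in
  \<open>C\<close>, and draw as many further edges inside \<open>C\<close> as possible.  If two vertices of \<open>C\<close> separate the
  resulting graph, add the edge between them on both sides and combine two smaller solutions by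
  permuting colours; this replaces the parallel edges that a naive triangulation would need.
  Otherwise the graph is so well connected that, by nonplanarity of \<open>K\<^sub>5\<close>, a face contains at most
  three vertices of \<open>C\<close>, and a face at a star contains no vertices besides the centre and two leaves.
  Hence deleting the stars yields a plane graph on \<open>C\<close> in which a face that contained a star has only
  its leaves on the boundary, and the cyclic colouring of this graph is as required.\<close>

section \<open>Arcs and crosscuts\<close>

text \<open>The direct way to separate the leaves of a star is to draw a cycle through them and
  delete the centre, leaving a face bounded by the leaves. Such a cycle may need an edge that is
  already drawn elsewhere, and the hypothesis on cyclic colourings concerns graphs without parallel
  edges. After the separations, the vertices of a face at a star are known wherever the edge between
  its leaves was drawn. Faces are components of the complement of a union of arbitrary arcs, so what
  a combinatorial embedding supplies by definition has to be proved: a face boundary containing an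
  inner point of an edge contains the edge, a boundary vertex can be reached by an arc through the
  face, and a boundary vertex with two or more edges has two of them on the boundary. The last two
  facts are the reason for redrawing the edges straight near the vertices. \<open>K_5\<close> enters
  with a face as its fifth vertex, through Jordan curves and without Euler's formula. The constants:
  \<open>((D - 1) / k + 3) * (3 k / 2)\<close> equals \<open>3 D / 2 + 9 k / 2 - 3 / 2\<close>, and
  rounding \<open>3 D / 2\<close> down costs at most \<open>1 / 2\<close>, hence the final
  \<open>- 1\<close>.\<close>

lemma arc_interior_image:
  assumes "arc g"
  shows "path_image g - {pathstart g, pathfinish g} = g ` {0<..<1}"
proof -
  have inj: "inj_on g {0..1}" using assms by (simp add: arc_def)
  have "{0..1::real} = {0<..<1} \<union> {0,1}" by auto
  moreover have "g 0 \<notin> g ` {0<..<1}" "g 1 \<notin> g ` {0<..<1}"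
    using inj by (force simp: inj_on_def)+
  ultimately show ?thesis
    by (auto simp: path_image_def pathstart_def pathfinish_def)
qed

lemma connected_arc_interior:
  assumes "arc g"
  shows "connected (path_image g - {pathstart g, pathfinish g})"
  unfolding arc_interior_image[OF assms]
  by (intro connected_continuous_image continuous_on_subset[OF arc_imp_path[OF assms, unfolded path_def]]) auto

lemma closure_arc_interior:
  fixes g :: "real \<Rightarrow> 'a :: real_normed_vector"
  assumes "arc g"
  shows "path_image g \<subseteq> closure (path_image g - {pathstart g, pathfinish g})"
proof -
  have "continuous_on (closure {0<..<1}) g"
    using arc_imp_path[OF assms] by (simp add: path_def)
  then have "g ` closure {0<..<1} \<subseteq> closure (g ` {0<..<1})"
    by (intro image_closure_subset closed_closure closure_subset)
  then show ?thesis
    unfolding arc_interior_image[OF assms] by (simp add: path_image_def)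
qed

lemma connected_arc_minus_finish:
  assumes "arc g"
  shows "connected (path_image g - {pathfinish g})"
proof -
  have inj: "inj_on g {0..1}" using assms by (simp add: arc_def)
  have "{0..1::real} = {0..<1} \<union> {1}" by auto
  moreover have "g 1 \<notin> g ` {0..<1}"
    using inj by (force simp: inj_on_def)+
  ultimately have "path_image g - {pathfinish g} = g ` {0..<1}"
    by (auto simp: path_image_def pathfinish_def)
  then show ?thesis
    by (metis arc_imp_path[OF assms] path_def connected_Ico connected_continuous_image
        continuous_on_subset atLeastLessThan_subseteq_atLeastAtMost_iff order_refl zero_less_one)
qed


text \<open>By invariance of dimension. This supplies points off an edge arbitrarily close to a
  given point on it.\<close>

lemma not_open_subset_arc:
  fixes g :: "real \<Rightarrow> complex"
  assumes "arc g" "open S" "S \<noteq> {}"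
  shows "\<not> S \<subseteq> path_image g"
proof
  assume S: "S \<subseteq> path_image g"
  have "path_image g homeomorphic {0..1::real}"
    using assms by (simp add: homeomorphic_arc_image_interval)
  then obtain h h' where "homeomorphism (path_image g) {0..1::real} h h'"
    by (auto simp: homeomorphic_def)
  then have "continuous_on (path_image g) h" "inj_on h (path_image g)"
    by (auto simp: homeomorphism_def intro: inj_on_inverseI)
  then have "DIM(complex) \<le> DIM(real)"
    using S assms(2,3) by (intro invariance_of_dimension[of S h])
      (auto intro: continuous_on_subset inj_on_subset)
  then show False by simp
qed

text \<open>A theta curve: \<open>c\<close> cuts the inside of the closed curve into two regions,
  each bounded by \<open>c\<close> and only one of \<open>c1\<close>, \<open>c2\<close>. The
  connected \<open>D\<close> lies in one region, so its closure cannot reach inner points of both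
  arcs.\<close>

lemma crosscut_inside:
  fixes c1 c2 c :: "real \<Rightarrow> complex"
  assumes arcs: "arc c1" "arc c2" "arc c"
    and ends: "pathstart c1 = s" "pathfinish c1 = t" "pathstart c2 = s" "pathfinish c2 = t"
      "pathstart c = s" "pathfinish c = t"
    and int: "path_image c1 \<inter> path_image c2 = {s, t}" "path_image c1 \<inter> path_image c = {s, t}"
      "path_image c2 \<inter> path_image c = {s, t}"
    and c: "path_image c - {s, t} \<subseteq> inside (path_image c1 \<union> path_image c2)"
    and D: "connected D" "D \<subseteq> inside (path_image c1 \<union> path_image c2)" "D \<inter> path_image c = {}"
    and p: "p1 \<in> path_image c1 - {s, t}" "p1 \<in> closure D" "p2 \<in> path_image c2 - {s, t}" "p2 \<in> closure D"
  shows False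
proof -
  have "s \<noteq> t" using arcs(1) ends arc_distinct_ends by metis
  have "path_image c - {s, t} \<noteq> {}"
    using arc_interior_image[OF arcs(3)] ends by auto
  with c have ne: "path_image c \<inter> inside (path_image c1 \<union> path_image c2) \<noteq> {}" by blast
  let ?I = "inside (path_image c1 \<union> path_image c2)"
  let ?I1 = "inside (path_image c1 \<union> path_image c)" and ?I2 = "inside (path_image c2 \<union> path_image c)"
  have split: "?I1 \<inter> ?I2 = {}" "?I1 \<union> ?I2 \<union> (path_image c - {s, t}) = ?I"
    using split_inside_simple_closed_curve[OF arc_imp_simple_path[OF arcs(1)] ends(1,2)
        arc_imp_simple_path[OF arcs(2)] ends(3,4) arc_imp_simple_path[OF arcs(3)] ends(5,6) \<open>s \<noteq> t\<close> int ne]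
    by blast+
  have cl: "closed (path_image c1 \<union> path_image c)" "closed (path_image c2 \<union> path_image c)"
    using arcs by (auto intro!: closed_Un closed_arc_image)
  have op: "open ?I1" "open ?I2" using cl by (auto intro: open_inside)
  have "D \<subseteq> ?I1 \<union> ?I2" using split D by blast
  then have "D \<subseteq> ?I1 \<or> D \<subseteq> ?I2"
    using connectedD[OF D(1) op] split(1) by blast
  then have "closure D \<subseteq> closure ?I1 \<or> closure D \<subseteq> closure ?I2"
    by (auto dest: closure_mono)
  then have "p2 \<in> path_image c1 \<union> path_image c \<union> ?I1 \<or> p1 \<in> path_image c2 \<union> path_image c \<union> ?I2"
    using p closure_inside_subset[OF cl(1)] closure_inside_subset[OF cl(2)] by blast
  moreover have "p1 \<notin> ?I" "p2 \<notin> ?I"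
    using p inside_no_overlap[of "path_image c1 \<union> path_image c2"] by blast+
  then have "p1 \<notin> ?I2" "p2 \<notin> ?I1" using split(2) by blast+
  moreover have "p1 \<notin> path_image c2" "p1 \<notin> path_image c" "p2 \<notin> path_image c1" "p2 \<notin> path_image c"
    using p int by blast+
  ultimately show False by blast
qed

lemma connected_unbounded_subset_outside:
  assumes "connected S" "\<not> bounded S" "S \<inter> T = {}"
  shows "S \<subseteq> outside T"
proof
  fix x assume "x \<in> S"
  then have "S \<subseteq> connected_component_set (- T) x"
    using assms by (intro connected_component_maximal) auto
  then show "x \<in> outside T" using assms(2) bounded_subset by (auto simp: outside)
qed

text \<open>Inversion at an inner point exchanges the two sides of a Jordan curve. The inclusion
  given here is the one that transfers crosscuts from the unbounded side to the bounded one.\<close>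

lemma inversion_outside:
  fixes c :: "real \<Rightarrow> complex"
  assumes c: "simple_path c" "pathfinish c = pathstart c" and w: "w \<in> inside (path_image c)"
  defines "f \<equiv> \<lambda>z. inverse (z - w)"
  shows "f ` outside (path_image c) \<subseteq> inside (f ` path_image c)"
proof -
  let ?J = "path_image c" let ?I = "inside ?J" let ?O = "outside ?J"
  note jio = Jordan_inside_outside[OF c]
  have wn: "w \<notin> ?J" "w \<notin> ?O" using w jio by blast+
  have cont: "continuous_on (- {w}) f" unfolding f_def by (intro continuous_intros) auto
  \<comment> \<open>Since \<open>inverse 0 = 0\<close>, the map is injective everywhere, although it
    is continuous only away from \<open>w\<close>.\<close>
  have inj: "inj f" unfolding f_def by (auto simp: inj_on_def)
  have "path (f \<circ> c)"
    using c(1) wn by (intro path_continuous_image simple_path_imp_path continuous_on_subset[OF cont]) auto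
  moreover have "loop_free (f \<circ> c)"
    using c(1) inj by (auto simp: simple_path_def loop_free_def inj_eq)
  ultimately have fc: "simple_path (f \<circ> c)" "pathfinish (f \<circ> c) = pathstart (f \<circ> c)"
    using c by (auto simp: simple_path_def pathfinish_compose pathstart_compose)
  have fJ: "path_image (f \<circ> c) = f ` ?J" by (simp add: path_image_compose)
  note fio = Jordan_inside_outside[OF fc, unfolded fJ]
  have "connected (?I - {w})" using jio by (intro connected_open_delete) auto
  then have "connected (f ` (?I - {w}))"
    by (rule connected_continuous_image[rotated]) (auto intro: continuous_on_subset[OF cont])
  moreover have "\<not> bounded (f ` (?I - {w}))"
  proof
    assume "bounded (f ` (?I - {w}))"
    then obtain B where B: "\<And>z. z \<in> ?I - {w} \<Longrightarrow> norm (f z) \<le> B" "B > 0"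
      by (auto simp: bounded_pos)
    have "open ?I" using jio by simp
    then obtain e where e: "e > 0" "ball w e \<subseteq> ?I" using w by (auto elim: openE)
    \<comment> \<open>The point at distance \<open>d\<close> from \<open>w\<close> is sent to a
      point of modulus \<open>1 / d\<close>, which exceeds \<open>B\<close>; \<open>d < e\<close>
      keeps it inside the curve.\<close>
    define d where "d = min (e/2) (1/(2*B))"
    have d: "d > 0" "d < e" "d < 1/B" using e(1) B(2) by (auto simp: d_def min_def field_simps)
    have "w + of_real d \<in> ball w e" using d by (simp add: dist_norm)
    then have "w + of_real d \<in> ?I - {w}" using e d by auto
    from B(1)[OF this] have "1 / d \<le> B" using d by (simp add: f_def norm_inverse divide_inverse)
    then show False using d B(2) by (simp add: field_simps)
  qed
  moreover have "f ` (?I - {w}) \<inter> f ` ?J = {}"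
    using injD[OF inj] inside_no_overlap[of ?J] by blast
  ultimately have I: "f ` (?I - {w}) \<subseteq> outside (f ` ?J)"
    by (rule connected_unbounded_subset_outside)
  \<comment> \<open>The value \<open>0\<close> is taken at \<open>w\<close> only, so a point
    \<open>u\<close> other than \<open>0\<close> is needed for its preimage \<open>z\<close> to lie
    outside the original curve.\<close>
  have "\<not> inside (f ` ?J) \<subseteq> {0}"
    using fio by (metis bot.extremum_uniqueI insert_not_empty not_open_singleton subset_singletonD)
  then obtain u where u: "u \<in> inside (f ` ?J)" "u \<noteq> 0" by blast
  define z where "z = w + inverse u"
  have z: "f z = u" "z \<noteq> w" using u by (auto simp: z_def f_def)
  have "z \<in> ?O"
  proof -
    have "z \<notin> ?J" using u z fio by blast
    moreover have "z \<notin> ?I" using I u z fio by blast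
    ultimately show ?thesis using jio by blast
  qed
  then have meet: "f ` ?O \<inter> inside (f ` ?J) \<noteq> {}" using u z by blast
  have "connected (f ` ?O)"
    using jio wn by (intro connected_continuous_image continuous_on_subset[OF cont]) auto
  moreover have "f ` ?O \<inter> f ` ?J = {}"
    using injD[OF inj] outside_no_overlap[of ?J] by blast
  moreover have "frontier (inside (f ` ?J)) = f ` ?J" using fio by simp
  ultimately show ?thesis
    using connected_Int_frontier[of "f ` ?O" "inside (f ` ?J)"] meet by (metis Diff_eq_empty_iff)
qed

text \<open>Inversion at a point inside the curve reduces this to the bounded side.\<close>

lemma crosscut_outside:
  fixes c1 c2 c :: "real \<Rightarrow> complex"
  assumes arcs: "arc c1" "arc c2" "arc c"
    and ends: "pathstart c1 = s" "pathfinish c1 = t" "pathstart c2 = s" "pathfinish c2 = t"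
      "pathstart c = s" "pathfinish c = t"
    and int: "path_image c1 \<inter> path_image c2 = {s, t}" "path_image c1 \<inter> path_image c = {s, t}"
      "path_image c2 \<inter> path_image c = {s, t}"
    and c: "path_image c - {s, t} \<subseteq> outside (path_image c1 \<union> path_image c2)"
    and D: "connected D" "D \<subseteq> outside (path_image c1 \<union> path_image c2)" "D \<inter> path_image c = {}"
    and p: "p1 \<in> path_image c1 - {s, t}" "p1 \<in> closure D" "p2 \<in> path_image c2 - {s, t}" "p2 \<in> closure D"
  shows False
proof -
  define J where "J = path_image c1 \<union> path_image c2"
  define j where "j = c1 +++ reversepath c2"
  have j: "simple_path j" "pathfinish j = pathstart j" and jJ: "path_image j = J"
    using arcs ends int by (auto simp: j_def J_def path_image_join intro!: simple_path_join_loop arc_reversepath)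
  note jio = Jordan_inside_outside[OF j, unfolded jJ]
  then obtain w where w: "w \<in> inside J" by blast
  define f where "f = (\<lambda>z. inverse (z - w))"
  have out: "f ` outside J \<subseteq> inside (f ` J)"
    using inversion_outside[OF j, unfolded jJ, OF w] by (simp add: f_def)
  have wn: "w \<notin> J" "w \<notin> outside J" using w jio by blast+
  have cont: "continuous_on (- {w}) f" unfolding f_def by (intro continuous_intros) auto
  have inj: "inj f" unfolding f_def by (auto simp: inj_on_def)
  have arcf: "arc (f \<circ> g)" if "arc g" "w \<notin> path_image g" for g
    using that inj unfolding arc_def
    by (auto intro!: path_continuous_image continuous_on_subset[OF cont] comp_inj_on
             intro: inj_on_subset)
  have wc: "w \<notin> path_image c" using wn c int ends by (auto simp: J_def[symmetric]) (auto simp: J_def)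
  have clD: "closure D \<subseteq> J \<union> outside J"
  proof -
    have "closed J" using jJ j(1) by (metis closed_simple_path_image)
    then show ?thesis using D(2) closure_outside_subset[of J] closure_mono[of D "outside J"] by (auto simp: J_def)
  qed
  have fcl: "f ` closure D \<subseteq> closure (f ` D)"
    using clD wn by (intro image_closure_subset closed_closure closure_subset continuous_on_subset[OF cont]) auto
  have eq: "path_image (f \<circ> c1) \<union> path_image (f \<circ> c2) = f ` J"
    by (simp add: path_image_compose J_def image_Un)
  note im = image_Int[OF inj, symmetric]
  show False
  proof (rule crosscut_inside[of "f \<circ> c1" "f \<circ> c2" "f \<circ> c" "f s" "f t" "f ` D" "f p1" "f p2"], unfold eq)
    show "arc (f \<circ> c1)" "arc (f \<circ> c2)" "arc (f \<circ> c)" using arcs wn wc by (auto intro!: arcf simp: J_def)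
    show "path_image (f \<circ> c) - {f s, f t} \<subseteq> inside (f ` J)"
      using c out inj by (auto simp: path_image_compose J_def[symmetric] inj_eq)
    show "connected (f ` D)"
      using D wn by (intro connected_continuous_image continuous_on_subset[OF cont]) (auto simp: J_def)
    show "f ` D \<subseteq> inside (f ` J)" using D(2) out by (auto simp: J_def)
    show "f ` D \<inter> path_image (f \<circ> c) = {}"
      using D(3) by (simp add: path_image_compose im)
  qed (use ends int p fcl inj in \<open>auto simp: pathstart_compose pathfinish_compose path_image_compose im inj_eq\<close>)
qed

lemma crosscut:
  fixes c1 c2 c :: "real \<Rightarrow> complex"
  assumes "arc c1" "arc c2" "arc c"
    and "pathstart c1 = s" "pathfinish c1 = t" "pathstart c2 = s" "pathfinish c2 = t"
      "pathstart c = s" "pathfinish c = t"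
    and "path_image c1 \<inter> path_image c2 = {s, t}" "path_image c1 \<inter> path_image c = {s, t}"
      "path_image c2 \<inter> path_image c = {s, t}"
    and "X = inside (path_image c1 \<union> path_image c2) \<or> X = outside (path_image c1 \<union> path_image c2)"
    and "path_image c - {s, t} \<subseteq> X"
    and "connected D" "D \<subseteq> X" "D \<inter> path_image c = {}"
    and "p1 \<in> path_image c1 - {s, t}" "p1 \<in> closure D" "p2 \<in> path_image c2 - {s, t}" "p2 \<in> closure D"
  shows False
  using assms(13)
proof
  assume X: "X = inside (path_image c1 \<union> path_image c2)"
  show False
    by (rule crosscut_inside[OF assms(1-12) assms(14)[unfolded X] assms(15) assms(16)[unfolded X] assms(17-21)])
next
  assume X: "X = outside (path_image c1 \<union> path_image c2)"
  show False
    by (rule crosscut_outside[OF assms(1-12) assms(14)[unfolded X] assms(15) assms(16)[unfolded X] assms(17-21)])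
qed

section \<open>Nonplanarity of \<open>K_5\<close>, with a connected set as the fifth vertex\<close>

text \<open>The arcs \<open>c1\<close> and \<open>c2\<close> form a closed curve through
  \<open>s\<close>, \<open>p1\<close>, \<open>t\<close>, \<open>p2\<close>, in this cyclic order,
  and \<open>c\<close> and \<open>d\<close> are its chords. On the side of \<open>Q\<close>, the
  chord \<open>c\<close> would be crossed by \<open>h\<close>, and \<open>d\<close> would be crossed
  by \<open>g\<close>; if both chords are on the other side, they cross each other. The arcs
  \<open>g\<close> and \<open>h\<close> are used one at a time and may intersect.\<close>

lemma no_face_touches_all_of_K4:
  fixes c1 c2 c d g h :: "real \<Rightarrow> complex"
  assumes arcs: "arc c1" "arc c2" "arc c" "arc d" "arc g" "arc h"
    and ends: "pathstart c1 = s" "pathfinish c1 = t" "pathstart c2 = s" "pathfinish c2 = t"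
      "pathstart c = s" "pathfinish c = t" "pathstart g = s" "pathfinish g = t"
      "pathstart d = p1" "pathfinish d = p2" "pathstart h = p1" "pathfinish h = p2"
    and p: "p1 \<in> path_image c1 - {s, t}" "p2 \<in> path_image c2 - {s, t}"
    and int: "path_image c1 \<inter> path_image c2 = {s, t}" "path_image c1 \<inter> path_image c = {s, t}"
      "path_image c2 \<inter> path_image c = {s, t}" "path_image d \<inter> path_image c1 = {p1}"
      "path_image d \<inter> path_image c2 = {p2}" "path_image c \<inter> path_image d = {}"
    and Q: "connected Q" "Q \<inter> (path_image c1 \<union> path_image c2 \<union> path_image c \<union> path_image d) = {}"
    and gh: "path_image g \<subseteq> Q \<union> {s, t}" "path_image h \<subseteq> Q \<union> {p1, p2}"
  shows False
proof -
  define J where "J = path_image c1 \<union> path_image c2"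
  define j where "j = c1 +++ reversepath c2"
  have j: "simple_path j" "pathfinish j = pathstart j" and jJ: "path_image j = J"
    using arcs ends int by (auto simp: j_def J_def path_image_join intro!: simple_path_join_loop arc_reversepath)
  note jio = Jordan_inside_outside[OF j, unfolded jJ]
  have io: "open (inside J)" "open (outside J)" "inside J \<inter> outside J = {}" "inside J \<union> outside J = - J"
    using jio by auto
  have side: "S \<subseteq> inside J \<or> S \<subseteq> outside J" if "connected S" "S \<inter> J = {}" for S
  proof -
    have "S \<subseteq> inside J \<union> outside J" using io(4) that(2) by (simp add: disjoint_eq_subset_Compl)
    moreover have "inside J \<inter> outside J \<inter> S = {}" using io(3) by simp
    ultimately show ?thesis
      using connectedD[OF that(1) io(1,2)] by blast
  qed
  define c' d' h' where "c' = path_image c - {s, t}" and "d' = path_image d - {p1, p2}"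
    and "h' = path_image h - {p1, p2}"
  have con: "connected c'" "connected d'" "connected h'"
    using connected_arc_interior[OF arcs(3)] connected_arc_interior[OF arcs(4)]
      connected_arc_interior[OF arcs(6)] ends by (simp_all add: c'_def d'_def h'_def)
  have cl: "path_image d \<subseteq> closure d'" "path_image h \<subseteq> closure h'"
    using closure_arc_interior[OF arcs(4)] closure_arc_interior[OF arcs(6)] ends
    by (simp_all add: d'_def h'_def)
  have pin: "p1 \<in> closure d'" "p2 \<in> closure d'" "p1 \<in> closure h'" "p2 \<in> closure h'"
    using cl ends pathstart_in_path_image[of d] pathfinish_in_path_image[of d]
      pathstart_in_path_image[of h] pathfinish_in_path_image[of h] by auto
  have stg: "{s, t} \<subseteq> path_image g" "{s, t} \<subseteq> path_image c1" "{s, t} \<subseteq> path_image c2"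
    using ends pathstart_in_path_image[of g] pathfinish_in_path_image[of g]
      pathstart_in_path_image[of c1] pathfinish_in_path_image[of c1]
      pathstart_in_path_image[of c2] pathfinish_in_path_image[of c2] by auto
  have QJ: "Q \<inter> J = {}" using Q(2) by (auto simp: J_def)
  have "c' \<inter> path_image c1 = {}" using int(2) unfolding c'_def by blast
  moreover have "c' \<inter> path_image c2 = {}" using int(3) unfolding c'_def by blast
  moreover have "d' \<inter> path_image c1 = {}" using int(4) unfolding d'_def by blast
  moreover have "d' \<inter> path_image c2 = {}" using int(5) unfolding d'_def by blast
  ultimately have cJ: "c' \<inter> J = {}" "d' \<inter> J = {}" by (simp_all add: J_def Int_Un_distrib)
  have g: "path_image c1 \<inter> path_image g = {s, t}" "path_image c2 \<inter> path_image g = {s, t}"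
  proof -
    have "path_image c1 \<inter> Q = {}" "path_image c2 \<inter> Q = {}"
      using Q(2) by (simp_all add: Int_Un_distrib Int_commute)
    then have "path_image c1 \<inter> path_image g \<subseteq> {s, t}" "path_image c2 \<inter> path_image g \<subseteq> {s, t}"
      using gh(1) by blast+
    then show "path_image c1 \<inter> path_image g = {s, t}" "path_image c2 \<inter> path_image g = {s, t}"
      using stg by (simp_all add: subset_antisym)
  qed
  \<comment> \<open>\<open>X\<close> is the side that contains \<open>Q\<close>, \<open>Y\<close>
    the other one.\<close>
  define X where "X = (if Q \<subseteq> inside J then inside J else outside J)"
  define Y where "Y = (if Q \<subseteq> inside J then outside J else inside J)"
  have QX: "Q \<subseteq> X" using side[OF Q(1) QJ] by (auto simp: X_def)
  note cc = crosscut[OF arcs(1,2) _ ends(1-4), folded J_def, OF _ _ _ int(1)]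
  have X: "X = inside J \<or> X = outside J" "Y = inside J \<or> Y = outside J" by (auto simp: X_def Y_def)
  have "\<not> c' \<subseteq> X"
  proof
    assume cX: "c' \<subseteq> X"
    have "h' \<subseteq> Q" using gh(2) by (auto simp: h'_def)
    then have "h' \<subseteq> X" "h' \<inter> path_image c = {}" using QX Q(2) by auto
    then show False
      using cc[OF arcs(3) ends(5,6) int(2,3) X(1) cX[unfolded c'_def] con(3) _ _ p(1) pin(3) p(2) pin(4)] by blast
  qed
  \<comment> \<open>Here the crosscut is \<open>g\<close>, drawn through \<open>Q\<close>, and
    \<open>d'\<close> is the connected set that would have to cross it.\<close>
  moreover have "\<not> d' \<subseteq> X"
  proof
    assume dX: "d' \<subseteq> X"
    have gX: "path_image g - {s, t} \<subseteq> X" using gh(1) QX by blast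
    have "s \<in> path_image c1" "t \<in> path_image c1" "p1 \<noteq> s" "p1 \<noteq> t" using p(1) stg by auto
    then have "s \<notin> path_image d" "t \<notin> path_image d" using int(4) by auto
    moreover have "Q \<inter> path_image d = {}" using Q(2) by (simp add: Int_Un_distrib)
    ultimately have "d' \<inter> path_image g = {}" using gh(1) by (auto simp: d'_def)
    then show False
      using cc[OF arcs(5) ends(7,8) g X(1) gX con(2) dX _ p(1) pin(1) p(2) pin(2)] by blast
  qed
  ultimately have cY: "c' \<subseteq> Y" and dY: "d' \<subseteq> Y"
    using side[OF con(1) cJ(1)] side[OF con(2) cJ(2)] by (auto simp: X_def Y_def split: if_splits)
  have "d' \<inter> path_image c = {}" using int(6) by (auto simp: d'_def)
  then show False
    using cc[OF arcs(3) ends(5,6) int(2,3) X(2) cY[unfolded c'_def] con(2) dY _ p(1) pin(1) p(2) pin(2)] by blast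
qed

section \<open>Plane graphs\<close>

lemma plane_graph_arcE:
  assumes "plane_graph V A" "a \<in> A"
  obtains g x y where "arc g" "path_image g = a" "pathstart g = x" "pathfinish g = y"
    "a \<inter> V = {x, y}" "x \<noteq> y"
  using assms unfolding plane_graph_def by (metis arc_distinct_ends)

lemma plane_graph_finite:
  assumes "plane_graph V A"
  shows "finite V" "finite A"
proof -
  show V: "finite V" using assms by (simp add: plane_graph_def)
  have "inj_on (\<lambda>a. a \<inter> V) A" using assms by (auto simp: plane_graph_def inj_on_def)
  moreover have "(\<lambda>a. a \<inter> V) ` A \<subseteq> Pow V" by auto
  ultimately show "finite A" using V by (metis finite_Pow_iff finite_imageD finite_subset)
qed

lemma plane_graph_compact:
  assumes "plane_graph V A"
  shows "compact (V \<union> \<Union>A)" "\<And>B. B \<subseteq> A \<Longrightarrow> compact (\<Union>B)" "a \<in> A \<Longrightarrow> compact a"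
proof -
  have a: "compact a" if "a \<in> A" for a
    using plane_graph_arcE[OF assms that] compact_arc_image by metis
  then show "a \<in> A \<Longrightarrow> compact a" .
  show B: "compact (\<Union>B)" if "B \<subseteq> A" for B
    using that a plane_graph_finite(2)[OF assms] by (intro compact_Union) (auto intro: finite_subset)
  show "compact (V \<union> \<Union>A)"
    by (intro compact_Un B finite_imp_compact plane_graph_finite[OF assms]) auto
qed

lemma plane_graph_Int:
  assumes "plane_graph V A" "a \<in> A" "b \<in> A" "a \<noteq> b"
  shows "a \<inter> b \<subseteq> V"
  using assms by (auto simp: plane_graph_def)

lemma plane_graph_inj:
  assumes "plane_graph V A" "a \<in> A" "b \<in> A" "a \<inter> V = b \<inter> V"
  shows "a = b"
  using assms by (metis plane_graph_def)

lemma plane_graph_mono: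
  assumes "plane_graph V A" "B \<subseteq> A" "W \<subseteq> V" "\<And>b. b \<in> B \<Longrightarrow> b \<inter> V \<subseteq> W"
  shows "plane_graph W B"
proof -
  have eq: "b \<inter> W = b \<inter> V" if "b \<in> B" for b using assms(3) assms(4)[OF that] by blast
  show ?thesis
    unfolding plane_graph_def
  proof (intro conjI ballI impI)
    show "finite W" using assms plane_graph_finite finite_subset by blast
    fix a assume a: "a \<in> B"
    then show "\<exists>g. arc g \<and> path_image g = a \<and> a \<inter> W = {pathstart g, pathfinish g}"
      using assms(1,2) eq[OF a] unfolding plane_graph_def by auto
    fix b assume b: "b \<in> B" "a \<noteq> b"
    then show "a \<inter> b \<subseteq> W" using plane_graph_Int[OF assms(1)] a assms(2,4) by blast
    show "a \<inter> W \<noteq> b \<inter> W"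
      using plane_graph_inj[OF assms(1), of a b] eq[OF a] eq[OF b(1)] a b assms(2) by auto
  qed
qed

lemma face_basics:
  assumes "plane_graph V A" "Q \<in> faces V A"
  shows "open Q" "connected Q" "Q \<noteq> {}" "Q \<inter> V = {}" "\<And>a. a \<in> A \<Longrightarrow> Q \<inter> a = {}" "frontier Q \<subseteq> V \<union> \<Union>A"
proof -
  have cl: "closed (V \<union> \<Union>A)" using plane_graph_compact[OF assms(1)] compact_imp_closed by blast
  have Q: "Q \<in> components (- (V \<union> \<Union>A))" using assms by (simp add: faces_def)
  show "open Q" using open_components[OF open_Compl[OF cl] Q] .
  show "connected Q" "Q \<noteq> {}" using Q in_components_connected in_components_nonempty by auto
  have "Q \<subseteq> - (V \<union> \<Union>A)" using Q in_components_subset by auto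
  then show "Q \<inter> V = {}" "\<And>a. a \<in> A \<Longrightarrow> Q \<inter> a = {}" by auto
  show "frontier Q \<subseteq> V \<union> \<Union>A" using frontier_of_components_closed_complement[OF cl Q] .
qed

lemma face_vertices_eq:
  assumes "plane_graph V A" "Q \<in> faces V A"
  shows "face_vertices V Q = V \<inter> closure Q"
  using face_basics[OF assms] by (auto simp: face_vertices_def frontier_def interior_open)

lemma connected_subset_face:
  assumes "plane_graph V A" "Q \<in> faces V A" "connected S" "S \<inter> (V \<union> \<Union>A) = {}" "S \<inter> Q \<noteq> {}"
  shows "S \<subseteq> Q"
  using components_maximal[of Q "- (V \<union> \<Union>A)" S] assms by (auto simp: faces_def)

lemma connected_in_some_face:
  assumes "connected S" "S \<inter> (V \<union> \<Union>A) = {}" "S \<noteq> {}"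
  obtains Q where "Q \<in> faces V A" "S \<subseteq> Q"
  using assms exists_component_superset[of S "- (V \<union> \<Union>A)"] by (auto simp: faces_def)

lemma point_in_some_face:
  assumes "z \<notin> V" "z \<notin> \<Union>A"
  obtains Q where "Q \<in> faces V A" "z \<in> Q"
  using connected_in_some_face[of "{z}" V A] assms by auto

lemma connected_hits_face_boundary:
  assumes "plane_graph V A" "Q \<in> faces V A" "connected B" "B \<inter> Q \<noteq> {}" "B \<inter> (V \<union> \<Union>A) \<noteq> {}"
  obtains p where "p \<in> B" "p \<in> V \<union> \<Union>A" "p \<in> closure Q"
proof -
  have "B - Q \<noteq> {}" using assms(5) face_basics(4,5)[OF assms(1,2)] by blast
  then have "B \<inter> frontier Q \<noteq> {}" using connected_Int_frontier assms(3,4) by blast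
  then obtain p where "p \<in> B" "p \<in> frontier Q" by blast
  then show thesis using that[of p] face_basics(6)[OF assms(1,2)] by (auto simp: frontier_def)
qed

section \<open>Edges on face boundaries\<close>

text \<open>If an inner point of the edge \<open>a\<close> is on the boundary of \<open>Q\<close>, but another one is not, then
  \<open>Q\<close> is still a face after removing a piece of \<open>a\<close>; Janiszewski's theorem applied to the part
  of \<open>a\<close> that now ends freely gives a contradiction.\<close>

lemma edge_in_face_closure_aux:
  assumes pg: "plane_graph V A" "a \<in> A" and Q: "Q \<in> faces V A"
    and g: "arc g" "path_image g = a" "a \<inter> V = {g 0, g 1}"
    and st: "0 < s" "s < t" "t < 1" "g s \<in> closure Q"
  shows "g t \<in> closure Q"
proof (rule ccontr)
  assume nt: "g t \<notin> closure Q"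
  have cont: "continuous_on {0..1} g" and inj: "inj_on g {0..1}"
    using g(1) by (auto simp: arc_def path_def)
  have a: "a = g ` {0..1}" using g(2) by (simp add: path_image_def)
  note fb = face_basics[OF pg(1) Q]
  obtain d where d: "d > 0" "\<And>u. u \<in> {0..1} \<Longrightarrow> dist u t < d \<Longrightarrow> g u \<notin> closure Q"
  proof -
    have "open (- closure Q)" by auto
    then obtain e where e: "e > 0" "ball (g t) e \<subseteq> - closure Q" using nt by (auto elim: openE)
    have "t \<in> {0..1}" using st by auto
    then obtain d where "d > 0" "\<And>u. u \<in> {0..1} \<Longrightarrow> dist u t < d \<Longrightarrow> dist (g u) (g t) < e"
      using cont e(1) unfolding continuous_on_iff by blast
    then show thesis using that[of d] e(2) by (auto simp: dist_commute subset_iff)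
  qed
  \<comment> \<open>\<open>t0\<close> lies strictly between \<open>s\<close> and \<open>t\<close>
    and so close to \<open>t\<close> that the whole piece from \<open>t0\<close> to \<open>t\<close>
    stays off \<open>closure Q\<close>.\<close>
  define t0 where "t0 = max ((s + t) / 2) (t - d / 2)"
  have "t - d / 2 \<le> t0" by (simp add: t0_def)
  moreover have "(s + t) / 2 \<le> t0" "t0 < t" using st d(1) by (simp_all add: t0_def)
  ultimately have t0: "s < t0" "t0 < t" "t - t0 < d" using st d(1) by auto
  have gap: "g u \<notin> closure Q" if "t0 \<le> u" "u \<le> t" for u
    using that d(2)[of u] t0 st by (auto simp: dist_real_def)
  \<comment> \<open>Omitting the piece between \<open>t0\<close> and \<open>t\<close> leaves the
    graph as \<open>K \<union> e2\<close> together with the loose end \<open>e1\<close>, and this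
    still contains all of \<open>frontier Q\<close>.\<close>
  define K where "K = V \<union> \<Union>(A - {a})"
  define e1 where "e1 = g ` {0..t0}"
  define e2 where "e2 = g ` {t..1}"
  have e1: "e1 = path_image (subpath 0 t0 g)" using t0 st by (simp add: e1_def path_image_subpath)
  have arc1: "arc (subpath 0 t0 g)" using g(1) t0 st by (intro arc_subpath_arc) auto
  have c1: "compact e1" unfolding e1 using arc1 by (rule compact_arc_image)
  have c2: "compact e2" unfolding e2_def
    using st by (intro compact_continuous_image continuous_on_subset[OF cont]) auto
  have cK: "compact K" unfolding K_def
    by (intro compact_Un finite_imp_compact plane_graph_finite[OF pg(1)] plane_graph_compact(2)[OF pg(1)]) auto
  have notK: "g u \<notin> K" if "0 < u" "u < 1" for u
  proof -
    have u: "g u \<in> a" using that by (auto simp: a)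
    have "g u \<noteq> g 0" "g u \<noteq> g 1" using inj that by (auto simp: inj_on_eq_iff)
    then have "g u \<notin> V" using g(3) u by blast
    then show ?thesis using plane_graph_Int[OF pg(1) _ pg(2)] u by (auto simp: K_def)
  qed
  have note2: "g u \<notin> e2" if "0 \<le> u" "u < t" for u
  proof
    assume "g u \<in> e2"
    then obtain w where w: "w \<in> {t..1}" "g u = g w" by (auto simp: e2_def)
    then have "u = w" using inj that st by (auto dest: inj_onD)
    then show False using w that by auto
  qed
  have notK2: "g u \<notin> K \<union> e2" if "0 < u" "u < t" for u
    using that st notK note2 by auto
  \<comment> \<open>A single common point is connected, as Janiszewski's theorem requires.\<close>
  have inter: "(K \<union> e2) \<inter> e1 = {g 0}"
  proof
    show "(K \<union> e2) \<inter> e1 \<subseteq> {g 0}"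
    proof
      fix w assume "w \<in> (K \<union> e2) \<inter> e1"
      then obtain u where "0 \<le> u" "u \<le> t0" "w = g u" "g u \<in> K \<union> e2" by (auto simp: e1_def)
      then show "w \<in> {g 0}" using notK2[of u] t0 by (cases "u = 0") auto
    qed
    have "g 0 \<in> V" using g(3) by blast
    then show "{g 0} \<subseteq> (K \<union> e2) \<inter> e1" using t0 st by (auto simp: K_def e1_def)
  qed
  have fr: "frontier Q \<subseteq> K \<union> e2 \<union> e1"
  proof
    fix w assume w: "w \<in> frontier Q"
    then have wc: "w \<in> closure Q" by (simp add: frontier_def)
    have "w \<in> V \<union> \<Union>A" using fb(6) w by blast
    then have "w \<in> K \<or> w \<in> a" by (auto simp: K_def)
    then show "w \<in> K \<union> e2 \<union> e1"
    proof
      assume "w \<in> a"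
      then obtain u where u: "0 \<le> u" "u \<le> 1" "w = g u" by (auto simp: a)
      then have "u \<le> t0 \<or> t \<le> u" using gap[of u] wc by force
      then show ?thesis using u by (auto simp: e1_def e2_def)
    qed auto
  qed
  have ck2: "compact (K \<union> e2)" using cK c2 by (rule compact_Un)
  have op: "open (- (K \<union> e2))" by (rule open_Compl[OF compact_imp_closed[OF ck2]])
  have s0: "g s \<in> - (K \<union> e2)" and t0': "g t0 \<in> - (K \<union> e2)" using notK2 st t0 by auto
  obtain r where r: "r > 0" "ball (g s) r \<subseteq> - (K \<union> e2)" using op s0 by (auto elim: openE)
  obtain z where z: "z \<in> Q" "z \<in> ball (g s) r"
    using st(4) r(1) by (metis closure_approachable dist_commute mem_ball)
  have "open (- (K \<union> e2) \<inter> - closure Q)" using op by (intro open_Int) auto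
  moreover have "g t0 \<in> - (K \<union> e2) \<inter> - closure Q" using t0' gap[of t0] t0 by auto
  ultimately obtain r0 where r0: "r0 > 0" "ball (g t0) r0 \<subseteq> - (K \<union> e2) \<inter> - closure Q"
    by (auto elim: openE)
  obtain z0 where z0: "z0 \<in> ball (g t0) r0" "z0 \<notin> e1"
  proof -
    have "\<not> ball (g t0) r0 \<subseteq> e1"
      using not_open_subset_arc[OF arc1, of "ball (g t0) r0"] r0(1) unfolding e1 by (simp add: not_le)
    then show thesis using that by blast
  qed
  \<comment> \<open>With only \<open>K \<union> e2\<close> removed, \<open>z\<close> reaches
    \<open>z0\<close> by running along \<open>e1\<close> itself from \<open>g s\<close> to
    \<open>g t0\<close>; with only \<open>e1\<close> removed it does so because an arc does not
    separate the plane.\<close>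
  have "connected_component (- (K \<union> e2)) z (g s)"
    using z(2) r by (intro connected_componentI[of "ball (g s) r"]) auto
  moreover have "connected_component (- (K \<union> e2)) (g s) (g t0)"
  proof (rule connected_componentI)
    show "connected (g ` {s..t0})"
      using st t0 by (intro connected_continuous_image continuous_on_subset[OF cont]) auto
    show "g ` {s..t0} \<subseteq> - (K \<union> e2)" using notK2 st t0 by auto
  qed (use t0 in auto)
  moreover have "connected_component (- (K \<union> e2)) (g t0) z0"
    using z0 r0 by (intro connected_componentI[of "ball (g t0) r0"]) auto
  ultimately have con2: "connected_component (- (K \<union> e2)) z z0"
    by (meson connected_component_trans)
  have "z \<notin> e1" using z(1) fb(5)[OF pg(2)] t0 st by (auto simp: e1_def a)
  then have con1: "connected_component (- e1) z z0"
    using z0 connected_arc_complement[OF arc1] unfolding e1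
    by (intro connected_componentI[of "- path_image (subpath 0 t0 g)"]) auto
  have "connected_component (- ((K \<union> e2) \<union> e1)) z z0"
    by (rule Janiszewski[OF ck2 compact_imp_closed[OF c1] _ con2 con1]) (simp add: inter)
  then obtain Y where Y: "connected Y" "Y \<subseteq> - ((K \<union> e2) \<union> e1)" "z \<in> Y" "z0 \<in> Y"
    unfolding connected_component_def by blast
  have "Y \<subseteq> Q"
  proof (rule ccontr)
    assume "\<not> Y \<subseteq> Q"
    then have "Y \<inter> frontier Q \<noteq> {}" using connected_Int_frontier[OF Y(1), of Q] Y(3) z(1) by blast
    then show False using fr Y(2) by blast
  qed
  then have "z0 \<in> closure Q" using Y(4) closure_subset by blast
  then show False using z0 r0 by blast
qed

text \<open>The auxiliary lemma moves forward along the edge. Reversing the arc gives the other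
  direction, and the ends are limits of inner points.\<close>

lemma edge_in_face_closure:
  assumes pg: "plane_graph V A" "a \<in> A" and Q: "Q \<in> faces V A"
    and p: "p \<in> a" "p \<notin> V" "p \<in> closure Q"
  shows "a \<subseteq> closure Q"
proof -
  obtain g x y where g: "arc g" "path_image g = a" "pathstart g = x" "pathfinish g = y" "a \<inter> V = {x, y}"
    using plane_graph_arcE[OF pg] by metis
  have ends: "a \<inter> V = {g 0, g 1}" using g by (simp add: pathstart_def pathfinish_def)
  have aint: "a - V = g ` {0<..<1}"
  proof -
    have "a - V = a - {x, y}" using g(5) by blast
    then show ?thesis using arc_interior_image[OF g(1)] g(2-4) by simp
  qed
  obtain s where s: "0 < s" "s < 1" "p = g s"
  proof -
    have "p \<in> a - V" using p by blast
    then show thesis using that unfolding aint by auto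
  qed
  have "g t \<in> closure Q" if t: "0 < t" "t < 1" for t
  proof -
    consider "s = t" | "s < t" | "t < s" by linarith
    then show ?thesis
    proof cases
      case 3
      have r: "arc (reversepath g)" "path_image (reversepath g) = a" using g by (auto simp: arc_reversepath)
      have r3: "a \<inter> V = {reversepath g 0, reversepath g 1}" using ends by (auto simp: reversepath_def)
      have "reversepath g (1 - t) \<in> closure Q"
        by (rule edge_in_face_closure_aux[OF pg Q r r3, of "1 - s"])
           (use 3 s t p in \<open>auto simp: reversepath_def\<close>)
      then show ?thesis by (simp add: reversepath_def)
    qed (use edge_in_face_closure_aux[OF pg Q g(1,2) ends, of s t] s t p in auto)
  qed
  then have "closure (a - V) \<subseteq> closure Q" unfolding aint by (intro closure_minimal) auto
  moreover have "a - V = path_image g - {pathstart g, pathfinish g}" using g by auto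
  ultimately show ?thesis using closure_arc_interior[OF g(1)] g(2) by auto
qed

text \<open>Near an inner point of \<open>a\<close> there is nothing else of the graph, so a face
  that comes near has a boundary point on \<open>a\<close> inside the ball, and this brings all of
  \<open>a\<close> into its closure.\<close>

lemma near_edge:
  assumes pg: "plane_graph V A" "a \<in> A" and p: "p \<in> a" "p \<notin> V"
  obtains e where "e > 0" "ball p e \<inter> (V \<union> \<Union>A) \<subseteq> a - V"
    "\<And>Q. Q \<in> faces V A \<Longrightarrow> Q \<inter> ball p e \<noteq> {} \<Longrightarrow> a \<subseteq> closure Q"
proof -
  define K where "K = V \<union> \<Union>(A - {a})"
  have "compact K" unfolding K_def
    by (intro compact_Un finite_imp_compact plane_graph_finite[OF pg(1)] plane_graph_compact(2)[OF pg(1)]) auto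
  then have "open (- K)" using compact_imp_closed by auto
  moreover have "p \<in> - K" using p plane_graph_Int[OF pg(1) _ pg(2)] by (auto simp: K_def)
  ultimately obtain e where e: "e > 0" "ball p e \<subseteq> - K" by (auto elim: openE)
  then have sub: "ball p e \<inter> (V \<union> \<Union>A) \<subseteq> a - V" by (auto simp: K_def)
  have "a \<subseteq> closure Q" if Q: "Q \<in> faces V A" "Q \<inter> ball p e \<noteq> {}" for Q
  proof -
    have "p \<in> ball p e" using e(1) by simp
    then have "ball p e \<inter> (V \<union> \<Union>A) \<noteq> {}" using p(1) pg(2) by blast
    then obtain q where q: "q \<in> ball p e" "q \<in> V \<union> \<Union>A" "q \<in> closure Q"
      using connected_hits_face_boundary[OF pg(1) Q(1), of "ball p e"] Q(2) by (auto simp: Int_commute)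
    then have "q \<in> a - V" using sub by blast
    then show ?thesis using edge_in_face_closure[OF pg Q(1)] q(3) by blast
  qed
  then show thesis using that e(1) sub by blast
qed

text \<open>A small ball about an inner point is not covered by the arc, so some face comes
  near.\<close>

lemma edge_in_some_face_closure:
  assumes pg: "plane_graph V A" "a \<in> A"
  obtains Q where "Q \<in> faces V A" "a \<subseteq> closure Q"
proof -
  obtain g x y where g: "arc g" "path_image g = a" "a \<inter> V = {x, y}" "pathstart g = x" "pathfinish g = y"
    using plane_graph_arcE[OF pg] by metis
  have "path_image g - {pathstart g, pathfinish g} \<noteq> {}" using arc_interior_image[OF g(1)] by auto
  then obtain p where p: "p \<in> a" "p \<notin> V" using g by auto
  from near_edge[OF pg p] obtain e where e: "e > 0" "ball p e \<inter> (V \<union> \<Union>A) \<subseteq> a - V"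
    "\<And>Q. Q \<in> faces V A \<Longrightarrow> Q \<inter> ball p e \<noteq> {} \<Longrightarrow> a \<subseteq> closure Q" by blast
  obtain z where z: "z \<in> ball p e" "z \<notin> a"
  proof -
    have "\<not> ball p e \<subseteq> a"
      using not_open_subset_arc[OF g(1), of "ball p e"] e(1) unfolding g(2) by (simp add: not_le)
    then show thesis using that by blast
  qed
  then have "z \<notin> V" "z \<notin> \<Union>A" using e(2) by auto
  then obtain Q where "Q \<in> faces V A" "z \<in> Q" by (rule point_in_some_face)
  then show thesis using that e(3) z by blast
qed

section \<open>Drawings that are straight near the vertices\<close>

text \<open>Arbitrary arcs may spiral or oscillate at their ends. Once each is a single radius near
  a vertex, radial segments give access from a face to its boundary vertices, and a small circle
  about a vertex meets each incident edge exactly once.\<close>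

definition tame :: "real \<Rightarrow> complex set \<Rightarrow> complex set set \<Rightarrow> bool" where
  "tame r V A \<longleftrightarrow> plane_graph V A \<and> r > 0 \<and>
     (\<forall>x\<in>V. \<forall>y\<in>V. x \<noteq> y \<longrightarrow> y \<notin> cball x r) \<and>
     (\<forall>a\<in>A. \<forall>x\<in>V. (x \<in> a \<longrightarrow> (\<exists>p. dist x p = r \<and> a \<inter> cball x r = closed_segment x p)) \<and>
                     (x \<notin> a \<longrightarrow> a \<inter> cball x r = {}))"

lemma tameD:
  assumes "tame r V A"
  shows "plane_graph V A" "r > 0"
    "\<And>x y. x \<in> V \<Longrightarrow> y \<in> V \<Longrightarrow> x \<noteq> y \<Longrightarrow> y \<notin> cball x r"
    "\<And>a x. a \<in> A \<Longrightarrow> x \<in> V \<Longrightarrow> x \<notin> a \<Longrightarrow> a \<inter> cball x r = {}"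
    "\<And>a x. a \<in> A \<Longrightarrow> x \<in> V \<Longrightarrow> x \<in> a \<Longrightarrow> \<exists>p. dist x p = r \<and> a \<inter> cball x r = closed_segment x p"
  using assms unfolding tame_def by blast+

text \<open>A point \<open>w\<close> common to the segment and an edge would put \<open>z\<close> on
  the same ray as the radius of that edge, and \<open>dist x z < r\<close> would put it on the
  radius itself.\<close>

lemma tame_ray:
  assumes t: "tame r V A" and x: "x \<in> V" and z: "z \<in> ball x r" "z \<notin> \<Union>A"
  shows "(closed_segment x z - {x}) \<inter> (V \<union> \<Union>A) = {}"
proof (rule ccontr)
  assume "\<not> ?thesis"
  then obtain w where w: "w \<in> closed_segment x z" "w \<noteq> x" "w \<in> V \<union> \<Union>A" by blast
  have "closed_segment x z \<subseteq> ball x r"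
    using z(1) tameD(2)[OF t] by (intro closed_segment_subset) auto
  then have wb: "w \<in> cball x r" using w(1) by auto
  then have "w \<notin> V" using tameD(3)[OF t x _ w(2)[symmetric]] by blast
  then obtain a where a: "a \<in> A" "w \<in> a" using w(3) by blast
  then have "x \<in> a" using tameD(4)[OF t a(1) x] wb by blast
  then obtain p where p: "dist x p = r" "a \<inter> cball x r = closed_segment x p"
    using tameD(5)[OF t a(1) x] by blast
  have "w \<in> closed_segment x p" using p(2) a(2) wb by blast
  then obtain s where s: "0 \<le> s" "s \<le> 1" "w = (1 - s) *\<^sub>R x + s *\<^sub>R p" by (auto simp: closed_segment_def)
  obtain u where u: "0 \<le> u" "u \<le> 1" "w = (1 - u) *\<^sub>R x + u *\<^sub>R z" using w(1) by (auto simp: closed_segment_def)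
  have "u \<noteq> 0" using u(3) w(2) by auto
  then have u0: "u > 0" using u by simp
  have eq: "u *\<^sub>R (z - x) = s *\<^sub>R (p - x)"
  proof -
    have "w - x = u *\<^sub>R (z - x)" unfolding u(3) by (simp add: algebra_simps)
    moreover have "w - x = s *\<^sub>R (p - x)" unfolding s(3) by (simp add: algebra_simps)
    ultimately show ?thesis by simp
  qed
  \<comment> \<open>Comparing lengths: since \<open>dist x z < r = dist x p\<close>, the parameters
    satisfy \<open>s \<le> u\<close>, so \<open>s / u\<close> is a valid parameter on the
    radius.\<close>
  then have "u * dist x z = s * dist x p"
    using u0 s(1) by (metis abs_of_nonneg abs_of_pos dist_commute dist_norm norm_scaleR)
  then have su: "s \<le> u" using z(1) p(1) tameD(2)[OF t] u0
    by (metis less_eq_real_def mem_ball mult_le_cancel_right mult_left_mono not_le)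
  have "z - x = (s / u) *\<^sub>R (p - x)"
  proof -
    have "z - x = (1 / u) *\<^sub>R (u *\<^sub>R (z - x))" using u0 by simp
    then show ?thesis unfolding eq by simp
  qed
  then have "z = (1 - s / u) *\<^sub>R x + (s / u) *\<^sub>R p"
    by (simp add: algebra_simps)
  moreover have "0 \<le> s / u" "s / u \<le> 1" using s u0 su by auto
  ultimately have "z \<in> closed_segment x p" by (auto simp: closed_segment_def)
  then have "z \<in> a" using p(2) by blast
  then show False using z(2) a(1) by blast
qed

lemma tame_access:
  assumes t: "tame r V A" and Q: "Q \<in> faces V A" and x: "x \<in> V" and z: "z \<in> Q" "z \<in> ball x r"
  shows "closed_segment x z - {x} \<subseteq> Q" "x \<in> closure Q"
proof -
  note fb = face_basics[OF tameD(1)[OF t] Q]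
  have zA: "z \<notin> \<Union>A" using fb(5) z(1) by blast
  have xz: "x \<noteq> z" using fb(4) z(1) x by blast
  have arc: "arc (linepath z x)" using xz by simp
  have "connected (closed_segment x z - {x})"
    using connected_arc_minus_finish[OF arc] by (simp add: closed_segment_commute)
  then show sub: "closed_segment x z - {x} \<subseteq> Q"
    using tame_ray[OF t x z(2) zA] xz z(1)
    by (intro connected_subset_face[OF tameD(1)[OF t] Q]) auto
  have "x \<in> closure (open_segment x z)" using xz by (simp add: closure_open_segment)
  then show "x \<in> closure Q" using sub closure_mono[of "open_segment x z" Q] by (auto simp: open_segment_def)
qed

text \<open>The face and two radial segments form a path-connected set, in which any two points are
  joined by an arc. Such arcs serve both as new edges and as crosscuts in the \<open>K_5\<close>
  argument.\<close>

lemma tame_crosscut: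
  assumes t: "tame r V A" and Q: "Q \<in> faces V A" and x: "x \<in> V" "x \<in> closure Q" and y: "y \<in> V" "y \<in> closure Q"
    and "x \<noteq> y"
  obtains g where "arc g" "pathstart g = x" "pathfinish g = y" "path_image g \<subseteq> Q \<union> {x, y}"
proof -
  note fb = face_basics[OF tameD(1)[OF t] Q]
  have ex: "\<exists>z\<in>Q. z \<in> ball x r" if "x \<in> closure Q" for x
    using that tameD(2)[OF t] by (metis closure_approachable dist_commute mem_ball)
  obtain zx where zx: "zx \<in> Q" "zx \<in> ball x r" using ex x by blast
  obtain zy where zy: "zy \<in> Q" "zy \<in> ball y r" using ex y by blast
  define S where "S = (closed_segment x zx \<union> Q) \<union> closed_segment y zy"
  have "path_connected Q" using fb(1,2) connected_open_path_connected by blast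
  moreover have "path_connected (closed_segment x zx)" "path_connected (closed_segment y zy)"
    by (simp_all add: convex_imp_path_connected)
  ultimately have "path_connected S" unfolding S_def
    using zx(1) zy(1) by (intro path_connected_Un) auto
  moreover have "x \<in> S" "y \<in> S" by (auto simp: S_def)
  ultimately obtain g where g: "arc g" "path_image g \<subseteq> S" "pathstart g = x" "pathfinish g = y"
    using \<open>x \<noteq> y\<close> unfolding path_connected_arcwise by blast
  have "S \<subseteq> Q \<union> {x, y}"
    using tame_access(1)[OF t Q x(1) zx] tame_access(1)[OF t Q y(1) zy] by (auto simp: S_def)
  then show thesis using that g by blast
qed

text \<open>Follow the circle about \<open>v\<close> through a point \<open>z\<close> of
  \<open>Q\<close> in both directions until an edge is first met: both edges touch \<open>Q\<close>.
  They differ because an edge at \<open>v\<close> meets the circle only once, whereas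
  \<open>a\<close> and \<open>b\<close> produce at least two hits.\<close>

lemma two_edges_in_face_closure:
  assumes t: "tame r V A" and Q: "Q \<in> faces V A" and v: "v \<in> V" "v \<in> closure Q"
    and ab: "a \<in> A" "b \<in> A" "a \<noteq> b" "v \<in> a" "v \<in> b"
  obtains a' b' where "a' \<in> A" "b' \<in> A" "a' \<noteq> b'" "v \<in> a'" "v \<in> b'" "a' \<subseteq> closure Q" "b' \<subseteq> closure Q"
proof -
  have pg: "plane_graph V A" using tameD(1)[OF t] .
  note fb = face_basics[OF pg Q]
  obtain z where z: "z \<in> Q" "z \<in> ball v r"
    using v tameD(2)[OF t] by (metis closure_approachable dist_commute mem_ball)
  define \<rho> where "\<rho> = dist v z"
  have zv: "z \<noteq> v" using fb(4) z(1) v by blast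
  have \<rho>: "0 < \<rho>" "\<rho> < r" using zv z(2) by (auto simp: \<rho>_def)
  define \<gamma> where "\<gamma> = (\<lambda>\<theta>. v + (z - v) * cis \<theta>)"
  have cont: "continuous_on S \<gamma>" for S unfolding \<gamma>_def by (intro continuous_intros)
  have dg: "dist v (\<gamma> \<theta>) = \<rho>" for \<theta> by (simp add: \<gamma>_def \<rho>_def dist_norm norm_mult norm_minus_commute)
  have gball: "\<gamma> \<theta> \<in> ball v r" "\<gamma> \<theta> \<in> cball v r" "\<gamma> \<theta> \<noteq> v" for \<theta>
    using dg[of \<theta>] \<rho> by (auto intro: less_imp_le)
  have gV: "\<gamma> \<theta> \<notin> V" for \<theta> using tameD(3)[OF t v(1)] gball by metis
  have gz: "\<gamma> 0 = z" "\<gamma> (2 * pi) = z" by (simp_all add: \<gamma>_def)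
  have zA: "z \<notin> \<Union>A" using fb(5) z(1) by blast
  define \<Theta> where "\<Theta> = {0..2*pi} \<inter> \<gamma> -` (\<Union>A)"
  have "closed (\<Union>A)" using plane_graph_compact(2)[OF pg order_refl] compact_imp_closed by blast
  then have "closed \<Theta>" unfolding \<Theta>_def by (intro continuous_closed_preimage cont) auto
  then have com: "compact \<Theta>" by (auto simp: \<Theta>_def compact_eq_bounded_closed intro: bounded_subset[of "{0..2*pi}"])
  have hit: "\<exists>\<theta>\<in>\<Theta>. \<gamma> \<theta> \<in> c" if c: "c \<in> A" "v \<in> c" for c
  proof -
    obtain p where p: "dist v p = r" "c \<inter> cball v r = closed_segment v p"
      using tameD(5)[OF t c(1) v(1) c(2)] by blast
    \<comment> \<open>The angle at which the circle meets the radius towards \<open>p\<close>,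
      measured from the direction of \<open>z\<close>, is the argument of this quotient.\<close>
    define q where "q = (p - v) / (z - v)"
    define \<theta> where "\<theta> = Arg2pi q"
    have nq: "norm q = r / \<rho>" using p(1) by (simp add: q_def norm_divide \<rho>_def dist_norm norm_minus_commute)
    have q: "q = of_real (norm q) * cis \<theta>"
      using Arg2pi[of q] unfolding \<theta>_def cis_conv_exp by (metis is_Arg_def)
    have "\<gamma> \<theta> = v + of_real (\<rho> / r) * (p - v)"
    proof -
      have "p - v = (z - v) * q" using zv by (simp add: q_def)
      also have "\<dots> = of_real (r / \<rho>) * ((z - v) * cis \<theta>)" by (subst q) (simp add: nq mult_ac)
      finally have "of_real (\<rho> / r) * (p - v) = (of_real (\<rho> / r) * of_real (r / \<rho>)) * ((z - v) * cis \<theta>)"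
        by (simp only: mult.assoc)
      also have "of_real (\<rho> / r) * of_real (r / \<rho>) = (1::complex)"
        using \<rho> by (simp flip: of_real_mult)
      finally show ?thesis by (simp add: \<gamma>_def)
    qed
    also have "\<dots> = (1 - \<rho> / r) *\<^sub>R v + (\<rho> / r) *\<^sub>R p"
      by (simp add: scaleR_conv_of_real algebra_simps diff_divide_distrib)
    finally have "\<gamma> \<theta> \<in> closed_segment v p"
      using \<rho> by (auto simp: closed_segment_def intro!: exI[of _ "\<rho> / r"])
    then have "\<gamma> \<theta> \<in> c" using p(2) by blast
    moreover have "\<theta> \<in> {0..2*pi}" unfolding \<theta>_def using Arg2pi[of q] by auto
    ultimately show ?thesis using c(1) by (intro bexI[of _ \<theta>]) (auto simp: \<Theta>_def)
  qed
  obtain \<theta>a where \<theta>a: "\<theta>a \<in> \<Theta>" "\<gamma> \<theta>a \<in> a" using hit ab by blast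
  obtain \<theta>b where \<theta>b: "\<theta>b \<in> \<Theta>" "\<gamma> \<theta>b \<in> b" using hit ab by blast
  have ne: "\<theta>a \<noteq> \<theta>b" using plane_graph_Int[OF pg ab(1-3)] gV \<theta>a \<theta>b by blast
  have "\<Theta> \<noteq> {}" using \<theta>a by blast
  then obtain \<theta>1 \<theta>2 where \<theta>1: "\<theta>1 \<in> \<Theta>" "\<And>\<theta>. \<theta> \<in> \<Theta> \<Longrightarrow> \<theta>1 \<le> \<theta>"
    and \<theta>2: "\<theta>2 \<in> \<Theta>" "\<And>\<theta>. \<theta> \<in> \<Theta> \<Longrightarrow> \<theta> \<le> \<theta>2"
    using compact_attains_inf[OF com] compact_attains_sup[OF com] by metis
  have lt: "\<theta>1 < \<theta>2" using \<theta>1(2)[OF \<theta>a(1)] \<theta>1(2)[OF \<theta>b(1)] \<theta>2(2)[OF \<theta>a(1)] \<theta>2(2)[OF \<theta>b(1)] ne by linarith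
  \<comment> \<open>The point \<open>z\<close>, at the angles \<open>0\<close> and
    \<open>2 * pi\<close>, is off the graph, so both extreme angles are interior and the circular
    arcs adjacent to \<open>z\<close> stay in \<open>Q\<close>.\<close>
  have notz: "\<theta> \<notin> \<Theta>" if "\<gamma> \<theta> = z" for \<theta> using zA that by (auto simp: \<Theta>_def)
  have b1: "0 < \<theta>1" using \<theta>1(1) notz[OF gz(1)] by (cases "\<theta>1 = 0") (simp_all add: \<Theta>_def)
  have b2: "\<theta>2 < 2 * pi" using \<theta>2(1) notz[OF gz(2)] by (cases "\<theta>2 = 2*pi") (simp_all add: \<Theta>_def)
  have inQ: "\<gamma> ` {0..<\<theta>1} \<subseteq> Q" "\<gamma> ` {\<theta>2<..2*pi} \<subseteq> Q"
  proof -
    have "\<gamma> \<theta> \<notin> \<Union>A" if "0 \<le> \<theta>" "\<theta> < \<theta>1" for \<theta>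
      using that \<theta>1(2)[of \<theta>] lt b2 by (force simp: \<Theta>_def)
    then have "\<gamma> ` {0..<\<theta>1} \<inter> (V \<union> \<Union>A) = {}" using gV by auto
    moreover have "\<gamma> 0 \<in> \<gamma> ` {0..<\<theta>1}" using b1 by (intro imageI) auto
    ultimately show "\<gamma> ` {0..<\<theta>1} \<subseteq> Q"
      using gz(1) z(1)
      by (intro connected_subset_face[OF pg Q] connected_continuous_image cont) auto
    have "\<gamma> \<theta> \<notin> \<Union>A" if "\<theta>2 < \<theta>" "\<theta> \<le> 2 * pi" for \<theta>
      using that \<theta>2(2)[of \<theta>] lt b1 by (force simp: \<Theta>_def)
    then have "\<gamma> ` {\<theta>2<..2*pi} \<inter> (V \<union> \<Union>A) = {}" using gV by auto
    moreover have "\<gamma> (2 * pi) \<in> \<gamma> ` {\<theta>2<..2*pi}" using b2 by (intro imageI) auto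
    ultimately show "\<gamma> ` {\<theta>2<..2*pi} \<subseteq> Q"
      using gz(2) z(1)
      by (intro connected_subset_face[OF pg Q] connected_continuous_image cont) auto
  qed
  have "\<gamma> ` closure {0..<\<theta>1} \<subseteq> closure Q"
    using inQ(1) closure_subset by (intro image_closure_subset cont) auto
  then have cl1: "\<gamma> \<theta>1 \<in> closure Q" using b1 by (simp add: image_subset_iff)
  have "\<gamma> ` closure {\<theta>2<..2*pi} \<subseteq> closure Q"
    using inQ(2) closure_subset by (intro image_closure_subset cont) auto
  then have cl2: "\<gamma> \<theta>2 \<in> closure Q" using b2 by (simp add: image_subset_iff)
  obtain a' where a': "a' \<in> A" "\<gamma> \<theta>1 \<in> a'" using \<theta>1(1) by (auto simp: \<Theta>_def)
  obtain b' where b': "b' \<in> A" "\<gamma> \<theta>2 \<in> b'" using \<theta>2(1) by (auto simp: \<Theta>_def)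
  have va: "v \<in> a'" using tameD(4)[OF t a'(1) v(1)] gball(2) a'(2) by blast
  have vb: "v \<in> b'" using tameD(4)[OF t b'(1) v(1)] gball(2) b'(2) by blast
  have "a' \<noteq> b'"
  proof
    assume eq: "a' = b'"
    obtain p where p: "dist v p = r" "a' \<inter> cball v r = closed_segment v p"
      using tameD(5)[OF t a'(1) v(1) va] by blast
    have seg: "w = v + (\<rho> / r) *\<^sub>R (p - v)" if w: "w \<in> closed_segment v p" "dist v w = \<rho>" for w
    proof -
      obtain s where s: "0 \<le> s" "w = (1 - s) *\<^sub>R v + s *\<^sub>R p" using w(1) by (auto simp: closed_segment_def)
      then have ws: "w = v + s *\<^sub>R (p - v)" by (simp add: algebra_simps)
      then have "\<rho> = s * r" using w(2) s(1) p(1) by (simp add: dist_norm norm_minus_commute)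
      then show ?thesis using ws \<rho> by simp
    qed
    have "\<gamma> \<theta>1 \<in> closed_segment v p" "\<gamma> \<theta>2 \<in> closed_segment v p" using p(2) a'(2) b'(2) eq gball(2) by blast+
    then have "\<gamma> \<theta>1 = \<gamma> \<theta>2" using seg dg by metis
    then have "cis \<theta>1 = cis \<theta>2" using zv by (simp add: \<gamma>_def)
    then have "cis (\<theta>2 - \<theta>1) = 1" by (simp flip: cis_divide)
    then have "cos (\<theta>2 - \<theta>1) = 1" by (metis cis.simps(1) one_complex.simps(1))
    \<comment> \<open>The difference of the angles is a multiple of \<open>2 * pi\<close> lying
      strictly between \<open>0\<close> and \<open>2 * pi\<close>.\<close>
    then obtain n :: int where n: "\<theta>2 - \<theta>1 = of_int n * 2 * pi" using cos_one_2pi_int by blast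
    have "0 < of_int n * (2 * pi)" "of_int n * (2 * pi) < 1 * (2 * pi)" using lt b1 b2 n by linarith+
    then have "0 < real_of_int n" "real_of_int n < 1"
      using pi_gt_zero by (simp_all only: zero_less_mult_iff mult_less_cancel_right) auto
    then show False by simp
  qed
  then show thesis
    using that a' b' va vb edge_in_face_closure[OF pg a'(1) Q a'(2) gV cl1]
      edge_in_face_closure[OF pg b'(1) Q b'(2) gV cl2] by blast
qed

section \<open>Redrawing the edges as radii near the vertices\<close>

text \<open>The arc may leave a disc and return many times, so it is cut at its last visit to the
  disc about \<open>x\<close> and at its first later visit to the disc about \<open>y\<close>. The
  piece between touches each disc in one point, and radii complete it.\<close>

lemma straighten_arc_ends:
  fixes g :: "real \<Rightarrow> complex"
  assumes g: "arc g" "pathstart g = x" "pathfinish g = y" and r: "r > 0" "cball x r \<inter> cball y r = {}"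
  obtains h p q where "arc h" "pathstart h = x" "pathfinish h = y"
    "p \<in> path_image g" "dist x p = r" "path_image h \<inter> cball x r = closed_segment x p"
    "q \<in> path_image g" "dist y q = r" "path_image h \<inter> cball y r = closed_segment y q"
    "path_image h \<subseteq> path_image g \<union> cball x r \<union> cball y r"
proof -
  have cont: "continuous_on {0..1} g" and inj: "inj_on g {0..1}"
    using g(1) by (auto simp: arc_def path_def)
  have g01: "g 0 = x" "g 1 = y" using g by (auto simp: pathstart_def pathfinish_def)
  have xy: "x \<in> cball x r" "y \<in> cball y r" using r(1) by auto
  have com: "compact ({u..1} \<inter> g -` cball z r)" if "0 \<le> u" for u z
  proof -
    have "closed ({u..1} \<inter> g -` cball z r)"
      using that by (intro continuous_closed_preimage continuous_on_subset[OF cont]) auto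
    then show ?thesis by (auto simp: compact_eq_bounded_closed intro: bounded_subset[of "{u..1}"])
  qed
  have "0 \<in> {0..1} \<inter> g -` cball x r" using xy g01 by auto
  then obtain t0 where t0: "t0 \<in> {0..1} \<inter> g -` cball x r"
    and t0max: "\<And>t. t \<in> {0..1} \<inter> g -` cball x r \<Longrightarrow> t \<le> t0"
    using compact_attains_sup[OF com[of 0 x]] by (metis empty_iff order_refl)
  have t0x: "0 \<le> t0" "t0 \<le> 1" "g t0 \<in> cball x r" using t0 by auto
  have "1 \<in> {t0..1} \<inter> g -` cball y r" using xy g01 t0x by auto
  then obtain t1 where t1: "t1 \<in> {t0..1} \<inter> g -` cball y r"
    and t1min: "\<And>t. t \<in> {t0..1} \<inter> g -` cball y r \<Longrightarrow> t1 \<le> t"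
    using compact_attains_inf[OF com[OF t0x(1), of y]] by (metis empty_iff)
  have t1y: "t0 \<le> t1" "t1 \<le> 1" "g t1 \<in> cball y r" using t1 by auto
  have t01: "t0 < t1" using t0x t1y r(2) by (cases "t0 = t1") auto
  have out: "t = t0" if "t \<in> {t0..t1}" "g t \<in> cball x r" for t
    using t0max[of t] that t0x t1y by auto
  have out': "t = t1" if "t \<in> {t0..t1}" "g t \<in> cball y r" for t
    using t1min[of t] that t0x t1y by auto
  have conn: "connected (g ` {t0..t1})"
    using t0x t1y by (intro connected_continuous_image continuous_on_subset[OF cont]) auto
  have in0: "g t0 \<in> g ` {t0..t1}" and in1: "g t1 \<in> g ` {t0..t1}" using t01 by auto
  have y0: "g t1 \<notin> cball x r" and x0: "g t0 \<notin> cball y r" using t0x t1y r(2) by blast+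
  have p: "dist x (g t0) = r"
  proof -
    have "g ` {t0..t1} \<inter> frontier (cball x r) \<noteq> {}"
      using in0 in1 t0x(3) y0 by (intro connected_Int_frontier[OF conn]) blast+
    then obtain w where w: "w \<in> g ` {t0..t1}" "w \<in> frontier (cball x r)" by blast
    have "w \<in> sphere x r" using w(2) r(1) by (simp add: frontier_cball)
    then obtain t where t: "t \<in> {t0..t1}" "g t \<in> sphere x r" using w(1) by (metis imageE)
    then have "t = t0" using out[of t] by auto
    then show ?thesis using t(2) by simp
  qed
  have q: "dist y (g t1) = r"
  proof -
    have "g ` {t0..t1} \<inter> frontier (cball y r) \<noteq> {}"
      using in0 in1 t1y(3) x0 by (intro connected_Int_frontier[OF conn]) blast+
    then obtain w where w: "w \<in> g ` {t0..t1}" "w \<in> frontier (cball y r)" by blast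
    have "w \<in> sphere y r" using w(2) r(1) by (simp add: frontier_cball)
    then obtain t where t: "t \<in> {t0..t1}" "g t \<in> sphere y r" using w(1) by (metis imageE)
    then have "t = t1" using out'[of t] by auto
    then show ?thesis using t(2) by simp
  qed
  define h where "h = linepath x (g t0) +++ (subpath t0 t1 g +++ linepath (g t1) y)"
  have segx: "closed_segment x (g t0) \<subseteq> cball x r"
    using p r(1) by (intro closed_segment_subset) auto
  have segy: "closed_segment (g t1) y \<subseteq> cball y r"
    using q r(1) by (intro closed_segment_subset) auto
  have im: "path_image (subpath t0 t1 g) = g ` {t0..t1}" using t01 by (simp add: path_image_subpath)
  have gx: "g ` {t0..t1} \<inter> cball x r \<subseteq> {g t0}" using out by blast
  have gy: "g ` {t0..t1} \<inter> cball y r \<subseteq> {g t1}" using out' by blast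
  have imh: "path_image h = closed_segment x (g t0) \<union> (g ` {t0..t1} \<union> closed_segment (g t1) y)"
    unfolding h_def by (simp add: path_image_join im)
  have ne: "x \<noteq> g t0" "g t1 \<noteq> y" using p q r(1) by auto
  have a1: "arc (subpath t0 t1 g +++ linepath (g t1) y)"
  proof (rule arc_join)
    show "arc (subpath t0 t1 g)" using g(1) t0x t1y t01 by (intro arc_subpath_arc) auto
    show "path_image (subpath t0 t1 g) \<inter> path_image (linepath (g t1) y) \<subseteq> {pathstart (linepath (g t1) y)}"
      using gy segy unfolding im by auto
  qed (use ne in auto)
  have ah: "arc h" unfolding h_def
  proof (rule arc_join[OF _ a1])
    show "path_image (linepath x (g t0)) \<inter> path_image (subpath t0 t1 g +++ linepath (g t1) y)
      \<subseteq> {pathstart (subpath t0 t1 g +++ linepath (g t1) y)}"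
      using gx segx segy r(2) by (auto simp: path_image_join im)
  qed (use ne in auto)
  have hx: "path_image h \<inter> cball x r = closed_segment x (g t0)"
    unfolding imh using gx segx segy r(2) by auto
  have "path_image h \<inter> cball y r = closed_segment (g t1) y"
    unfolding imh using gy segx segy r(2) by auto
  then have hy: "path_image h \<inter> cball y r = closed_segment y (g t1)" by (simp add: closed_segment_commute)
  have "g ` {t0..t1} \<subseteq> path_image g" using t0x t1y by (auto simp: path_image_def)
  then have sub: "path_image h \<subseteq> path_image g \<union> cball x r \<union> cball y r"
    unfolding imh using segx segy by blast
  show thesis
    by (rule that[OF ah _ _ _ p hx _ q hy sub]) (use t0x t1y in \<open>auto simp: h_def path_image_def\<close>)
qed

lemma redraw_radius:
  assumes pg: "plane_graph V A"
  obtains r where "r > 0" "\<And>x y. x \<in> V \<Longrightarrow> y \<in> V \<Longrightarrow> x \<noteq> y \<Longrightarrow> cball x r \<inter> cball y r = {}"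
    "\<And>x a. x \<in> V \<Longrightarrow> a \<in> A \<Longrightarrow> x \<notin> a \<Longrightarrow> a \<inter> cball x r = {}"
proof -
  have "\<forall>x\<in>V. \<exists>e>0. ball x e \<inter> ((V - {x}) \<union> \<Union>{a\<in>A. x \<notin> a}) = {}"
  proof
    fix x assume x: "x \<in> V"
    have "compact ((V - {x}) \<union> \<Union>{a\<in>A. x \<notin> a})"
      by (intro compact_Un finite_imp_compact plane_graph_compact(2)[OF pg])
         (use plane_graph_finite[OF pg] in auto)
    then have "open (- ((V - {x}) \<union> \<Union>{a\<in>A. x \<notin> a}))" by (intro open_Compl compact_imp_closed)
    moreover have "x \<in> - ((V - {x}) \<union> \<Union>{a\<in>A. x \<notin> a})" by auto
    ultimately obtain e where "e > 0" "ball x e \<subseteq> - ((V - {x}) \<union> \<Union>{a\<in>A. x \<notin> a})"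
      using openE by blast
    then show "\<exists>e>0. ball x e \<inter> ((V - {x}) \<union> \<Union>{a\<in>A. x \<notin> a}) = {}" by blast
  qed
  then obtain e where e: "\<And>x. x \<in> V \<Longrightarrow> e x > 0"
    "\<And>x. x \<in> V \<Longrightarrow> ball x (e x) \<inter> ((V - {x}) \<union> \<Union>{a\<in>A. x \<notin> a}) = {}" by metis
  define m where "m = Min (insert 1 (e ` V))"
  have fin: "finite (insert 1 (e ` V))" using plane_graph_finite[OF pg] by auto
  have m0: "m > 0" unfolding m_def using fin e(1) by (subst Min_gr_iff) auto
  have me: "m \<le> e x" if "x \<in> V" for x unfolding m_def using fin that by (intro Min_le) auto
  \<comment> \<open>A third of the margin: if two discs of radius \<open>r\<close> met,
    \<open>y\<close> would be within \<open>2 * r < e x\<close> of \<open>x\<close>.\<close>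
  define r where "r = m / 3"
  have r: "r > 0" "\<And>x. x \<in> V \<Longrightarrow> 2 * r < e x" using m0 me by (force simp: r_def)+
  have sub: "cball x r \<subseteq> ball x (e x)" if "x \<in> V" for x using r(1) r(2)[OF that] by auto
  show thesis
  proof (rule that[OF r(1)])
    fix x y assume xy: "x \<in> V" "y \<in> V" "x \<noteq> y"
    show "cball x r \<inter> cball y r = {}"
    proof (rule ccontr)
      assume "\<not> ?thesis"
      then obtain z where "dist x z \<le> r" "dist y z \<le> r" by auto
      then have "dist x y \<le> 2 * r" using dist_triangle2[of x y z] by simp
      then have "y \<in> ball x (e x)" using r(2)[OF xy(1)] by simp
      then show False using e(2)[OF xy(1)] xy by blast
    qed
  next
    fix x a assume "x \<in> V" "a \<in> A" "x \<notin> a"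
    then show "a \<inter> cball x r = {}" using e(2)[of x] sub[of x] by blast
  qed
qed

text \<open>The new edges meet only in vertices: outside the discs they run along old edges, and
  inside a disc two radii with distinct end points share only the centre.\<close>

lemma plane_graph_redraw_tame:
  assumes pg: "plane_graph V A"
  obtains r A' where "tame r V A'" "(\<lambda>a. a \<inter> V) ` A' = (\<lambda>a. a \<inter> V) ` A"
proof -
  obtain r where r: "r > 0" "\<And>x y. x \<in> V \<Longrightarrow> y \<in> V \<Longrightarrow> x \<noteq> y \<Longrightarrow> cball x r \<inter> cball y r = {}"
    "\<And>x a. x \<in> V \<Longrightarrow> a \<in> A \<Longrightarrow> x \<notin> a \<Longrightarrow> a \<inter> cball x r = {}"
    using redraw_radius[OF pg] by blast
  have far: "y \<notin> cball x r" if "x \<in> V" "y \<in> V" "x \<noteq> y" for x y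
  proof -
    have "y \<in> cball y r" using r(1) by simp
    then show ?thesis using r(2)[OF that] by blast
  qed
  have "\<forall>a\<in>A. \<exists>h. arc h \<and> {pathstart h, pathfinish h} = a \<inter> V \<and>
      path_image h \<subseteq> a \<union> \<Union>((\<lambda>z. cball z r) ` (a \<inter> V)) \<and>
      (\<forall>z\<in>a \<inter> V. \<exists>p\<in>a. dist z p = r \<and> path_image h \<inter> cball z r = closed_segment z p)"
  proof
    fix a assume a: "a \<in> A"
    from plane_graph_arcE[OF pg a] obtain g x y where g: "arc g" "path_image g = a" "pathstart g = x" "pathfinish g = y"
      "a \<inter> V = {x, y}" "x \<noteq> y" by metis
    then have "x \<in> V" "y \<in> V" by auto
    then have dis: "cball x r \<inter> cball y r = {}" using r(2) g(6) by blast
    obtain h p q where h: "arc h" "pathstart h = x" "pathfinish h = y"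
      "p \<in> path_image g" "dist x p = r" "path_image h \<inter> cball x r = closed_segment x p"
      "q \<in> path_image g" "dist y q = r" "path_image h \<inter> cball y r = closed_segment y q"
      "path_image h \<subseteq> path_image g \<union> cball x r \<union> cball y r"
      using straighten_arc_ends[OF g(1,3,4) r(1) dis] by blast
    show "\<exists>h. arc h \<and> {pathstart h, pathfinish h} = a \<inter> V \<and>
      path_image h \<subseteq> a \<union> \<Union>((\<lambda>z. cball z r) ` (a \<inter> V)) \<and>
      (\<forall>z\<in>a \<inter> V. \<exists>p\<in>a. dist z p = r \<and> path_image h \<inter> cball z r = closed_segment z p)"
    proof (intro exI[of _ h] conjI)
      show "path_image h \<subseteq> a \<union> \<Union>((\<lambda>z. cball z r) ` (a \<inter> V))"
        using h(10) unfolding g(2,5) by auto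
      show "\<forall>z\<in>a \<inter> V. \<exists>p\<in>a. dist z p = r \<and> path_image h \<inter> cball z r = closed_segment z p"
        unfolding g(5) using h(4-9) g(2) by auto
      show "{pathstart h, pathfinish h} = a \<inter> V" using h(2,3) g(5) by simp
    qed (rule h(1))
  qed
  then obtain H where H: "\<And>a. a \<in> A \<Longrightarrow> arc (H a)"
    "\<And>a. a \<in> A \<Longrightarrow> {pathstart (H a), pathfinish (H a)} = a \<inter> V"
    "\<And>a. a \<in> A \<Longrightarrow> path_image (H a) \<subseteq> a \<union> \<Union>((\<lambda>z. cball z r) ` (a \<inter> V))"
    "\<And>a z. a \<in> A \<Longrightarrow> z \<in> a \<inter> V \<Longrightarrow> \<exists>p\<in>a. dist z p = r \<and> path_image (H a) \<inter> cball z r = closed_segment z p"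
    by metis
  define F where "F = (\<lambda>a. path_image (H a))"
  have FV: "F a \<inter> V = a \<inter> V" if a: "a \<in> A" for a
  proof
    show "F a \<inter> V \<subseteq> a \<inter> V"
    proof
      fix w assume w: "w \<in> F a \<inter> V"
      then have "w \<in> a \<or> (\<exists>z\<in>a \<inter> V. w \<in> cball z r)" using H(3)[OF a] unfolding F_def by blast
      then show "w \<in> a \<inter> V" using w far by blast
    qed
    have "{pathstart (H a), pathfinish (H a)} \<subseteq> F a"
      using pathstart_in_path_image pathfinish_in_path_image by (auto simp: F_def)
    then show "a \<inter> V \<subseteq> F a \<inter> V" unfolding H(2)[OF a] by blast
  qed
  have Fcb: "z \<in> a" if asm: "a \<in> A" "z \<in> V" "F a \<inter> cball z r \<noteq> {}" for a z
  proof (rule ccontr)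
    assume z: "z \<notin> a"
    obtain w where w: "w \<in> F a" "w \<in> cball z r" using asm(3) by blast
    then have "w \<in> a \<or> (\<exists>u\<in>a \<inter> V. w \<in> cball u r)" using H(3)[OF asm(1)] unfolding F_def by blast
    then show False using r(3)[OF asm(2,1) z] r(2)[OF asm(2)] w(2) z by blast
  qed
  have disj: "F a \<inter> F b \<subseteq> V" if ab: "a \<in> A" "b \<in> A" "a \<noteq> b" for a b
  proof
    fix w assume w: "w \<in> F a \<inter> F b"
    show "w \<in> V"
    proof (cases "\<exists>z\<in>V. w \<in> cball z r")
      case False
      then have "w \<in> a" "w \<in> b" using w H(3)[OF ab(1)] H(3)[OF ab(2)] unfolding F_def by blast+
      then show ?thesis using plane_graph_Int[OF pg ab] by blast
    next
      case True
      then obtain z where z: "z \<in> V" "w \<in> cball z r" by blast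
      then have zab: "z \<in> a \<inter> V" "z \<in> b \<inter> V" using Fcb ab w by blast+
      obtain p where p: "p \<in> a" "dist z p = r" "F a \<inter> cball z r = closed_segment z p"
        using H(4)[OF ab(1) zab(1)] unfolding F_def by blast
      obtain q where q: "q \<in> b" "dist z q = r" "F b \<inter> cball z r = closed_segment z q"
        using H(4)[OF ab(2) zab(2)] unfolding F_def by blast
      have "w \<in> closed_segment z p" "w \<in> closed_segment z q" using w z(2) p(3) q(3) by blast+
      then obtain s u where s: "0 \<le> s" "w = (1 - s) *\<^sub>R z + s *\<^sub>R p"
        and u: "0 \<le> u" "w = (1 - u) *\<^sub>R z + u *\<^sub>R q" by (auto simp: closed_segment_def)
      have ws: "w - z = s *\<^sub>R (p - z)" unfolding s(2) by (simp add: algebra_simps)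
      have wu: "w - z = u *\<^sub>R (q - z)" unfolding u(2) by (simp add: algebra_simps)
      have "norm (w - z) = s * r" unfolding ws using s(1) p(2) by (simp add: dist_norm norm_minus_commute)
      moreover have "norm (w - z) = u * r" unfolding wu using u(1) q(2) by (simp add: dist_norm norm_minus_commute)
      ultimately have su: "s = u" using r(1) by simp
      show ?thesis
      proof (cases "s = 0")
        case True
        then show ?thesis using ws z(1) by simp
      next
        case False
        \<comment> \<open>A common point other than the centre makes the two radii equal; their end
          point is then common to both old edges, hence a vertex, but the disc contains no vertex
          besides its centre.\<close>
        then have "p = q" using ws wu su by simp
        then have "p \<in> V" using p(1) q(1) plane_graph_Int[OF pg ab] by blast
        then have "p = z" using far[OF z(1), of p] p(2) by auto
        then show ?thesis using p(2) r(1) by simp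
      qed
    qed
  qed
  have "tame r V (F ` A)"
    unfolding tame_def
  proof (intro conjI ballI impI)
    show "plane_graph V (F ` A)"
      unfolding plane_graph_def
    proof (intro conjI ballI impI)
      show "finite V" using plane_graph_finite[OF pg] by blast
      fix a' assume "a' \<in> F ` A"
      then obtain a where a: "a \<in> A" "a' = F a" by blast
      then show "\<exists>g. arc g \<and> path_image g = a' \<and> a' \<inter> V = {pathstart g, pathfinish g}"
        using H(1,2)[OF a(1)] FV[OF a(1)] by (intro exI[of _ "H a"]) (auto simp: F_def)
      fix b' assume b': "b' \<in> F ` A" "a' \<noteq> b'"
      then obtain b where b: "b \<in> A" "b' = F b" by blast
      then have ne: "a \<noteq> b" using a b' by blast
      then show "a' \<inter> b' \<subseteq> V" using disj a b by blast
      show "a' \<inter> V \<noteq> b' \<inter> V" using plane_graph_inj[OF pg a(1) b(1)] ne FV a b by auto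
    qed
    fix a' x assume "a' \<in> F ` A" and x: "x \<in> V"
    then obtain a where a: "a \<in> A" "a' = F a" by blast
    show "\<exists>p. dist x p = r \<and> a' \<inter> cball x r = closed_segment x p" if "x \<in> a'"
    proof -
      have "x \<in> a \<inter> V" using that FV[OF a(1)] a(2) x by blast
      then show ?thesis using H(4)[OF a(1)] unfolding a(2) F_def by blast
    qed
    show "a' \<inter> cball x r = {}" if "x \<notin> a'"
      using Fcb[OF a(1) x] FV[OF a(1)] that x a(2) by blast
  qed (use r far in auto)
  moreover have "(\<lambda>a. a \<inter> V) ` F ` A = (\<lambda>a. a \<inter> V) ` A"
    using FV by (simp add: image_image)
  ultimately show thesis by (rule that)
qed

section \<open>Saturated drawings\<close>

abbreviation ends :: "complex set \<Rightarrow> complex set set \<Rightarrow> complex set set" where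
  "ends V A \<equiv> (\<lambda>a. a \<inter> V) ` A"

lemma endsE:
  assumes "plane_graph V A" "{x, y} \<in> ends V A"
  obtains g where "arc g" "pathstart g = x" "pathfinish g = y" "path_image g \<in> A" "path_image g \<inter> V = {x, y}"
proof -
  obtain a where a: "a \<in> A" "a \<inter> V = {x, y}" using assms(2) by auto
  from plane_graph_arcE[OF assms(1) a(1)] obtain g u w where g: "arc g" "path_image g = a"
    "pathstart g = u" "pathfinish g = w" "a \<inter> V = {u, w}" by metis
  have "u = x \<and> w = y \<or> u = y \<and> w = x" using g(5) a(2) by (metis doubleton_eq_iff)
  then show thesis
  proof
    assume "u = x \<and> w = y"
    then show thesis using that[of g] g a by simp
  next
    assume "u = y \<and> w = x"
    then show thesis using that[of "reversepath g"] g a by (simp add: arc_reversepath)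
  qed
qed

lemma ends_pair:
  assumes "plane_graph V A" "a \<in> A" "x \<in> a" "y \<in> a" "x \<in> V" "y \<in> V" "x \<noteq> y"
  shows "a \<inter> V = {x, y}" "{x, y} \<in> ends V A"
proof -
  obtain u w where "a \<inter> V = {u, w}" using plane_graph_arcE[OF assms(1,2)] by metis
  moreover have "x \<in> a \<inter> V" "y \<in> a \<inter> V" using assms by auto
  ultimately show "a \<inter> V = {x, y}" using assms(7) by auto
  then show "{x, y} \<in> ends V A" using assms(2) by blast
qed

lemma ends_simple:
  assumes "plane_graph V A" "e \<in> ends V A"
  shows "e \<subseteq> V" "card e = 2"
proof -
  obtain a where a: "a \<in> A" "e = a \<inter> V" using assms(2) by auto
  then show "e \<subseteq> V" by auto
  show "card e = 2" using plane_graph_arcE[OF assms(1) a(1)] a(2) by (metis card_2_iff)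
qed

section \<open>Connections in the graph turned into arcs\<close>

text \<open>Adjacency after deletion of \<open>X\<close>. Its reflexive transitive closure expresses
  connectedness of the remaining graph by relations alone.\<close>

definition link :: "'a set set \<Rightarrow> 'a set \<Rightarrow> ('a \<times> 'a) set" where
  "link E X = {(u, w). {u, w} \<in> E \<and> u \<notin> X \<and> w \<notin> X}"

lemma sym_link: "sym (link E X)"
  by (auto simp: link_def sym_def insert_commute)

lemma link_path_component:
  assumes pg: "plane_graph V A" and uw: "(u, w) \<in> (link (ends V B) {})\<^sup>*" "u \<noteq> w" and B: "B \<subseteq> A"
  shows "path_component (\<Union>B) u w"
proof -
  have "u = w \<or> path_component (\<Union>B) u w"
    using uw(1)
  proof (induction rule: rtrancl_induct)
    case (step y z)
    have pgB: "plane_graph V B" using plane_graph_mono[OF pg B] by blast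
    have "{y, z} \<in> ends V B" using step(2) by (simp add: link_def)
    then obtain g where g: "arc g" "pathstart g = y" "pathfinish g = z" "path_image g \<in> B"
      using endsE[OF pgB] by metis
    then have "path_component (\<Union>B) y z"
      unfolding path_component_def by (intro exI[of _ g]) (auto simp: arc_imp_path)
    then show ?case using step(3) by (metis path_component_trans)
  qed simp
  then show ?thesis using uw(2) by blast
qed

text \<open>Walks may repeat vertices, but the path that they trace contains an arc with the same
  ends.\<close>

lemma link_arc:
  assumes "plane_graph V A" "(u, w) \<in> (link (ends V B) {})\<^sup>*" "u \<noteq> w" "B \<subseteq> A"
  obtains g where "arc g" "pathstart g = u" "pathfinish g = w" "path_image g \<subseteq> \<Union>B"
proof -
  obtain p where p: "path p" "path_image p \<subseteq> \<Union>B" "pathstart p = u" "pathfinish p = w"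
    using link_path_component[OF assms] unfolding path_component_def by blast
  obtain q where "arc q" "path_image q \<subseteq> path_image p" "pathstart q = u" "pathfinish q = w"
    using path_contains_arc[OF p(1,3,4) assms(3)] by blast
  then show thesis using that p(2) by blast
qed

text \<open>The face \<open>Q\<close> is the fifth vertex of \<open>K_5\<close>. In place of an edge
  from \<open>s\<close> to \<open>t\<close> a connection avoiding \<open>p\<close> and
  \<open>q\<close> suffices; this matters because star centres are never adjacent to each other and
  need not be adjacent to a given vertex of \<open>C\<close>.\<close>

lemma face_avoids_K4:
  assumes t: "tame r V A" and Q: "Q \<in> faces V A"
    and cl: "{s, t, p, q} \<subseteq> closure Q" and dist: "distinct [s, t, p, q]"
    and E: "{s, p} \<in> ends V A" "{p, t} \<in> ends V A" "{s, q} \<in> ends V A" "{q, t} \<in> ends V A" "{p, q} \<in> ends V A"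
    and st: "(s, t) \<in> (link (ends V A) {p, q})\<^sup>*"
  shows False
proof -
  have pg: "plane_graph V A" using tameD(1)[OF t] .
  obtain g1 where g1: "arc g1" "pathstart g1 = s" "pathfinish g1 = p" "path_image g1 \<in> A" "path_image g1 \<inter> V = {s, p}"
    using endsE[OF pg E(1)] .
  obtain g2 where g2: "arc g2" "pathstart g2 = p" "pathfinish g2 = t" "path_image g2 \<in> A" "path_image g2 \<inter> V = {p, t}"
    using endsE[OF pg E(2)] .
  obtain g3 where g3: "arc g3" "pathstart g3 = s" "pathfinish g3 = q" "path_image g3 \<in> A" "path_image g3 \<inter> V = {s, q}"
    using endsE[OF pg E(3)] .
  obtain g4 where g4: "arc g4" "pathstart g4 = q" "pathfinish g4 = t" "path_image g4 \<in> A" "path_image g4 \<inter> V = {q, t}"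
    using endsE[OF pg E(4)] .
  obtain d where d: "arc d" "pathstart d = p" "pathfinish d = q" "path_image d \<in> A" "path_image d \<inter> V = {p, q}"
    using endsE[OF pg E(5)] .
  have ne: "s \<noteq> t" "s \<noteq> p" "s \<noteq> q" "t \<noteq> p" "t \<noteq> q" "p \<noteq> q" using dist by auto
  have V: "s \<in> V" "t \<in> V" "p \<in> V" "q \<in> V" using g1(5) g2(5) g3(5) by blast+
  have meet: "a \<inter> b \<subseteq> X \<inter> Y" if "a \<in> A" "b \<in> A" "a \<inter> V = X" "b \<inter> V = Y" "X \<noteq> Y" for a b X Y
    using plane_graph_Int[OF pg that(1,2)] that(3-5) by blast
  have i12: "path_image g1 \<inter> path_image g2 \<subseteq> {p}"
    using meet[OF g1(4) g2(4) g1(5) g2(5)] ne by (auto simp: doubleton_eq_iff)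
  have i34: "path_image g3 \<inter> path_image g4 \<subseteq> {q}"
    using meet[OF g3(4) g4(4) g3(5) g4(5)] ne by (auto simp: doubleton_eq_iff)
  have i13: "path_image g1 \<inter> path_image g3 \<subseteq> {s}"
    using meet[OF g1(4) g3(4) g1(5) g3(5)] ne by (auto simp: doubleton_eq_iff)
  have i14: "path_image g1 \<inter> path_image g4 \<subseteq> {}"
    using meet[OF g1(4) g4(4) g1(5) g4(5)] ne by (auto simp: doubleton_eq_iff)
  have i23: "path_image g2 \<inter> path_image g3 \<subseteq> {}"
    using meet[OF g2(4) g3(4) g2(5) g3(5)] ne by (auto simp: doubleton_eq_iff)
  have i24: "path_image g2 \<inter> path_image g4 \<subseteq> {t}"
    using meet[OF g2(4) g4(4) g2(5) g4(5)] ne by (auto simp: doubleton_eq_iff)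
  have d1: "path_image d \<inter> path_image g1 \<subseteq> {p}"
    using meet[OF d(4) g1(4) d(5) g1(5)] ne by (auto simp: doubleton_eq_iff)
  have d2: "path_image d \<inter> path_image g2 \<subseteq> {p}"
    using meet[OF d(4) g2(4) d(5) g2(5)] ne by (auto simp: doubleton_eq_iff)
  have d3: "path_image d \<inter> path_image g3 \<subseteq> {q}"
    using meet[OF d(4) g3(4) d(5) g3(5)] ne by (auto simp: doubleton_eq_iff)
  have d4: "path_image d \<inter> path_image g4 \<subseteq> {q}"
    using meet[OF d(4) g4(4) d(5) g4(5)] ne by (auto simp: doubleton_eq_iff)
  \<comment> \<open>Each of the five chosen edges contains \<open>p\<close> or \<open>q\<close>, so
    an edge in \<open>B\<close> can meet it only in \<open>s\<close> or \<open>t\<close>. Hence an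
    arc \<open>c\<close> along edges of \<open>B\<close> is a legitimate chord.\<close>
  define B where "B = {a\<in>A. p \<notin> a \<and> q \<notin> a}"
  have "link (ends V A) {p, q} \<subseteq> link (ends V B) {}"
  proof
    fix e assume "e \<in> link (ends V A) {p, q}"
    then obtain u w where e: "e = (u, w)" "{u, w} \<in> ends V A" "u \<notin> {p, q}" "w \<notin> {p, q}" by (auto simp: link_def)
    then obtain a where a: "a \<in> A" "a \<inter> V = {u, w}" by auto
    then have "p \<notin> a \<inter> V" "q \<notin> a \<inter> V" using e by auto
    then have "a \<in> B" using a V by (auto simp: B_def)
    then have "{u, w} \<in> ends V B" using a(2) by blast
    then show "e \<in> link (ends V B) {}" using e(1) by (simp add: link_def)
  qed
  then have "(s, t) \<in> (link (ends V B) {})\<^sup>*" using st rtrancl_mono by blast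
  then obtain c where c: "arc c" "pathstart c = s" "pathfinish c = t" "path_image c \<subseteq> \<Union>B"
    using link_arc[OF pg _ ne(1), of B] by (auto simp: B_def)
  have cmeet: "path_image c \<inter> a \<subseteq> (a \<inter> V) - {p, q}" if "a \<in> A" "p \<in> a \<or> q \<in> a" for a
  proof
    fix z assume z: "z \<in> path_image c \<inter> a"
    then obtain b where b: "b \<in> B" "z \<in> b" using c(4) by blast
    then have "b \<noteq> a" "b \<in> A" "p \<notin> b" "q \<notin> b" using that by (auto simp: B_def)
    then show "z \<in> (a \<inter> V) - {p, q}" using plane_graph_Int[OF pg _ that(1)] b(2) z by blast
  qed
  have c1: "path_image c \<inter> path_image g1 \<subseteq> {s}" using cmeet[OF g1(4)] unfolding g1(5) using g1(5) by blast
  have c2: "path_image c \<inter> path_image g2 \<subseteq> {t}" using cmeet[OF g2(4)] unfolding g2(5) using g2(5) by blast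
  have c3: "path_image c \<inter> path_image g3 \<subseteq> {s}" using cmeet[OF g3(4)] unfolding g3(5) using g3(5) by blast
  have c4: "path_image c \<inter> path_image g4 \<subseteq> {t}" using cmeet[OF g4(4)] unfolding g4(5) using g4(5) by blast
  have cd: "path_image c \<inter> path_image d = {}" using cmeet[OF d(4)] unfolding d(5) using d(5) by blast
  have sc: "s \<in> path_image c" "t \<in> path_image c" using c pathstart_in_path_image pathfinish_in_path_image by metis+
  have in1: "s \<in> path_image g1" "p \<in> path_image g1" using g1(5) by blast+
  have in2: "p \<in> path_image g2" "t \<in> path_image g2" using g2(5) by blast+
  have in3: "s \<in> path_image g3" "q \<in> path_image g3" using g3(5) by blast+
  have in4: "q \<in> path_image g4" "t \<in> path_image g4" using g4(5) by blast+
  have ind: "p \<in> path_image d" "q \<in> path_image d" using d(5) by blast+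
  obtain g where g: "arc g" "pathstart g = s" "pathfinish g = t" "path_image g \<subseteq> Q \<union> {s, t}"
    using tame_crosscut[OF t Q V(1) _ V(2)] cl ne by blast
  obtain h where h: "arc h" "pathstart h = p" "pathfinish h = q" "path_image h \<subseteq> Q \<union> {p, q}"
    using tame_crosscut[OF t Q V(3) _ V(4)] cl ne by blast
  note fb = face_basics[OF pg Q]
  \<comment> \<open>The two halves of the closed curve: one runs from \<open>s\<close> to
    \<open>t\<close> through \<open>p\<close>, the other through \<open>q\<close>.\<close>
  have a1: "arc (g1 +++ g2)" using g1 g2 i12 by (intro arc_join) auto
  have a2: "arc (g3 +++ g4)" using g3 g4 i34 by (intro arc_join) auto
  have im1: "path_image (g1 +++ g2) = path_image g1 \<union> path_image g2" using g1 g2 by (simp add: path_image_join)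
  have im2: "path_image (g3 +++ g4) = path_image g3 \<union> path_image g4" using g3 g4 by (simp add: path_image_join)
  have QA: "Q \<inter> (path_image g1 \<union> path_image g2 \<union> (path_image g3 \<union> path_image g4) \<union> path_image c \<union> path_image d) = {}"
    using fb(5) g1(4) g2(4) g3(4) g4(4) d(4) c(4) by (auto simp: B_def)
  show False
  proof (rule no_face_touches_all_of_K4[OF a1 a2 c(1) d(1) g(1) h(1) _ _ _ _ c(2,3) g(2,3) d(2,3) h(2,3),
        of Q, unfolded im1 im2])
    show "(path_image g1 \<union> path_image g2) \<inter> (path_image g3 \<union> path_image g4) = {s, t}"
      using i13 i14 i23 i24 in1 in2 in3 in4 by auto
    show "(path_image g1 \<union> path_image g2) \<inter> path_image c = {s, t}"
      using c1 c2 sc in1 in2 by auto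
    show "(path_image g3 \<union> path_image g4) \<inter> path_image c = {s, t}"
      using c3 c4 sc in3 in4 by auto
    show "path_image d \<inter> (path_image g1 \<union> path_image g2) = {p}" using d1 d2 ind in1 by auto
    show "path_image d \<inter> (path_image g3 \<union> path_image g4) = {q}" using d3 d4 ind in3 by auto
    show "p \<in> path_image g1 \<union> path_image g2 - {s, t}" "q \<in> path_image g3 \<union> path_image g4 - {s, t}"
      using in1 in3 ne by auto
  qed (use g1 g2 g3 g4 cd QA g(4) h(4) fb(2) in auto)
qed

section \<open>Faces of a saturated drawing\<close>

text \<open>The terminal situation of the induction: no star can be replaced by an edge, neither one
  nor two vertices of \<open>C\<close> separate (\<open>x = y\<close> is allowed in
  \<open>linked\<close>), and no edge inside \<open>C\<close> can be added across a face.\<close>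

locale saturated_drawing =
  fixes r :: real and V C :: "complex set" and A :: "complex set set" and k :: nat
  assumes tame: "tame r V A"
    and C_subset: "C \<subseteq> V"
    and meets_C: "\<And>e. e \<in> ends V A \<Longrightarrow> e \<inter> C \<noteq> {}"
    and star_le: "\<And>v. v \<in> V - C \<Longrightarrow> card (neighbourhood (ends V A) v) \<le> k"
    and star_ge: "\<And>v. v \<in> V - C \<Longrightarrow> card (neighbourhood (ends V A) v) \<ge> 3"
    and linked: "\<And>x y u w. x \<in> C \<Longrightarrow> y \<in> C \<Longrightarrow> u \<in> V - {x, y} \<Longrightarrow> w \<in> V - {x, y} \<Longrightarrow>
                   (u, w) \<in> (link (ends V A) {x, y})\<^sup>*"
    and saturated: "\<And>Q x y. Q \<in> faces V A \<Longrightarrow> x \<in> C \<inter> closure Q \<Longrightarrow> y \<in> C \<inter> closure Q \<Longrightarrow> x \<noteq> y \<Longrightarrow>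
                   {x, y} \<in> ends V A"
    and k3: "k \<ge> 3"
begin

lemma pg: "plane_graph V A"
  using tameD(1)[OF tame] .

lemma neighbour_star:
  assumes "v \<in> V - C" "x \<in> neighbourhood (ends V A) v"
  shows "x \<in> C" "x \<in> V" "{v, x} \<in> ends V A"
proof -
  have e: "{x, v} \<in> ends V A" using assms(2) by (simp add: neighbourhood_def)
  then show "x \<in> C" using meets_C[OF e] assms(1) by auto
  then show "x \<in> V" using C_subset by blast
  show "{v, x} \<in> ends V A" using e by (simp add: insert_commute)
qed

lemma star_edge:
  assumes "v \<in> V - C" "a \<in> A" "v \<in> a"
  obtains x where "x \<in> C" "a \<inter> V = {v, x}" "x \<in> neighbourhood (ends V A) v" "x \<noteq> v"
proof -
  obtain u w where uw: "a \<inter> V = {u, w}" using plane_graph_arcE[OF pg assms(2)] by metis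
  have "v \<in> a \<inter> V" using assms by blast
  then obtain x where x: "a \<inter> V = {v, x}" using uw by auto
  then have "{v, x} \<in> ends V A" using assms(2) by (metis image_eqI)
  then have "x \<in> neighbourhood (ends V A) v" by (simp add: neighbourhood_def insert_commute)
  then show thesis using that x neighbour_star[OF assms(1)] assms(1) by blast
qed

lemma star_face:
  assumes v: "v \<in> V - C" and Q: "Q \<in> faces V A" "v \<in> closure Q"
  obtains x y where "x \<in> C" "y \<in> C" "x \<noteq> y" "{v, x} \<in> ends V A" "{v, y} \<in> ends V A" "x \<in> closure Q" "y \<in> closure Q"
proof -
  have "card (neighbourhood (ends V A) v) \<ge> 2" using star_ge[OF v] by simp
  then obtain p q where pq: "p \<in> neighbourhood (ends V A) v" "q \<in> neighbourhood (ends V A) v" "p \<noteq> q"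
    by (meson card_2_iff' card_le_Suc_iff numeral_2_eq_2 obtain_subset_with_card_n subsetD)
  obtain a where a: "a \<in> A" "a \<inter> V = {p, v}" using pq(1) by (auto simp: neighbourhood_def)
  obtain b where b: "b \<in> A" "b \<inter> V = {q, v}" using pq(2) by (auto simp: neighbourhood_def)
  have pv: "p \<noteq> v" "q \<noteq> v" using neighbour_star[OF v pq(1)] neighbour_star[OF v pq(2)] v by auto
  have "a \<noteq> b" using a b pq(3) pv by (metis doubleton_eq_iff)
  moreover have "v \<in> a" "v \<in> b" "v \<in> V" using a b v by blast+
  ultimately obtain a' b' where ab: "a' \<in> A" "b' \<in> A" "a' \<noteq> b'" "v \<in> a'" "v \<in> b'" "a' \<subseteq> closure Q" "b' \<subseteq> closure Q"
    using two_edges_in_face_closure[OF tame Q(1) _ Q(2) a(1) b(1)] by metis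
  obtain x where x: "x \<in> C" "a' \<inter> V = {v, x}" "x \<in> neighbourhood (ends V A) v"
    using star_edge[OF v ab(1,4)] by metis
  obtain y where y: "y \<in> C" "b' \<inter> V = {v, y}" "y \<in> neighbourhood (ends V A) v"
    using star_edge[OF v ab(2,5)] by metis
  have "x \<noteq> y" using plane_graph_inj[OF pg ab(1,2)] ab(3) x(2) y(2) by auto
  moreover have "x \<in> a'" "y \<in> b'" using x(2) y(2) by blast+
  moreover have "{v, x} \<in> ends V A" "{v, y} \<in> ends V A"
    using neighbour_star(3)[OF v] x(3) y(3) by simp_all
  ultimately show thesis
    using that[OF x(1) y(1)] ab(6,7) by (metis subsetD)
qed

text \<open>Let \<open>x\<close> and \<open>y\<close> be two leaves on the boundary. A further
  boundary vertex adjacent to both would form the forbidden configuration with \<open>v\<close>,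
  \<open>x\<close> and \<open>y\<close>. A vertex of \<open>C\<close> is adjacent to both by
  saturation, and another star centre has two leaves on this boundary, which can only be
  \<open>x\<close> and \<open>y\<close>.\<close>

lemma star_face_vertices:
  assumes v: "v \<in> V - C" and Q: "Q \<in> faces V A" "v \<in> closure Q" and w: "w \<in> V" "w \<in> closure Q" "w \<noteq> v"
  shows "w \<in> C" "w \<in> neighbourhood (ends V A) v"
proof -
  obtain x y where xy: "x \<in> C" "y \<in> C" "x \<noteq> y" "{v, x} \<in> ends V A" "{v, y} \<in> ends V A" "x \<in> closure Q" "y \<in> closure Q"
    using star_face[OF v Q] .
  have no: False if u: "u \<in> V" "u \<in> closure Q" "u \<noteq> v" "u \<noteq> x" "u \<noteq> y" "{x, u} \<in> ends V A" "{y, u} \<in> ends V A" for u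
  proof (rule face_avoids_K4[OF tame Q(1), of v u x y])
    show "(v, u) \<in> (link (ends V A) {x, y})\<^sup>*"
      using linked[OF xy(1,2), of v u] v u xy by auto
    show "{x, y} \<in> ends V A" using saturated[OF Q(1)] xy by blast
  qed (use xy u Q v in auto)
  have Cxy: "u = x \<or> u = y" if u: "u \<in> C" "u \<in> closure Q" for u
  proof (rule ccontr)
    assume n: "\<not> ?thesis"
    then have "{x, u} \<in> ends V A" "{y, u} \<in> ends V A" using saturated[OF Q(1)] u xy by blast+
    then show False using no[of u] u C_subset v n by blast
  qed
  show wC: "w \<in> C"
  proof (rule ccontr)
    assume n: "w \<notin> C"
    then have wV: "w \<in> V - C" using w by blast
    obtain x' y' where xy': "x' \<in> C" "y' \<in> C" "x' \<noteq> y'" "{w, x'} \<in> ends V A" "{w, y'} \<in> ends V A" "x' \<in> closure Q" "y' \<in> closure Q"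
      using star_face[OF wV Q(1) w(2)] .
    then have "{x', y'} = {x, y}" using Cxy[of x'] Cxy[of y'] by blast
    then have "{w, x} \<in> ends V A" "{w, y} \<in> ends V A" using xy' by (metis doubleton_eq_iff)+
    then have "{x, w} \<in> ends V A" "{y, w} \<in> ends V A" by (simp_all add: insert_commute)
    then show False using no[of w] w n xy by blast
  qed
  have "{w, v} \<in> ends V A" using Cxy[OF wC w(2)] xy by (metis insert_commute)
  then show "w \<in> neighbourhood (ends V A) v" by (simp add: neighbourhood_def)
qed

lemma card_C_face:
  assumes Q: "Q \<in> faces V A"
  shows "card (C \<inter> closure Q) \<le> 3"
proof (rule ccontr)
  assume "\<not> ?thesis"
  then have "card (C \<inter> closure Q) \<ge> 4" by simp
  then obtain S where S: "S \<subseteq> C \<inter> closure Q" "card S = 4" by (metis obtain_subset_with_card_n)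
  then have "finite S" by (simp add: card_ge_0_finite)
  then obtain l where l: "set l = S" "distinct l" using finite_distinct_list by blast
  then have "length l = 4" using S(2) distinct_card by fastforce
  then obtain s t p q where lq: "l = [s, t, p, q]"
    by (auto simp: eval_nat_numeral length_Suc_conv)
  have st: "s \<in> C \<inter> closure Q" "t \<in> C \<inter> closure Q" "p \<in> C \<inter> closure Q" "q \<in> C \<inter> closure Q"
    using l lq S by auto
  have ne: "distinct [s, t, p, q]" using l lq by simp
  show False
  proof (rule face_avoids_K4[OF tame Q _ ne])
    show "{s, p} \<in> ends V A" "{p, t} \<in> ends V A" "{s, q} \<in> ends V A" "{q, t} \<in> ends V A" "{p, q} \<in> ends V A"
      using saturated[OF Q] st ne by auto
    show "(s, t) \<in> (link (ends V A) {p, q})\<^sup>*" using linked[of p q s t] st ne C_subset by auto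
  qed (use st in auto)
qed

section \<open>The plane graph left after deleting the stars\<close>

definition C_edges :: "complex set set" where
  "C_edges = {a \<in> A. a \<inter> V \<subseteq> C}"

lemma plane_C_edges: "plane_graph C C_edges"
  by (rule plane_graph_mono[OF pg _ C_subset]) (simp_all add: C_edges_def subset_iff)

lemma not_C_edge:
  assumes "a \<in> A" "a \<notin> C_edges"
  obtains v where "v \<in> V - C" "v \<in> a"
  using assms by (auto simp: C_edges_def)

text \<open>A spoke without its leaf therefore lies in a single face of the graph on
  \<open>C\<close>, the one that contains the centre.\<close>

lemma connected_spoke:
  assumes v: "v \<in> V - C" and a: "a \<in> A" "v \<in> a"
  shows "connected (a - C)" "(a - C) \<inter> (C \<union> \<Union>C_edges) = {}"
proof -
  obtain x where x: "x \<in> C" "a \<inter> V = {v, x}" using star_edge[OF v a] by metis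
  have "{v, x} \<in> ends V A" using x(2) a(1) by (metis image_eqI)
  then obtain g where g: "arc g" "pathstart g = v" "pathfinish g = x" "path_image g \<in> A" "path_image g \<inter> V = {v, x}"
    using endsE[OF pg] by metis
  have "path_image g = a" using plane_graph_inj[OF pg g(4) a(1)] g(5) x(2) by simp
  moreover have "a - C = a - {x}"
  proof -
    have "a \<inter> C \<subseteq> {v, x}" "x \<in> a" "v \<notin> C" using x(2) C_subset v by blast+
    then show ?thesis using x(1) by blast
  qed
  ultimately show "connected (a - C)" using connected_arc_minus_finish[OF g(1)] g(3) by simp
  have "(a - C) \<inter> b = {}" if b: "b \<in> C_edges" for b
  proof -
    have "b \<noteq> a" "b \<in> A" "b \<inter> V \<subseteq> C" using b v a by (auto simp: C_edges_def)
    then show ?thesis using plane_graph_Int[OF pg a(1), of b] by blast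
  qed
  then show "(a - C) \<inter> (C \<union> \<Union>C_edges) = {}" by blast
qed

text \<open>A spoke that met \<open>F\<close> would drag its centre into \<open>F\<close>. Hence
  \<open>F\<close> avoids the whole drawing and lies inside one of its faces, which has at most
  three vertices of \<open>C\<close>.\<close>

lemma face_without_star:
  assumes F: "F \<in> faces C C_edges" and n: "F \<inter> (V - C) = {}"
  shows "card (C \<inter> closure F) \<le> 3"
proof -
  note fb = face_basics[OF plane_C_edges F]
  have "F \<inter> a = {}" if a: "a \<in> A" for a
  proof (cases "a \<in> C_edges")
    case True
    then show ?thesis using fb(5) by blast
  next
    case False
    then obtain v where v: "v \<in> V - C" "v \<in> a" using not_C_edge[OF a] by blast
    show ?thesis
    proof (rule ccontr)
      assume "F \<inter> a \<noteq> {}"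
      then have "(a - C) \<inter> F \<noteq> {}" using fb(4) by blast
      then have "a - C \<subseteq> F"
        using connected_subset_face[OF plane_C_edges F connected_spoke[OF v(1) a v(2)]] by blast
      then show False using v n by blast
    qed
  qed
  then have "F \<inter> (V \<union> \<Union>A) = {}" using n fb(4) by blast
  then obtain Q where Q: "Q \<in> faces V A" "F \<subseteq> Q" using connected_in_some_face[OF fb(2) _ fb(3)] by metis
  have "C \<inter> closure F \<subseteq> C \<inter> closure Q" using closure_mono[OF Q(2)] by blast
  moreover have "finite (C \<inter> closure Q)"
    using finite_subset[OF C_subset] plane_graph_finite[OF pg] by blast
  ultimately show ?thesis using card_C_face[OF Q(1)] card_mono by (metis order_trans)
qed

text \<open>A candidate for the face of the graph on \<open>C\<close> that surrounds
  \<open>v\<close>: the star without its leaves, together with the faces of the full drawing at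
  \<open>v\<close>. The aim is to show that the surrounding face is contained in it.\<close>

definition fan :: "complex \<Rightarrow> complex set" where
  "fan v = {v} \<union> \<Union>((\<lambda>a. a - C) ` {a \<in> A. v \<in> a}) \<union> \<Union>{Q \<in> faces V A. v \<in> closure Q}"

lemma fanE:
  assumes "w \<in> fan v"
  obtains "w = v" | a where "a \<in> A" "v \<in> a" "w \<in> a - C" | Q where "Q \<in> faces V A" "v \<in> closure Q" "w \<in> Q"
  using assms by (auto simp: fan_def)

lemma faces_disjoint:
  assumes "Q \<in> faces V A" "Q' \<in> faces V A" "z \<in> Q" "z \<in> Q'"
  shows "Q = Q'"
  using assms components_nonoverlap[of Q "- (V \<union> \<Union>A)" Q'] by (auto simp: faces_def)

text \<open>A point of the fan close to \<open>z\<close> lies on a spoke ending at \<open>z\<close>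
  or in a face with \<open>z\<close> on its boundary; in both cases \<open>z\<close> is a leaf of
  \<open>v\<close>.\<close>

lemma C_closure_fan:
  assumes v: "v \<in> V - C"
  shows "C \<inter> closure (fan v) \<subseteq> neighbourhood (ends V A) v"
proof
  fix z assume z: "z \<in> C \<inter> closure (fan v)"
  then have zV: "z \<in> V" "z \<noteq> v" using C_subset v by auto
  obtain w where w: "w \<in> fan v" "w \<in> ball z r"
    using z tameD(2)[OF tame] by (metis IntD2 closure_approachable dist_commute mem_ball)
  from w(1) show "z \<in> neighbourhood (ends V A) v"
  proof (cases rule: fanE)
    case 1
    then show ?thesis using tameD(3)[OF tame zV(1), of v] v zV w(2) by auto
  next
    case (2 a)
    then have "z \<in> a" using tameD(4)[OF tame 2(1) zV(1)] w(2) by fastforce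
    then have "{z, v} \<in> ends V A" using ends_pair(2)[OF pg 2(1), of z v] 2 zV v by blast
    then show ?thesis by (simp add: neighbourhood_def)
  next
    case (3 Q)
    then have "z \<in> closure Q" using tame_access(2)[OF tame 3(1) zV(1) 3(3) w(2)] by blast
    then show ?thesis using star_face_vertices(2)[OF v 3(1,2) zV(1)] zV by blast
  qed
qed

text \<open>In other words, the frontier of the fan lies in the graph on \<open>C\<close>. The
  critical points belong to other stars: no face has two star centres on its boundary, so such a
  point has a neighbourhood disjoint from the fan.\<close>

lemma fan_locally_constant:
  assumes v: "v \<in> V - C" and p: "p \<notin> C" "p \<notin> \<Union>C_edges"
  obtains e where "e > 0" "ball p e \<subseteq> fan v \<or> ball p e \<inter> fan v = {}"
proof -
  consider "p \<in> V" | a where "p \<notin> V" "a \<in> A" "p \<in> a" | "p \<notin> V" "p \<notin> \<Union>A" by blast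
  then show thesis
  proof cases
    case 1
    then have pVC: "p \<in> V - C" using p by blast
    show thesis
    proof (cases "p = v")
      case True
      have "ball v r \<subseteq> fan v"
      proof
        fix z assume z: "z \<in> ball v r"
        consider "z = v" | "z \<noteq> v" "z \<in> \<Union>A" | "z \<noteq> v" "z \<notin> \<Union>A" by blast
        then show "z \<in> fan v"
        proof cases
          case 2
          then obtain a where a: "a \<in> A" "z \<in> a" by blast
          then have "v \<in> a" using tameD(4)[OF tame a(1), of v] v z by fastforce
          moreover have "z \<notin> V" using tameD(3)[OF tame, of v z] v z 2 by auto
          ultimately show ?thesis using a C_subset by (auto simp: fan_def)
        next
          case 3
          then have "z \<notin> V" using tameD(3)[OF tame, of v z] v z by auto
          then obtain Q where Q: "Q \<in> faces V A" "z \<in> Q" using point_in_some_face 3 by blast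
          then have "v \<in> closure Q" using tame_access(2)[OF tame Q(1) _ Q(2) z] v by blast
          then show ?thesis using Q by (auto simp: fan_def)
        qed (simp add: fan_def)
      qed
      then show thesis using that[of r] True tameD(2)[OF tame] by blast
    next
      case False
      have "z \<notin> fan v" if z: "z \<in> ball p r" for z
      proof
        assume "z \<in> fan v"
        then show False
        proof (cases rule: fanE)
          case 1
          then show False using tameD(3)[OF tame, of p v] pVC v False z by auto
        next
          case (2 a)
          then have "p \<in> a" using tameD(4)[OF tame 2(1), of p] pVC z by fastforce
          moreover obtain x where "x \<in> C" "a \<inter> V = {v, x}" using star_edge[OF v 2(1,2)] by metis
          ultimately show False using pVC False by blast
        next
          case (3 Q)
          then have "p \<in> closure Q" using tame_access(2)[OF tame 3(1) _ 3(3) z] pVC by blast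
          then show False using star_face_vertices(1)[OF v 3(1,2), of p] pVC False by blast
        qed
      qed
      then show thesis using that[of r] tameD(2)[OF tame] by blast
    qed
  next
    case (2 a)
    obtain e where e: "e > 0" "ball p e \<inter> (V \<union> \<Union>A) \<subseteq> a - V"
      "\<And>Q. Q \<in> faces V A \<Longrightarrow> Q \<inter> ball p e \<noteq> {} \<Longrightarrow> a \<subseteq> closure Q"
      using near_edge[OF pg 2(2,3,1)] by blast
    \<comment> \<open>\<open>u\<close> is the centre of the star that has \<open>a\<close> as a
      spoke, and it equals \<open>v\<close> exactly if \<open>v \<in> a\<close>.\<close>
    obtain u where u: "u \<in> V - C" "u \<in> a" using not_C_edge[OF 2(2)] 2 p by blast
    show thesis
    proof (cases "v \<in> a")
      case True
      have "ball p e \<subseteq> fan v"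
      proof
        fix z assume z: "z \<in> ball p e"
        show "z \<in> fan v"
        proof (cases "z \<in> V \<union> \<Union>A")
          case zG: True
          then have "z \<in> a - V" using e(2) z by blast
          then show ?thesis using True 2(2) C_subset by (auto simp: fan_def)
        next
          case False
          then obtain Q where Q: "Q \<in> faces V A" "z \<in> Q" using point_in_some_face by blast
          then have "v \<in> closure Q" using e(3)[OF Q(1)] z True by blast
          then show ?thesis using Q by (auto simp: fan_def)
        qed
      qed
      then show thesis using that e(1) by blast
    next
      case False
      have "z \<notin> fan v" if z: "z \<in> ball p e" for z
      proof
        assume "z \<in> fan v"
        then show False
        proof (cases rule: fanE)
          case 1
          then show False using e(2) z v by blast
        next
          case (2 b)
          then have "z \<in> a - V" using e(2) z by blast
          moreover have "a \<noteq> b" using False 2 by blast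
          ultimately show False using plane_graph_Int[OF pg \<open>a \<in> A\<close> 2(1)] 2(3) by blast
        next
          case (3 Q)
          then have "u \<in> closure Q" using e(3)[OF 3(1)] z u(2) by blast
          then show False using star_face_vertices(1)[OF v 3(1,2), of u] u False by blast
        qed
      qed
      then show thesis using that e(1) by blast
    qed
  next
    case 3
    then obtain Q where Q: "Q \<in> faces V A" "p \<in> Q" using point_in_some_face by blast
    then obtain e where e: "e > 0" "ball p e \<subseteq> Q" using face_basics(1)[OF pg Q(1)] openE by blast
    show thesis
    proof (cases "v \<in> closure Q")
      case True
      then have "Q \<subseteq> fan v" using Q(1) by (auto simp: fan_def)
      then show thesis using that[OF e(1)] e(2) by blast
    next
      case False
      have "z \<notin> fan v" if z: "z \<in> Q" for z
      proof
        assume "z \<in> fan v"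
        then show False
        proof (cases rule: fanE)
          case 1
          then show False using face_basics(4)[OF pg Q(1)] z v by blast
        next
          case (2 a)
          then show False using face_basics(5)[OF pg Q(1) 2(1)] z by blast
        next
          case (3 Q')
          then show False using faces_disjoint[OF Q(1) 3(1) z 3(3)] False by blast
        qed
      qed
      then show thesis using that[OF e(1)] e(2) by blast
    qed
  qed
qed

text \<open>A connected face that left the fan would meet its frontier at a point off the graph on
  \<open>C\<close>, where the fan is locally constant.\<close>

lemma face_with_star:
  assumes F: "F \<in> faces C C_edges" and v: "v \<in> F" "v \<in> V - C"
  shows "C \<inter> closure F \<subseteq> neighbourhood (ends V A) v"
proof -
  note fb = face_basics[OF plane_C_edges F]
  have "F \<subseteq> fan v"
  proof (rule ccontr)
    assume "\<not> F \<subseteq> fan v"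
    moreover have "F \<inter> fan v \<noteq> {}" using v by (auto simp: fan_def)
    ultimately have "F \<inter> frontier (fan v) \<noteq> {}" using connected_Int_frontier[OF fb(2)] by blast
    then obtain p where p: "p \<in> F" "p \<in> frontier (fan v)" by blast
    then have "p \<notin> C" "p \<notin> \<Union>C_edges" using fb(4,5) by blast+
    then obtain e where e: "e > 0" "ball p e \<subseteq> fan v \<or> ball p e \<inter> fan v = {}"
      using fan_locally_constant[OF v(2)] by blast
    obtain z z' where "z \<in> fan v" "dist p z < e" "z' \<notin> fan v" "dist p z' < e"
      using p(2) e(1) unfolding frontier_straddle by blast
    then show False using e(2) by (auto simp: subset_iff)
  qed
  then show ?thesis using C_closure_fan[OF v(2)] closure_mono[of F "fan v"] by blast
qed

lemma finite_neighbourhood: "finite (neighbourhood (ends V A) v)"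
proof -
  have "neighbourhood (ends V A) v \<subseteq> V" using ends_simple(1)[OF pg] by (auto simp: neighbourhood_def)
  then show ?thesis using plane_graph_finite[OF pg] finite_subset by blast
qed

lemma max_face_size_C: "max_face_size C C_edges \<le> k"
proof -
  have "card (face_vertices C F) \<le> k" if F: "F \<in> faces C C_edges" for F
  proof (cases "F \<inter> (V - C) = {}")
    case True
    then show ?thesis
      using face_without_star[OF F] k3 by (simp add: face_vertices_eq[OF plane_C_edges F])
  next
    case False
    then obtain v where v: "v \<in> F" "v \<in> V - C" by blast
    show ?thesis
      using card_mono[OF finite_neighbourhood face_with_star[OF F v]] star_le[OF v(2)]
      by (simp add: face_vertices_eq[OF plane_C_edges F])
  qed
  \<comment> \<open>\<open>Max\<close> is meaningful only for a finite nonempty set: the sizes are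
    at most \<open>card C\<close>, and a compact graph does not fill the plane.\<close>
  moreover have "finite ((\<lambda>F. card (face_vertices C F)) ` faces C C_edges)"
  proof (rule finite_subset)
    have "finite C" using plane_graph_finite[OF plane_C_edges] by blast
    then show "(\<lambda>F. card (face_vertices C F)) ` faces C C_edges \<subseteq> {..card C}"
      by (auto simp: face_vertices_def intro: card_mono)
  qed simp
  moreover have "faces C C_edges \<noteq> {}"
  proof -
    have "compact (C \<union> \<Union>C_edges)" using plane_graph_compact(1)[OF plane_C_edges] .
    then have "C \<union> \<Union>C_edges \<noteq> UNIV" by (metis compact_imp_bounded not_bounded_UNIV)
    then obtain z where "z \<notin> C" "z \<notin> \<Union>C_edges" by blast
    then show ?thesis using point_in_some_face by (metis empty_iff)
  qed
  ultimately show ?thesis by (auto simp: max_face_size_def)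
qed

text \<open>An edge lies in the closure of some face, so its ends share a face. The leaves of
  \<open>v\<close> share the face that contains \<open>v\<close>, since each spoke runs inside it up
  to its leaf.\<close>

lemma cyclic_colouring_good:
  assumes c: "cyclic_colouring C C_edges c"
  shows "\<And>x y. {x, y} \<in> ends V A \<Longrightarrow> x \<in> C \<Longrightarrow> y \<in> C \<Longrightarrow> c x \<noteq> c y"
    and "\<And>v. v \<in> V - C \<Longrightarrow> inj_on c (neighbourhood (ends V A) v)"
proof -
  have inj: "inj_on c (C \<inter> closure F)" if "F \<in> faces C C_edges" for F
    using c that by (auto simp: cyclic_colouring_def face_vertices_eq[OF plane_C_edges that, symmetric])
  fix x y assume xy: "{x, y} \<in> ends V A" "x \<in> C" "y \<in> C"
  have "x \<noteq> y" using ends_simple(2)[OF pg xy(1)] by auto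
  obtain a where a: "a \<in> A" "a \<inter> V = {x, y}" using xy(1) by auto
  then have "a \<in> C_edges" using xy by (auto simp: C_edges_def)
  then obtain F where "F \<in> faces C C_edges" "a \<subseteq> closure F" using edge_in_some_face_closure[OF plane_C_edges] by blast
  moreover have "x \<in> a" "y \<in> a" using a(2) by blast+
  ultimately show "c x \<noteq> c y" using inj_onD[OF inj[of F], of x y] xy(2,3) \<open>x \<noteq> y\<close> by blast
next
  fix v assume v: "v \<in> V - C"
  have inj: "inj_on c (C \<inter> closure F)" if "F \<in> faces C C_edges" for F
    using c that by (auto simp: cyclic_colouring_def face_vertices_eq[OF plane_C_edges that, symmetric])
  have "v \<notin> b" if "b \<in> C_edges" for b using that v by (auto simp: C_edges_def)
  then obtain F where F: "F \<in> faces C C_edges" "v \<in> F"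
    using point_in_some_face[of v C C_edges] v by blast
  have "neighbourhood (ends V A) v \<subseteq> C \<inter> closure F"
  proof
    fix x assume x: "x \<in> neighbourhood (ends V A) v"
    obtain g where g: "arc g" "pathstart g = v" "pathfinish g = x" "path_image g \<in> A" "path_image g \<inter> V = {v, x}"
      using endsE[OF pg neighbour_star(3)[OF v x]] .
    have va: "v \<in> path_image g" "x \<in> path_image g" using g(5) by blast+
    have "(path_image g - C) \<inter> F \<noteq> {}" using va F v by blast
    then have "path_image g - C \<subseteq> F"
      using connected_subset_face[OF plane_C_edges F(1) connected_spoke[OF v g(4) va(1)]] by blast
    moreover have "path_image g - {v, x} \<subseteq> path_image g - C" using g(5) C_subset by blast
    ultimately have "closure (path_image g - {v, x}) \<subseteq> closure F" by (intro closure_mono) blast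
    then have "x \<in> closure F" using closure_arc_interior[OF g(1)] g(2,3) va by auto
    then show "x \<in> C \<inter> closure F" using neighbour_star[OF v x] by blast
  qed
  then show "inj_on c (neighbourhood (ends V A) v)" using inj[OF F(1)] inj_on_subset by blast
qed

end

section \<open>Reduction to saturated drawings\<close>

text \<open>Only the set of end pairs is kept, so that every step of the induction may choose a new
  drawing.\<close>

definition drawable :: "complex set \<Rightarrow> complex set set \<Rightarrow> bool" where
  "drawable V E \<longleftrightarrow> (\<exists>A. plane_graph V A \<and> ends V A = E)"

lemma drawable_simple:
  assumes "drawable V E"
  shows "finite V" "\<And>e. e \<in> E \<Longrightarrow> e \<subseteq> V" "\<And>e. e \<in> E \<Longrightarrow> card e = 2" "\<And>x y. {x, y} \<in> E \<Longrightarrow> x \<noteq> y"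
    "finite (neighbourhood E v)" "neighbourhood E v \<subseteq> V"
proof -
  obtain A where A: "plane_graph V A" "ends V A = E" using assms by (auto simp: drawable_def)
  show V: "finite V" using plane_graph_finite[OF A(1)] by blast
  show s: "\<And>e. e \<in> E \<Longrightarrow> e \<subseteq> V" "\<And>e. e \<in> E \<Longrightarrow> card e = 2" using ends_simple[OF A(1)] A(2) by auto
  show "\<And>x y. {x, y} \<in> E \<Longrightarrow> x \<noteq> y" using s(2) by force
  show "neighbourhood E v \<subseteq> V" using s(1) by (auto simp: neighbourhood_def)
  then show "finite (neighbourhood E v)" using V finite_subset by blast
qed

lemma drawable_mono:
  assumes "drawable V E" "W \<subseteq> V" "E' \<subseteq> E" "\<And>e. e \<in> E' \<Longrightarrow> e \<subseteq> W"
  shows "drawable W E'"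
proof -
  obtain A where A: "plane_graph V A" "ends V A = E" using assms(1) by (auto simp: drawable_def)
  define B where "B = {a \<in> A. a \<inter> V \<in> E'}"
  have bW: "b \<inter> V \<subseteq> W" if "b \<in> B" for b using that assms(4) by (auto simp: B_def)
  then have eq: "b \<inter> W = b \<inter> V" if "b \<in> B" for b using that assms(2) by blast
  have "plane_graph W B"
    by (rule plane_graph_mono[OF A(1) _ assms(2) bW]) (auto simp: B_def)
  moreover have "ends W B = ends V B" using eq by (intro image_cong) auto
  moreover have "ends V B = E'"
  proof
    show "ends V B \<subseteq> E'" by (auto simp: B_def)
    show "E' \<subseteq> ends V B"
    proof
      fix e assume e: "e \<in> E'"
      then have "e \<in> ends V A" using A(2) assms(3) by auto
      then obtain a where "a \<in> A" "e = a \<inter> V" by auto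
      then show "e \<in> ends V B" using e by (auto simp: B_def)
    qed
  qed
  ultimately show ?thesis by (auto simp: drawable_def)
qed

lemma drawable_insert_arc:
  assumes pg: "plane_graph W A" and g: "arc g" "pathstart g = x" "pathfinish g = y"
    and gW: "path_image g \<inter> W = {x, y}" and gA: "\<And>a. a \<in> A \<Longrightarrow> a \<inter> path_image g \<subseteq> W"
    and new: "{x, y} \<notin> ends W A"
  shows "drawable W (insert {x, y} (ends W A))"
proof -
  have ne: "a \<inter> W \<noteq> {x, y}" if "a \<in> A" for a using new that by (metis image_eqI)
  have "plane_graph W (insert (path_image g) A)"
    unfolding plane_graph_def
  proof (intro conjI ballI impI)
    show "finite W" using plane_graph_finite[OF pg] by blast
    fix a assume a: "a \<in> insert (path_image g) A"
    show "\<exists>h. arc h \<and> path_image h = a \<and> a \<inter> W = {pathstart h, pathfinish h}"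
    proof (cases "a = path_image g")
      case True
      then show ?thesis using g gW by blast
    next
      case False
      then have "a \<in> A" using a by blast
      then show ?thesis using pg by (simp add: plane_graph_def)
    qed
    fix b assume b: "b \<in> insert (path_image g) A" "a \<noteq> b"
    show "a \<inter> b \<subseteq> W" using a b gA plane_graph_Int[OF pg] by (metis Int_commute insert_iff)
    show "a \<inter> W \<noteq> b \<inter> W" using a b gW ne plane_graph_inj[OF pg] by (metis insert_iff)
  qed
  moreover have "ends W (insert (path_image g) A) = insert {x, y} (ends W A)" using gW by simp
  ultimately show ?thesis unfolding drawable_def by blast
qed

text \<open>Each vertex outside \<open>C\<close> stands for a hyperedge, namely its neighbourhood.\<close>

definition star_system :: "nat \<Rightarrow> complex set \<Rightarrow> complex set set \<Rightarrow> complex set \<Rightarrow> bool" where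
  "star_system k V E C \<longleftrightarrow> drawable V E \<and> C \<subseteq> V \<and> (\<forall>e\<in>E. e \<inter> C \<noteq> {}) \<and>
     (\<forall>v\<in>V - C. card (neighbourhood E v) \<le> k)"

text \<open>Edges inside \<open>C\<close> count as constraints, which lets an added edge force
  distinct colours at a separating pair. In a star system the neighbourhood of a vertex outside
  \<open>C\<close> lies in \<open>C\<close>, so all constraints concern colours on
  \<open>C\<close>.\<close>

definition star_colouring :: "nat \<Rightarrow> 'a set \<Rightarrow> 'a set set \<Rightarrow> 'a set \<Rightarrow> ('a \<Rightarrow> nat) \<Rightarrow> bool" where
  "star_colouring q V E C c \<longleftrightarrow> (\<forall>x\<in>C. c x < q) \<and> (\<forall>x\<in>C. \<forall>y\<in>C. {x, y} \<in> E \<longrightarrow> c x \<noteq> c y) \<and>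
     (\<forall>v\<in>V - C. inj_on c (neighbourhood E v))"

section \<open>Permuting and gluing colourings\<close>

text \<open>The matching between the two sets of colours on \<open>X\<close> extends to a
  permutation, because equally many colours remain on both sides.\<close>

lemma extend_partial_injection:
  fixes c1 c2 :: "'a \<Rightarrow> nat"
  assumes "finite X" "inj_on c1 X" "inj_on c2 X" "c1 ` X \<subseteq> {..<q}" "c2 ` X \<subseteq> {..<q}"
  obtains p where "inj_on p {..<q}" "p ` {..<q} \<subseteq> {..<q}" "\<And>x. x \<in> X \<Longrightarrow> p (c2 x) = c1 x"
proof -
  have "card ({..<q} - c2 ` X) = card ({..<q} - c1 ` X)"
    using assms by (simp add: card_Diff_subset card_image)
  then obtain h where h: "bij_betw h ({..<q} - c2 ` X) ({..<q} - c1 ` X)"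
    using finite_same_card_bij[of "{..<q} - c2 ` X" "{..<q} - c1 ` X"] by auto
  have f: "bij_betw (c1 \<circ> inv_into X c2) (c2 ` X) (c1 ` X)"
    using assms(2,3) by (intro bij_betw_trans[of _ _ X] bij_betw_inv_into inj_on_imp_bij_betw)
  define p where "p = (\<lambda>z. if z \<in> c2 ` X then (c1 \<circ> inv_into X c2) z else h z)"
  have "bij_betw p (c2 ` X \<union> ({..<q} - c2 ` X)) (c1 ` X \<union> ({..<q} - c1 ` X))"
    unfolding p_def by (rule bij_betw_disjoint_Un[OF f h]) auto
  then have "bij_betw p {..<q} {..<q}" using assms(4,5) by (simp add: Un_absorb1)
  moreover have "p (c2 x) = c1 x" if "x \<in> X" for x
    using that assms(3) by (simp add: p_def)
  ultimately show thesis using that by (auto simp: bij_betw_def)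
qed

text \<open>The second colouring is permuted to agree with the first on \<open>X\<close>. No star is
  cut: its centre is outside \<open>X\<close>, so its leaves lie in the centre's own side together
  with \<open>X\<close>. The sides may carry additional edges.\<close>

lemma star_colouring_glue:
  assumes V: "V = V1 \<union> V2 \<union> X" "V1 \<inter> V2 = {}" "V1 \<inter> X = {}" "V2 \<inter> X = {}" and X: "X \<subseteq> C" "finite X"
    and C: "C \<subseteq> V" "\<And>e. e \<in> E \<Longrightarrow> e \<inter> C \<noteq> {}"
    and E: "\<And>e. e \<in> E \<Longrightarrow> e \<subseteq> V1 \<union> X \<or> e \<subseteq> V2 \<union> X"
    and c1: "star_colouring q (V1 \<union> X) E1 (C \<inter> (V1 \<union> X)) c1" "inj_on c1 X"
    and c2: "star_colouring q (V2 \<union> X) E2 (C \<inter> (V2 \<union> X)) c2" "inj_on c2 X"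
    and E1: "\<And>e. e \<in> E \<Longrightarrow> e \<subseteq> V1 \<union> X \<Longrightarrow> e \<in> E1" and E2: "\<And>e. e \<in> E \<Longrightarrow> e \<subseteq> V2 \<union> X \<Longrightarrow> e \<in> E2"
  obtains c where "star_colouring q V E C c"
proof -
  have "c1 ` X \<subseteq> {..<q}" "c2 ` X \<subseteq> {..<q}" using c1(1) c2(1) X(1) by (auto simp: star_colouring_def)
  then obtain p where p: "inj_on p {..<q}" "p ` {..<q} \<subseteq> {..<q}" "\<And>x. x \<in> X \<Longrightarrow> p (c2 x) = c1 x"
    using extend_partial_injection[OF X(2) c1(2) c2(2)] by metis
  define c where "c = (\<lambda>z. if z \<in> V1 \<union> X then c1 z else p (c2 z))"
  have cc1: "c z = c1 z" if "z \<in> V1 \<union> X" for z using that by (simp add: c_def)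
  have cc2: "c z = p (c2 z)" if "z \<in> V2 \<union> X" for z
  proof (cases "z \<in> X")
    case True
    then show ?thesis using p(3) by (simp add: c_def)
  next
    case False
    then have "z \<notin> V1 \<union> X" using that V(2) by blast
    then show ?thesis by (simp add: c_def)
  qed
  have lt2: "c2 z < q" if "z \<in> C" "z \<in> V2 \<union> X" for z using c2(1) that by (auto simp: star_colouring_def)
  have p_eq: "x = y" if "p x = p y" "x < q" "y < q" for x y using p(1) that by (auto dest: inj_onD)
  have nb1: "neighbourhood E v \<subseteq> neighbourhood E1 v \<inter> (V1 \<union> X)" if v: "v \<in> V1" for v
  proof
    fix x assume "x \<in> neighbourhood E v"
    then have e: "{x, v} \<in> E" by (simp add: neighbourhood_def)
    then have "{x, v} \<subseteq> V1 \<union> X" using E[OF e] v V by blast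
    then show "x \<in> neighbourhood E1 v \<inter> (V1 \<union> X)" using E1[OF e] by (simp add: neighbourhood_def)
  qed
  have nb2: "neighbourhood E v \<subseteq> neighbourhood E2 v \<inter> (V2 \<union> X)" if v: "v \<in> V2" for v
  proof
    fix x assume "x \<in> neighbourhood E v"
    then have e: "{x, v} \<in> E" by (simp add: neighbourhood_def)
    then have "{x, v} \<subseteq> V2 \<union> X" using E[OF e] v V by blast
    then show "x \<in> neighbourhood E2 v \<inter> (V2 \<union> X)" using E2[OF e] by (simp add: neighbourhood_def)
  qed
  show thesis
  proof (rule that[of c], unfold star_colouring_def, intro conjI ballI impI)
    fix x assume x: "x \<in> C"
    then have "x \<in> V1 \<union> X \<or> x \<in> V2 \<union> X" using C(1) V(1) by blast
    then show "c x < q"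
    proof
      assume "x \<in> V1 \<union> X"
      then show ?thesis using cc1 c1(1) x by (auto simp: star_colouring_def)
    next
      assume "x \<in> V2 \<union> X"
      then show ?thesis using cc2 lt2[OF x] p(2) by auto
    qed
    fix y assume y: "y \<in> C" and e: "{x, y} \<in> E"
    show "c x \<noteq> c y"
      using E[OF e]
    proof
      assume s: "{x, y} \<subseteq> V1 \<union> X"
      then have "{x, y} \<in> E1" using E1[OF e] by blast
      then show ?thesis using c1(1) x y s cc1 by (auto simp: star_colouring_def)
    next
      assume s: "{x, y} \<subseteq> V2 \<union> X"
      then have "{x, y} \<in> E2" using E2[OF e] by blast
      then have "c2 x \<noteq> c2 y" using c2(1) x y s by (auto simp: star_colouring_def)
      then show ?thesis using cc2 s p_eq lt2 x y by auto
    qed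
  next
    fix v assume v: "v \<in> V - C"
    then have "v \<in> V1 \<or> v \<in> V2" using V(1) X(1) by blast
    then show "inj_on c (neighbourhood E v)"
    proof
      assume v1: "v \<in> V1"
      then have "inj_on c1 (neighbourhood E1 v)" using c1(1) v by (auto simp: star_colouring_def)
      then have "inj_on c1 (neighbourhood E v)" using nb1[OF v1] inj_on_subset by blast
      then show ?thesis using nb1[OF v1] cc1 by (subst inj_on_cong[of _ _ c1]) auto
    next
      assume v2: "v \<in> V2"
      then have i: "inj_on c2 (neighbourhood E2 v)" using c2(1) v by (auto simp: star_colouring_def)
      show ?thesis
      proof (rule inj_onI)
        fix x y assume xy: "x \<in> neighbourhood E v" "y \<in> neighbourhood E v" "c x = c y"
        have "x \<in> C" "y \<in> C" using C(2)[of "{x, v}"] C(2)[of "{y, v}"] xy v by (auto simp: neighbourhood_def)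
        moreover have "x \<in> V2 \<union> X" "y \<in> V2 \<union> X" using nb2[OF v2] xy by blast+
        ultimately have "c2 x = c2 y" using p_eq lt2 cc2 xy(3) by auto
        then show "x = y" using i nb2[OF v2] xy by (auto dest: inj_onD)
      qed
    qed
  qed
qed

section \<open>Separations and their sides\<close>

definition separation :: "'a set \<Rightarrow> 'a set set \<Rightarrow> 'a set \<Rightarrow> 'a set \<Rightarrow> 'a set \<Rightarrow> bool" where
  "separation V E X V1 V2 \<longleftrightarrow> V = V1 \<union> V2 \<union> X \<and> V1 \<inter> V2 = {} \<and> V1 \<inter> X = {} \<and> V2 \<inter> X = {} \<and>
     V1 \<noteq> {} \<and> V2 \<noteq> {} \<and> (\<forall>e\<in>E. e \<subseteq> V1 \<union> X \<or> e \<subseteq> V2 \<union> X)"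

lemma separationD:
  assumes "separation V E X V1 V2"
  shows "V = V1 \<union> V2 \<union> X" "V1 \<inter> V2 = {}" "V1 \<inter> X = {}" "V2 \<inter> X = {}" "V1 \<noteq> {}" "V2 \<noteq> {}"
    "\<And>e. e \<in> E \<Longrightarrow> e \<subseteq> V1 \<union> X \<or> e \<subseteq> V2 \<union> X"
  using assms by (simp_all add: separation_def)

lemma separation_sym: "separation V E X V1 V2 \<Longrightarrow> separation V E X V2 V1"
  unfolding separation_def by blast

lemma separationI_not_linked:
  assumes "X \<subseteq> V" "u \<in> V - X" "w \<in> V - X" "(u, w) \<notin> (link E X)\<^sup>*"
    and E: "\<And>e. e \<in> E \<Longrightarrow> e \<subseteq> V" "\<And>e. e \<in> E \<Longrightarrow> card e = 2"
  obtains V1 V2 where "separation V E X V1 V2"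
proof
  define V1 where "V1 = {z \<in> V - X. (u, z) \<in> (link E X)\<^sup>*}"
  define V2 where "V2 = V - X - V1"
  have step: "z' \<in> V1" if "z \<in> V1" "{z, z'} \<in> E" "z' \<notin> X" for z z'
  proof -
    have "(z, z') \<in> link E X" using that by (auto simp: link_def V1_def)
    then show ?thesis using that E(1)[OF that(2)] by (auto simp: V1_def intro: rtrancl_into_rtrancl)
  qed
  have "e \<subseteq> V1 \<union> X \<or> e \<subseteq> V2 \<union> X" if e: "e \<in> E" for e
  proof -
    obtain z z' where z: "e = {z, z'}" using E(2)[OF e] by (metis card_2_iff)
    have "{z', z} \<in> E" "{z, z'} \<in> E" using e z by (simp_all add: insert_commute)
    then have "z' \<in> V1" if "z \<in> V1" "z' \<notin> X" using step that by blast
    moreover have "z \<in> V1" if "z' \<in> V1" "z \<notin> X" using step that \<open>{z', z} \<in> E\<close> by blast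
    moreover have "z \<in> V" "z' \<in> V" using E(1)[OF e] z by auto
    ultimately show ?thesis unfolding z V2_def by auto
  qed
  moreover have "u \<in> V1" "w \<in> V2" using assms by (auto simp: V1_def V2_def)
  ultimately show "separation V E X V1 V2"
    using assms(1) unfolding separation_def by (auto simp: V1_def V2_def)
qed

text \<open>A walk from \<open>V2\<close> that avoids \<open>y\<close> can leave \<open>V2\<close>
  only through \<open>x\<close>; cutting it at its first visit to \<open>x\<close> keeps it on the
  second side.\<close>

lemma separation_reach:
  assumes sep: "separation V E {x, y} V1 V2" and w: "w \<in> V2" and r: "(w, x) \<in> (link E {y})\<^sup>*"
  shows "(w, x) \<in> (link {e \<in> E. e \<subseteq> V2 \<union> {x, y}} {})\<^sup>*"
proof -
  let ?R = "link {e \<in> E. e \<subseteq> V2 \<union> {x, y}} {}"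
  note d = separationD(2,4)[OF sep]
  have "(w, x) \<in> ?R\<^sup>* \<or> (w, z) \<in> ?R\<^sup>* \<and> z \<in> V2" if "(w, z) \<in> (link E {y})\<^sup>*" for z
    using that
  proof (induction rule: rtrancl_induct)
    case (step z z')
    show ?case
    proof (cases "(w, x) \<in> ?R\<^sup>*")
      case False
      then have z: "(w, z) \<in> ?R\<^sup>*" "z \<in> V2" using step by auto
      have e: "{z, z'} \<in> E" "z' \<noteq> y" using step(2) by (auto simp: link_def)
      have "{z, z'} \<subseteq> V1 \<union> {x, y} \<or> {z, z'} \<subseteq> V2 \<union> {x, y}"
        by (rule separationD(7)[OF sep e(1)])
      moreover have "z \<notin> V1 \<union> {x, y}" using d z(2) by blast
      ultimately have "{z, z'} \<subseteq> V2 \<union> {x, y}" by blast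
      then have "(z, z') \<in> ?R" using e by (simp add: link_def)
      then have "(w, z') \<in> ?R\<^sup>*" using z(1) by simp
      then show ?thesis using \<open>{z, z'} \<subseteq> V2 \<union> {x, y}\<close> e(2) by auto
    qed simp
  qed (use w in simp)
  from this[OF r] show ?thesis by blast
qed

text \<open>The new edge can be drawn along a path through the other side of the separation.\<close>

lemma drawable_side:
  assumes dr: "drawable V E" and sep: "separation V E {x, y} V1 V2" and xy: "x \<noteq> y"
    and one: "\<And>w. w \<in> V - {y} \<Longrightarrow> (w, x) \<in> (link E {y})\<^sup>*" "\<And>w. w \<in> V - {x} \<Longrightarrow> (w, y) \<in> (link E {x})\<^sup>*"
  shows "drawable (V1 \<union> {x, y}) ({e \<in> E. e \<subseteq> V1 \<union> {x, y}} \<union> {{x, y}})"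
proof (cases "{x, y} \<in> E")
  case True
  have "V1 \<union> {x, y} \<subseteq> V" using sep by (auto simp: separation_def)
  then show ?thesis using True by (intro drawable_mono[OF dr]) auto
next
  case False
  obtain A where A: "plane_graph V A" "ends V A = E" using dr by (auto simp: drawable_def)
  define W where "W = V1 \<union> {x, y}"
  define A1 where "A1 = {a \<in> A. a \<inter> V \<subseteq> W}"
  define B where "B = {a \<in> A. a \<inter> V \<subseteq> V2 \<union> {x, y}}"
  have V: "V = V1 \<union> V2 \<union> {x, y}" "V1 \<inter> V2 = {}" "V1 \<inter> {x, y} = {}" "V2 \<inter> {x, y} = {}" "V2 \<noteq> {}"
    using sep by (auto simp: separation_def)
  then obtain w where w: "w \<in> V2" by blast
  have WV: "W \<subseteq> V" using V by (auto simp: W_def)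
  have eB: "{e \<in> E. e \<subseteq> V2 \<union> {x, y}} = ends V B" using A(2) by (auto simp: B_def)
  \<comment> \<open>Neither \<open>x\<close> nor \<open>y\<close> separates alone, so
    \<open>w\<close> reaches \<open>x\<close> without \<open>y\<close> and \<open>y\<close> without
    \<open>x\<close>. The two walks together join \<open>x\<close> to \<open>y\<close> on the second
    side.\<close>
  have wx: "(w, x) \<in> (link (ends V B) {})\<^sup>*"
    using separation_reach[OF sep w one(1)] w V eB by auto
  have sep': "separation V E {y, x} V1 V2" using sep by (simp add: insert_commute)
  have "(w, y) \<in> (link {e \<in> E. e \<subseteq> V2 \<union> {y, x}} {})\<^sup>*"
    using separation_reach[OF sep' w one(2)] w V by auto
  then have wy: "(w, y) \<in> (link (ends V B) {})\<^sup>*" using eB by (simp add: insert_commute)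
  have "(x, w) \<in> (link (ends V B) {})\<^sup>*" using wx sym_link sym_rtrancl by (metis symD)
  then have "(x, y) \<in> (link (ends V B) {})\<^sup>*" using wy by (rule rtrancl_trans)
  moreover have BA: "B \<subseteq> A" by (auto simp: B_def)
  ultimately obtain g where g: "arc g" "pathstart g = x" "pathfinish g = y" "path_image g \<subseteq> \<Union>B"
    using link_arc[OF A(1) _ xy] by metis
  have pgW: "plane_graph W A1" by (rule plane_graph_mono[OF A(1) _ WV]) (auto simp: A1_def)
  have "a \<inter> W = a \<inter> V" if "a \<in> A1" for a using that WV by (auto simp: A1_def)
  then have "ends W A1 = ends V A1" by (intro image_cong) auto
  then have eW: "ends W A1 = {e \<in> E. e \<subseteq> W}" using A(2) by (auto simp: A1_def)
  have "drawable W (insert {x, y} (ends W A1))"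
  proof (rule drawable_insert_arc[OF pgW g(1-3)])
    show "{x, y} \<notin> ends W A1" using False eW by auto
    have "x \<in> path_image g" "y \<in> path_image g"
      using g pathstart_in_path_image pathfinish_in_path_image by metis+
    moreover have "\<Union>B \<inter> W \<subseteq> {x, y}" using V WV by (auto simp: B_def W_def)
    ultimately show "path_image g \<inter> W = {x, y}" using g(4) by (auto simp: W_def)
    fix a assume a: "a \<in> A1"
    show "a \<inter> path_image g \<subseteq> W"
    proof
      fix z assume z: "z \<in> a \<inter> path_image g"
      then obtain b where b: "b \<in> B" "z \<in> b" using g(4) by blast
      \<comment> \<open>An edge belonging to both sides would have the ends \<open>x\<close> and
        \<open>y\<close>, but this pair is not an edge in the present case.\<close>
      have "a \<noteq> b"
      proof
        assume "a = b"
        then have "a \<inter> V \<subseteq> {x, y}" using a b V(2-4) by (auto simp: A1_def B_def W_def)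
        moreover have "card (a \<inter> V) = 2" using ends_simple(2)[OF A(1), of "a \<inter> V"] a by (auto simp: A1_def)
        ultimately have "a \<inter> V = {x, y}" using xy by (intro card_subset_eq) auto
        then show False using False A(2) a by (auto simp: A1_def)
      qed
      then have "z \<in> V" using plane_graph_Int[OF A(1), of a b] a b z BA by (auto simp: A1_def)
      then show "z \<in> W" using z a by (auto simp: A1_def)
    qed
  qed
  moreover have "insert {x, y} (ends W A1) = {e \<in> E. e \<subseteq> W} \<union> {{x, y}}" unfolding eW by blast
  ultimately show ?thesis unfolding W_def by simp
qed

text \<open>\<open>C\<close> shrinks because the other side has a vertex of \<open>C\<close> outside
  \<open>X\<close>: a star centre there has at least three leaves, of which at most two are in
  \<open>X\<close>. Stars do not grow, as the new edge lies inside \<open>C\<close>.\<close>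

lemma side_system:
  assumes sys: "star_system k V E C" and big: "\<And>v. v \<in> V - C \<Longrightarrow> card (neighbourhood E v) \<ge> 3"
    and sep: "separation V E X V1 V2" and X: "X \<subseteq> C" "card X \<le> 2"
    and E1: "E1 = {e \<in> E. e \<subseteq> V1 \<union> X} \<union> (if card X = 2 then {X} else {})"
    and dr: "card X = 2 \<Longrightarrow> drawable (V1 \<union> X) E1"
  shows "star_system k (V1 \<union> X) E1 (C \<inter> (V1 \<union> X))" "card (C \<inter> (V1 \<union> X)) < card C"
proof -
  have V: "V = V1 \<union> V2 \<union> X" "V1 \<inter> V2 = {}" "V1 \<inter> X = {}" "V2 \<inter> X = {}" "V2 \<noteq> {}"
    and sE: "\<And>e. e \<in> E \<Longrightarrow> e \<subseteq> V1 \<union> X \<or> e \<subseteq> V2 \<union> X"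
    using sep by (auto simp: separation_def)
  have s: "drawable V E" "C \<subseteq> V" "\<And>e. e \<in> E \<Longrightarrow> e \<inter> C \<noteq> {}"
    "\<And>v. v \<in> V - C \<Longrightarrow> card (neighbourhood E v) \<le> k" using sys by (auto simp: star_system_def)
  note ds = drawable_simple[OF s(1)]
  have d1: "drawable (V1 \<union> X) E1"
  proof (cases "card X = 2")
    case False
    then show ?thesis using V(1) unfolding E1 by (intro drawable_mono[OF s(1)]) auto
  qed (rule dr)
  show "star_system k (V1 \<union> X) E1 (C \<inter> (V1 \<union> X))"
    unfolding star_system_def
  proof (intro conjI ballI d1)
    fix e assume "e \<in> E1"
    then consider "e \<in> E" "e \<subseteq> V1 \<union> X" | "e = X" "card X = 2" unfolding E1 by (auto split: if_splits)
    then show "e \<inter> (C \<inter> (V1 \<union> X)) \<noteq> {}"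
    proof cases
      case 1
      then show ?thesis using s(3)[OF 1(1)] by blast
    next
      case 2
      then have "X \<noteq> {}" by auto
      then show ?thesis using 2 X(1) by blast
    qed
  next
    fix v assume v: "v \<in> V1 \<union> X - C \<inter> (V1 \<union> X)"
    then have vC: "v \<in> V - C" using V(1) by blast
    have "neighbourhood E1 v \<subseteq> neighbourhood E v"
      using vC X(1) unfolding E1 neighbourhood_def by (auto split: if_splits)
    then have "card (neighbourhood E1 v) \<le> card (neighbourhood E v)" using ds(5) card_mono by blast
    then show "card (neighbourhood E1 v) \<le> k" using s(4)[OF vC] by simp
  qed blast
  have fC: "finite C" using s(2) ds(1) finite_subset by blast
  have "\<exists>z. z \<in> V2 \<inter> C"
  proof -
    obtain w where w: "w \<in> V2" using V(5) by blast
    show ?thesis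
    proof (cases "w \<in> C")
      case False
      then have wC: "w \<in> V - C" using w V(1) by blast
      have nb: "neighbourhood E w \<subseteq> C \<inter> (V2 \<union> X)"
      proof
        fix z assume "z \<in> neighbourhood E w"
        then have e: "{z, w} \<in> E" by (simp add: neighbourhood_def)
        then show "z \<in> C \<inter> (V2 \<union> X)" using sE[OF e] s(3)[OF e] wC w V by blast
      qed
      have "\<not> neighbourhood E w \<subseteq> X"
      proof
        assume "neighbourhood E w \<subseteq> X"
        then have "card (neighbourhood E w) \<le> card X" using X(1) fC by (meson card_mono finite_subset)
        then show False using big[OF wC] X(2) by simp
      qed
      then show ?thesis using nb by blast
    qed (use w in blast)
  qed
  then have "C \<inter> (V1 \<union> X) \<subset> C" using V by blast
  then show "card (C \<inter> (V1 \<union> X)) < card C" using fC psubset_card_mono by blast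
qed

section \<open>Stars with at most two leaves\<close>

text \<open>The two spokes at \<open>v\<close> are concatenated to a single arc; \<open>new\<close>
  keeps the result free of parallel edges.\<close>

lemma drawable_smooth:
  assumes dr: "drawable V E" and v: "neighbourhood E v = {x, y}" "x \<noteq> y" and new: "{x, y} \<notin> E"
  shows "drawable (V - {v}) (insert {x, y} {e \<in> E. v \<notin> e})"
proof -
  obtain A where A: "plane_graph V A" "ends V A = E" using dr by (auto simp: drawable_def)
  have e: "{x, v} \<in> ends V A" "{v, y} \<in> ends V A"
  proof -
    have "x \<in> neighbourhood E v" "y \<in> neighbourhood E v" unfolding v(1) by simp_all
    then show "{x, v} \<in> ends V A" "{v, y} \<in> ends V A"
      unfolding neighbourhood_def A(2) by (simp_all add: insert_commute)
  qed
  have ne: "x \<noteq> v" "y \<noteq> v" using drawable_simple(4)[OF dr] e A(2) by auto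
  obtain g1 where g1: "arc g1" "pathstart g1 = x" "pathfinish g1 = v" "path_image g1 \<in> A" "path_image g1 \<inter> V = {x, v}"
    using endsE[OF A(1) e(1)] .
  obtain g2 where g2: "arc g2" "pathstart g2 = v" "pathfinish g2 = y" "path_image g2 \<in> A" "path_image g2 \<inter> V = {v, y}"
    using endsE[OF A(1) e(2)] .
  define W where "W = V - {v}"
  define A1 where "A1 = {a \<in> A. v \<notin> a}"
  have pgW: "plane_graph W A1"
    by (rule plane_graph_mono[OF A(1)]) (auto simp: A1_def W_def)
  have eq: "a \<inter> W = a \<inter> V" if "a \<in> A1" for a using that by (auto simp: A1_def W_def)
  have vV: "v \<in> V" using g1(5) by blast
  have "ends W A1 = ends V A1" using eq by (intro image_cong) auto
  also have "\<dots> = {e \<in> E. v \<notin> e}" using A(2) vV by (auto simp: A1_def)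
  finally have eW: "ends W A1 = {e \<in> E. v \<notin> e}" .
  have "path_image g1 \<noteq> path_image g2" using g1(5) g2(5) v(2) ne by (metis doubleton_eq_iff)
  then have "path_image g1 \<inter> path_image g2 \<subseteq> V" using plane_graph_Int[OF A(1) g1(4) g2(4)] by blast
  then have "path_image g1 \<inter> path_image g2 \<subseteq> {x, v} \<inter> {v, y}" using g1(5) g2(5) by blast
  then have i: "path_image g1 \<inter> path_image g2 \<subseteq> {v}" using v(2) by auto
  have arc: "arc (g1 +++ g2)" using g1 g2 i by (intro arc_join) auto
  have im: "path_image (g1 +++ g2) = path_image g1 \<union> path_image g2" using g1 g2 by (simp add: path_image_join)
  have "drawable W (insert {x, y} (ends W A1))"
  proof (rule drawable_insert_arc[OF pgW arc])
    have "(path_image g1 \<union> path_image g2) \<inter> W = (path_image g1 \<inter> V \<union> path_image g2 \<inter> V) - {v}"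
      by (auto simp: W_def)
    also have "\<dots> = {x, y}" unfolding g1(5) g2(5) using ne by auto
    finally show "path_image (g1 +++ g2) \<inter> W = {x, y}" unfolding im .
    show "{x, y} \<notin> ends W A1" using new eW by auto
    fix a assume a: "a \<in> A1"
    have "v \<in> path_image g1" "v \<in> path_image g2" using g1(5) g2(5) by blast+
    then have "a \<in> A" "a \<noteq> path_image g1" "a \<noteq> path_image g2" using a by (auto simp: A1_def)
    then have "a \<inter> path_image g1 \<subseteq> V" "a \<inter> path_image g2 \<subseteq> V"
      using plane_graph_Int[OF A(1) _ g1(4)] plane_graph_Int[OF A(1) _ g2(4)] by blast+
    then show "a \<inter> path_image (g1 +++ g2) \<subseteq> W" using a unfolding im by (auto simp: A1_def W_def)
  qed (use g1 g2 in auto)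
  then show ?thesis unfolding eW unfolding W_def .
qed

text \<open>A star with two leaves imposes the same constraint as an edge between them, and a star
  with fewer leaves imposes none.\<close>

lemma remove_small_star:
  assumes sys: "star_system k V E C" and v: "v \<in> V - C" and small: "card (neighbourhood E v) \<le> 2"
    and E': "E' = {e \<in> E. v \<notin> e} \<union> (if card (neighbourhood E v) = 2 then {neighbourhood E v} else {})"
  shows "star_system k (V - {v}) E' C"
    and "star_colouring q (V - {v}) E' C c \<Longrightarrow> star_colouring q V E C c"
proof -
  let ?N = "neighbourhood E v"
  have s: "drawable V E" "C \<subseteq> V" "\<And>e. e \<in> E \<Longrightarrow> e \<inter> C \<noteq> {}"
    "\<And>v. v \<in> V - C \<Longrightarrow> card (neighbourhood E v) \<le> k" using sys by (auto simp: star_system_def)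
  note ds = drawable_simple[OF s(1)]
  have NC: "?N \<subseteq> C"
  proof
    fix x assume "x \<in> ?N"
    then have "{x, v} \<in> E" by (simp add: neighbourhood_def)
    then show "x \<in> C" using s(3) v by fastforce
  qed
  have dr: "drawable (V - {v}) E'"
  \<comment> \<open>If the two leaves are already adjacent, deleting \<open>v\<close> is enough and
    no arc has to be drawn.\<close>
  proof (cases "card ?N = 2 \<and> ?N \<notin> E")
    case True
    then obtain x y where xy: "?N = {x, y}" "x \<noteq> y" by (meson card_2_iff)
    then show ?thesis using drawable_smooth[OF s(1) xy] True unfolding E' by simp
  next
    case False
    have "v \<notin> ?N" using NC v by blast
    then show ?thesis unfolding E' using False ds(2) by (intro drawable_mono[OF s(1)]) (auto split: if_splits)
  qed
  have nb: "neighbourhood E' u = neighbourhood E u" if u: "u \<in> V - {v} - C" for u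
  proof
    show "neighbourhood E' u \<subseteq> neighbourhood E u"
      using u NC unfolding E' neighbourhood_def by (auto split: if_splits)
    show "neighbourhood E u \<subseteq> neighbourhood E' u"
    proof
      fix x assume "x \<in> neighbourhood E u"
      then have e: "{x, u} \<in> E" by (simp add: neighbourhood_def)
      then have "x \<in> C" using s(3)[OF e] u by blast
      then have "v \<notin> {x, u}" using u v by blast
      then show "x \<in> neighbourhood E' u" using e by (simp add: E' neighbourhood_def)
    qed
  qed
  show "star_system k (V - {v}) E' C"
    unfolding star_system_def
  proof (intro conjI ballI dr)
    show "C \<subseteq> V - {v}" using s(2) v by blast
    fix e assume "e \<in> E'"
    then consider "e \<in> E" | "e = ?N" "card ?N = 2" unfolding E' by (auto split: if_splits)
    then show "e \<inter> C \<noteq> {}"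
    proof cases
      case 2
      then have "?N \<noteq> {}" by auto
      then show ?thesis using 2 NC by blast
    qed (use s(3) in blast)
  next
    fix u assume "u \<in> V - {v} - C"
    then show "card (neighbourhood E' u) \<le> k" using nb s(4) by auto
  qed
  assume c: "star_colouring q (V - {v}) E' C c"
  then have c': "\<And>x y. x \<in> C \<Longrightarrow> y \<in> C \<Longrightarrow> {x, y} \<in> E' \<Longrightarrow> c x \<noteq> c y"
    by (auto simp: star_colouring_def)
  show "star_colouring q V E C c"
    unfolding star_colouring_def
  proof (intro conjI ballI impI)
    fix x assume x: "x \<in> C"
    then show "c x < q" using c by (auto simp: star_colouring_def)
    fix y assume "y \<in> C" "{x, y} \<in> E"
    then show "c x \<noteq> c y" using c'[OF x, of y] v x by (auto simp: E')
  next
    fix u assume u: "u \<in> V - C"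
    show "inj_on c (neighbourhood E u)"
    proof (cases "u = v")
      case True
      show ?thesis
      proof (cases "card ?N = 2")
        case 2: True
        then obtain x y where xy: "?N = {x, y}" "x \<noteq> y" by (meson card_2_iff)
        then have "c x \<noteq> c y" using c'[of x y] NC 2 by (auto simp: E')
        then show ?thesis using xy True by simp
      next
        case False
        then have "card ?N \<le> Suc 0" using small by simp
        then show ?thesis using ds(5) True by (auto simp: card_le_Suc0_iff_eq inj_on_def)
      qed
    next
      case False
      then have "u \<in> V - {v} - C" using u by blast
      then show ?thesis using c nb by (auto simp: star_colouring_def)
    qed
  qed
qed

section \<open>The induction\<close>

text \<open>For \<open>card X = 2\<close> both sides contain the edge \<open>X\<close>, so both
  colourings are injective on \<open>X\<close> and can be matched by a permutation. For smaller
  \<open>X\<close> injectivity is automatic.\<close>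

lemma glue_sides:
  assumes sys: "star_system k V E C" and big: "\<And>v. v \<in> V - C \<Longrightarrow> card (neighbourhood E v) \<ge> 3"
    and sep: "separation V E X V1 V2" and X: "X \<subseteq> C" "card X \<le> 2"
    and E': "\<And>U. E' U = {e \<in> E. e \<subseteq> U \<union> X} \<union> (if card X = 2 then {X} else {})"
    and dr: "\<And>U1 U2. separation V E X U1 U2 \<Longrightarrow> card X = 2 \<Longrightarrow> drawable (U1 \<union> X) (E' U1)"
    and col: "\<And>V' E' C'. card C' < card C \<Longrightarrow> star_system k V' E' C' \<Longrightarrow> \<exists>c. star_colouring q V' E' C' c"
  shows "\<exists>c. star_colouring q V E C c"
proof -
  have s: "drawable V E" "C \<subseteq> V" "\<And>e. e \<in> E \<Longrightarrow> e \<inter> C \<noteq> {}" using sys by (auto simp: star_system_def)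
  have fX: "finite X" using X(1) s(2) drawable_simple(1)[OF s(1)] by (meson finite_subset)
  have *: "\<exists>c. star_colouring q (U1 \<union> X) (E' U1) (C \<inter> (U1 \<union> X)) c \<and> inj_on c X"
    if sp: "separation V E X U1 U2" for U1 U2
  proof -
    note ss = side_system[OF sys big sp X E' dr[OF sp]]
    obtain c where c: "star_colouring q (U1 \<union> X) (E' U1) (C \<inter> (U1 \<union> X)) c"
      using col[OF ss(2) ss(1)] by blast
    have "inj_on c X"
    proof (cases "card X = 2")
      case True
      then obtain x y where xy: "X = {x, y}" by (meson card_2_iff)
      then have "{x, y} \<in> E' U1" "x \<in> C \<inter> (U1 \<union> X)" "y \<in> C \<inter> (U1 \<union> X)" using True X(1) by (auto simp: E')
      then have "c x \<noteq> c y" using c unfolding star_colouring_def by blast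
      then show ?thesis using xy by (auto simp: inj_on_def)
    next
      case False
      then have "card X \<le> Suc 0" using X(2) by simp
      then show ?thesis using fX by (auto simp: card_le_Suc0_iff_eq inj_on_def)
    qed
    then show ?thesis using c by blast
  qed
  obtain c1 where c1: "star_colouring q (V1 \<union> X) (E' V1) (C \<inter> (V1 \<union> X)) c1" "inj_on c1 X" using *[OF sep] by blast
  obtain c2 where c2: "star_colouring q (V2 \<union> X) (E' V2) (C \<inter> (V2 \<union> X)) c2" "inj_on c2 X"
    using *[OF separation_sym[OF sep]] by blast
  show ?thesis
    using star_colouring_glue[OF separationD(1-4)[OF sep] X(1) fX s(2,3) separationD(7)[OF sep] c1 c2]
    by (metis (no_types, lifting) E' UnI1 mem_Collect_eq)
qed

text \<open>The lexicographic measure reflects three reductions: a separation shrinks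
  \<open>C\<close>; removing a small star keeps \<open>C\<close> and shrinks \<open>V - C\<close>;
  adding an edge keeps both and shrinks the set of non-edges. Only when none of them applies is the
  hypothesis on cyclic colourings invoked.\<close>

lemma star_system_colourable:
  assumes hyp: "\<And>W A. plane_graph W A \<Longrightarrow> max_face_size W A \<le> k \<Longrightarrow>
                 \<exists>c. cyclic_colouring W A c \<and> (\<forall>x\<in>W. c x < q)"
    and k: "k \<ge> 3"
  shows "star_system k V E C \<Longrightarrow> \<exists>c. star_colouring q V E C c"
proof (induction "(V, E, C)" arbitrary: V E C
    rule: wf_induct_rule[OF wf_measures[of "[\<lambda>(V, E, C). card C, \<lambda>(V, E, C). card (V - C),
      \<lambda>(V, E, C). card (Pow V - E)]"]])
  case (1 V E C)
  have sys: "star_system k V E C" by fact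
  have IH1: "\<exists>c. star_colouring q V' E' C' c" if "card C' < card C" "star_system k V' E' C'" for V' E' C'
    using 1(1)[of V' E' C'] that by simp
  have IH2: "\<exists>c. star_colouring q V' E' C c" if "card (V' - C) < card (V - C)" "star_system k V' E' C" for V' E'
    using 1(1)[of V' E' C] that by simp
  have IH3: "\<exists>c. star_colouring q V E' C c" if "card (Pow V - E') < card (Pow V - E)" "star_system k V E' C" for E'
    using 1(1)[of V E' C] that by simp
  have s: "drawable V E" "C \<subseteq> V" "\<And>e. e \<in> E \<Longrightarrow> e \<inter> C \<noteq> {}"
    "\<And>v. v \<in> V - C \<Longrightarrow> card (neighbourhood E v) \<le> k" using sys by (auto simp: star_system_def)
  note ds = drawable_simple[OF s(1)]
  show ?case
  proof (cases "\<exists>v\<in>V - C. card (neighbourhood E v) \<le> 2")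
    case True
    then obtain v where v: "v \<in> V - C" "card (neighbourhood E v) \<le> 2" by blast
    have "V - {v} - C \<subset> V - C" using v by blast
    then have "card (V - {v} - C) < card (V - C)" using ds(1) by (intro psubset_card_mono) auto
    then show ?thesis using IH2 remove_small_star[OF sys v refl] by blast
  next
    case False
    then have big: "card (neighbourhood E v) \<ge> 3" if "v \<in> V - C" for v using that by force
    define E' where "E' = (\<lambda>X U. {e \<in> E. e \<subseteq> U \<union> X} \<union> (if card X = 2 then {X} else {}))"
    show ?thesis
    \<comment> \<open>Single vertices come before pairs, since drawing the edge of a separating pair
      relies on neither of its vertices separating alone.\<close>
    proof (cases "\<exists>x\<in>C. \<exists>u\<in>V - {x}. \<exists>w\<in>V - {x}. (u, w) \<notin> (link E {x})\<^sup>*")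
      case True
      then obtain x u w where x: "x \<in> C" "u \<in> V - {x}" "w \<in> V - {x}" "(u, w) \<notin> (link E {x})\<^sup>*" by blast
      obtain V1 V2 where sep: "separation V E {x} V1 V2"
        using separationI_not_linked[OF _ x(2-4) ds(2,3)] x(1) s(2) by blast
      show ?thesis
        by (rule glue_sides[OF sys big sep _ _ E'_def[THEN fun_cong, THEN fun_cong] _ IH1]) (use x in auto)
    next
      case False
      then have one: "(u, w) \<in> (link E {x})\<^sup>*" if "x \<in> C" "u \<in> V - {x}" "w \<in> V - {x}" for x u w
        using that by blast
      show ?thesis
      proof (cases "\<exists>x\<in>C. \<exists>y\<in>C. \<exists>u\<in>V - {x, y}. \<exists>w\<in>V - {x, y}. (u, w) \<notin> (link E {x, y})\<^sup>*")
        case True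
        then obtain x y u w where xy: "x \<in> C" "y \<in> C" "u \<in> V - {x, y}" "w \<in> V - {x, y}"
          "(u, w) \<notin> (link E {x, y})\<^sup>*" by blast
        \<comment> \<open>With \<open>x = y\<close> a single vertex would separate, which is already
          excluded.\<close>
        have ne: "x \<noteq> y" using one[of x u w] xy by auto
        have xyV: "x \<in> V" "y \<in> V" using xy s(2) by auto
        obtain V1 V2 where sep: "separation V E {x, y} V1 V2"
          using separationI_not_linked[OF _ xy(3-5) ds(2,3)] xyV by blast
        show ?thesis
        proof (rule glue_sides[OF sys big sep _ _ E'_def[THEN fun_cong, THEN fun_cong] _ IH1])
          fix U1 U2 assume sp: "separation V E {x, y} U1 U2"
          show "drawable (U1 \<union> {x, y}) (E' {x, y} U1)"
            using drawable_side[OF s(1) sp ne] one xy xyV ne by (simp add: E'_def)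
        qed (use xy ne in auto)
      next
        case False
        then have two: "(u, w) \<in> (link E {x, y})\<^sup>*" if "x \<in> C" "y \<in> C" "u \<in> V - {x, y}" "w \<in> V - {x, y}" for x y u w
          using that by blast
        obtain A0 where A0: "plane_graph V A0" "ends V A0 = E" using s(1) by (auto simp: drawable_def)
        obtain r A where A: "tame r V A" "ends V A = E" using plane_graph_redraw_tame[OF A0(1)] A0(2) by metis
        show ?thesis
        proof (cases "\<exists>Q\<in>faces V A. \<exists>x\<in>C \<inter> closure Q. \<exists>y\<in>C \<inter> closure Q. x \<noteq> y \<and> {x, y} \<notin> E")
          case True
          then obtain Q x y where Q: "Q \<in> faces V A" and x: "x \<in> C" "x \<in> closure Q" and y: "y \<in> C" "y \<in> closure Q"
            and new: "x \<noteq> y" "{x, y} \<notin> E" by blast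
          have xyV: "x \<in> V" "y \<in> V" using x y s(2) by auto
          obtain g where g: "arc g" "pathstart g = x" "pathfinish g = y" "path_image g \<subseteq> Q \<union> {x, y}"
            using tame_crosscut[OF A(1) Q xyV(1) x(2) xyV(2) y(2) new(1)] .
          note pg = tameD(1)[OF A(1)]
          note fb = face_basics[OF pg Q]
          have "drawable V (insert {x, y} (ends V A))"
          proof (rule drawable_insert_arc[OF pg g(1-3)])
            have "x \<in> path_image g" "y \<in> path_image g"
              using g pathstart_in_path_image pathfinish_in_path_image by metis+
            then show "path_image g \<inter> V = {x, y}" using g(4) fb(4) xyV by blast
            show "{x, y} \<notin> ends V A" using new A(2) by simp
            fix a assume "a \<in> A"
            then show "a \<inter> path_image g \<subseteq> V" using g(4) fb(5) xyV by blast
          qed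
          then have d: "drawable V (insert {x, y} E)" using A(2) by simp
          \<comment> \<open>Both ends of the new edge are in \<open>C\<close>, so no star
            changes.\<close>
          have "neighbourhood (insert {x, y} E) v = neighbourhood E v" if "v \<in> V - C" for v
            using that x y by (auto simp: neighbourhood_def doubleton_eq_iff)
          then have sys': "star_system k V (insert {x, y} E) C"
            using d s x by (auto simp: star_system_def)
          have "Pow V - insert {x, y} E \<subset> Pow V - E" using new xyV by blast
          then have "card (Pow V - insert {x, y} E) < card (Pow V - E)"
            using ds(1) by (intro psubset_card_mono) auto
          then obtain c where "star_colouring q V (insert {x, y} E) C c" using IH3 sys' by blast
          then have "star_colouring q V E C c"
            unfolding star_colouring_def neighbourhood_def
            by (auto elim!: inj_on_subset)
          then show ?thesis by blast
        next
          case False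
          interpret saturated_drawing r V C A k
          proof
            show "tame r V A" "C \<subseteq> V" "k \<ge> 3" by (fact A s k)+
            show "e \<inter> C \<noteq> {}" if "e \<in> ends V A" for e using s(3) that A(2) by simp
            show "card (neighbourhood (ends V A) v) \<le> k" "card (neighbourhood (ends V A) v) \<ge> 3"
              if "v \<in> V - C" for v using s(4) big that A(2) by simp_all
            show "(u, w) \<in> (link (ends V A) {x, y})\<^sup>*"
              if "x \<in> C" "y \<in> C" "u \<in> V - {x, y}" "w \<in> V - {x, y}" for x y u w
              using two that A(2) by simp
            show "{x, y} \<in> ends V A"
              if "Q \<in> faces V A" "x \<in> C \<inter> closure Q" "y \<in> C \<inter> closure Q" "x \<noteq> y" for Q x y
              using False that unfolding A(2) by meson
          qed
          obtain c where c: "cyclic_colouring C C_edges c" "\<forall>x\<in>C. c x < q"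
            using hyp[OF plane_C_edges max_face_size_C] by blast
          have "star_colouring q V E C c"
            unfolding star_colouring_def
          proof (intro conjI ballI impI)
            show "c x \<noteq> c y" if "x \<in> C" "y \<in> C" "{x, y} \<in> E" for x y
              using cyclic_colouring_good(1)[OF c(1)] that A(2) by simp
            show "inj_on c (neighbourhood E v)" if "v \<in> V - C" for v
              using cyclic_colouring_good(2)[OF c(1)] that A(2) by simp
          qed (use c(2) in blast)
          then show ?thesis by blast
        qed
      qed
    qed
  qed
qed

section \<open>Squares and frugal colourings\<close>

text \<open>\<open>enat\<close> is well-ordered, so an infimum below a finite bound is attained; the
  infimum of the empty set is infinite.\<close>

lemma Inf_enat_le_iff:
  fixes X :: "enat set" and m :: nat
  shows "Inf X \<le> enat m \<longleftrightarrow> (\<exists>x\<in>X. x \<le> enat m)"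
proof
  assume le: "Inf X \<le> enat m"
  then have "X \<noteq> {}" by (auto simp: Inf_enat_def)
  then have "Inf X \<in> X" by (metis Inf_enat_def LeastI ex_in_conv)
  then show "\<exists>x\<in>X. x \<le> enat m" using le by blast
qed (meson Inf_lower order_trans)

lemma simple_graphD:
  assumes "simple_graph V E"
  shows "finite V" "{u, v} \<in> E \<Longrightarrow> u \<in> V" "{u, v} \<in> E \<Longrightarrow> v \<in> V" "{u, v} \<in> E \<Longrightarrow> u \<noteq> v"
    "finite (neighbourhood E w)"
proof -
  show f: "finite V" using assms by (simp add: simple_graph_def)
  show n: "{u, v} \<in> E \<Longrightarrow> u \<in> V" "{u, v} \<in> E \<Longrightarrow> v \<in> V" for u v
  proof -
    assume e: "{u, v} \<in> E"
    have "\<forall>e\<in>E. e \<subseteq> V" using assms by (simp add: simple_graph_def)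
    from bspec[OF this e] have "{u, v} \<subseteq> V" .
    then show "u \<in> V" "v \<in> V" by simp_all
  qed
  show "{u, v} \<in> E \<Longrightarrow> u \<noteq> v" using assms unfolding simple_graph_def by fastforce
  have "neighbourhood E w \<subseteq> V" using n by (auto simp: neighbourhood_def)
  then show "finite (neighbourhood E w)" using f finite_subset by blast
qed

lemma square_edges_iff:
  assumes "simple_graph V E"
  shows "{u, v} \<in> square_edges V E \<longleftrightarrow>
    u \<in> V \<and> v \<in> V \<and> u \<noteq> v \<and> ({u, v} \<in> E \<or> (\<exists>w. {u, w} \<in> E \<and> {w, v} \<in> E))"
proof -
  have dist: "graph_dist V E u v \<le> 2 \<longleftrightarrow> ({u, v} \<in> E \<or> (\<exists>w. {u, w} \<in> E \<and> {w, v} \<in> E))"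
    if uv: "u \<in> V" "v \<in> V" "u \<noteq> v" for u v
  proof -
    \<comment> \<open>Truncated subtraction does no harm here: the empty list satisfies both
      sides.\<close>
    have "enat (length p - 1) \<le> enat 2 \<longleftrightarrow> length p \<le> 3" for p :: "'a list" by auto
    then have "graph_dist V E u v \<le> 2 \<longleftrightarrow> (\<exists>p\<in>walks V E u v. length p \<le> 3)"
      by (simp only: graph_dist_def numeral_eq_enat Inf_enat_le_iff bex_simps)
    also have "\<dots> \<longleftrightarrow> ({u, v} \<in> E \<or> (\<exists>w. {u, w} \<in> E \<and> {w, v} \<in> E))"
    proof
      assume "\<exists>p\<in>walks V E u v. length p \<le> 3"
      then obtain p where p: "p \<in> walks V E u v" "length p \<le> 3" by blast
      then have w: "p \<noteq> []" "hd p = u" "last p = v" "successively (\<lambda>x y. {x, y} \<in> E) p"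
        by (auto simp: walks_def)
      consider a where "p = [a]" | a b where "p = [a, b]" | a b c where "p = [a, b, c]"
        using w(1) p(2) by (cases p; cases "tl p"; cases "tl (tl p)") auto
      then show "{u, v} \<in> E \<or> (\<exists>w. {u, w} \<in> E \<and> {w, v} \<in> E)"
      proof cases
        case (3 a b c)
        then have "{u, b} \<in> E" "{b, v} \<in> E" using w by simp_all
        then show ?thesis by blast
      qed (use w uv(3) in auto)
    next
      assume "{u, v} \<in> E \<or> (\<exists>w. {u, w} \<in> E \<and> {w, v} \<in> E)"
      then show "\<exists>p\<in>walks V E u v. length p \<le> 3"
      proof
        assume "{u, v} \<in> E"
        then have "[u, v] \<in> walks V E u v" using uv by (simp add: walks_def)
        then show ?thesis by (intro bexI[of _ "[u, v]"]) auto
      next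
        assume "\<exists>w. {u, w} \<in> E \<and> {w, v} \<in> E"
        then obtain w where w: "{u, w} \<in> E" "{w, v} \<in> E" by blast
        then have "[u, w, v] \<in> walks V E u v"
          using uv simple_graphD(3)[OF assms w(1)] by (simp add: walks_def)
        then show ?thesis by (intro bexI[of _ "[u, w, v]"]) auto
      qed
    qed
    finally show ?thesis .
  qed
  have "{u, v} \<in> square_edges V E \<longleftrightarrow> u \<in> V \<and> v \<in> V \<and> u \<noteq> v \<and> graph_dist V E u v \<le> 2"
  proof
    assume "{u, v} \<in> square_edges V E"
    then obtain x y where xy: "{u, v} = {x, y}" "x \<in> V" "y \<in> V" "x \<noteq> y" "graph_dist V E x y \<le> 2"
      by (auto simp: square_edges_def)
    have "graph_dist V E y x \<le> 2" using dist[of x y] dist[of y x] xy(2-5) by (auto simp: insert_commute)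
    then show "u \<in> V \<and> v \<in> V \<and> u \<noteq> v \<and> graph_dist V E u v \<le> 2"
      using xy by (auto simp: doubleton_eq_iff)
  qed (auto simp: square_edges_def)
  then show ?thesis using dist by blast
qed

text \<open>Besides adjacent pairs, the square joins exactly the pairs of distinct vertices with a
  common neighbour, and these are the pairs that 1-frugality keeps apart.\<close>

lemma proper_square_iff_frugal:
  assumes sg: "simple_graph V E"
  shows "proper_colouring (square_edges V E) c \<longleftrightarrow> frugal_colouring 1 V E c"
proof
  assume p: "proper_colouring (square_edges V E) c"
  then have p': "c u \<noteq> c v" if "{u, v} \<in> square_edges V E" for u v using that by (simp add: proper_colouring_def)
  show "frugal_colouring 1 V E c"
    unfolding frugal_colouring_def proper_colouring_def
  proof (intro conjI allI impI ballI)
    fix u v assume "{u, v} \<in> E"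
    then have "{u, v} \<in> square_edges V E" using simple_graphD(2-4)[OF sg] by (auto simp: square_edges_iff[OF sg])
    then show "c u \<noteq> c v" by (rule p')
  next
    fix v i assume "v \<in> V"
    have "x = y" if "x \<in> neighbourhood E v" "y \<in> neighbourhood E v" "c x = c y" for x y
    proof (rule ccontr)
      assume "x \<noteq> y"
      moreover have "{x, v} \<in> E" "{v, y} \<in> E" using that by (auto simp: neighbourhood_def insert_commute)
      ultimately have "{x, y} \<in> square_edges V E"
        using simple_graphD(2,3)[OF sg] by (auto simp: square_edges_iff[OF sg])
      then show False using p' that by blast
    qed
    moreover have "finite {u \<in> neighbourhood E v. c u = i}" using simple_graphD(5)[OF sg] by simp
    ultimately show "card {u \<in> neighbourhood E v. c u = i} \<le> 1"
      by (auto simp: card_le_Suc0_iff_eq)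
  qed
next
  assume f: "frugal_colouring 1 V E c"
  show "proper_colouring (square_edges V E) c"
    unfolding proper_colouring_def
  proof (intro allI impI)
    fix u v assume "{u, v} \<in> square_edges V E"
    then have uv: "u \<noteq> v" "{u, v} \<in> E \<or> (\<exists>w. {u, w} \<in> E \<and> {w, v} \<in> E)"
      by (auto simp: square_edges_iff[OF sg])
    from uv(2) show "c u \<noteq> c v"
    proof
      assume "{u, v} \<in> E"
      then show ?thesis using f by (auto simp: frugal_colouring_def proper_colouring_def)
    next
      assume "\<exists>w. {u, w} \<in> E \<and> {w, v} \<in> E"
      then obtain w where w: "{u, w} \<in> E" "{w, v} \<in> E" by blast
      let ?S = "{x \<in> neighbourhood E w. c x = c u}"
      have "w \<in> V" using simple_graphD(3)[OF sg w(1)] .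
      then have "card ?S \<le> Suc 0" using f by (auto simp: frugal_colouring_def)
      moreover have "finite ?S" using simple_graphD(5)[OF sg] by simp
      ultimately have "\<forall>x\<in>?S. \<forall>y\<in>?S. x = y" by (simp add: card_le_Suc0_iff_eq)
      moreover have "u \<in> neighbourhood E w" "v \<in> neighbourhood E w"
        using w by (auto simp: neighbourhood_def insert_commute)
      ultimately show ?thesis using uv(1) by fastforce
    qed
  qed
qed

lemma chromatic_number_square:
  assumes "simple_graph V E"
  shows "chromatic_number V (square_edges V E) = frugal_chromatic_number 1 V E"
  by (simp add: chromatic_number_def frugal_chromatic_number_def proper_square_iff_frugal[OF assms])

text \<open>\<open>LEAST\<close> needs a witness: an injective colouring is frugal, since it repeats
  no colour in a neighbourhood and \<open>k \<ge> 1\<close>.\<close>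

lemma frugal_chromatic_number_attained:
  assumes sg: "simple_graph V E" and k: "k \<ge> 1"
  obtains c where "frugal_colouring k V E c" "card (c ` V) = frugal_chromatic_number k V E"
proof -
  obtain c :: "'a \<Rightarrow> nat" where c: "inj_on c V"
    using finite_imp_inj_to_nat_seg[OF simple_graphD(1)[OF sg]] by blast
  have ne: "c u \<noteq> c v" if "u \<in> V" "v \<in> V" "u \<noteq> v" for u v using c that by (auto dest: inj_onD)
  have "frugal_colouring k V E c"
    unfolding frugal_colouring_def proper_colouring_def
  proof (intro conjI allI impI ballI)
    fix u v assume "{u, v} \<in> E"
    then show "c u \<noteq> c v" using ne simple_graphD(2-4)[OF sg] by metis
  next
    fix v i
    have "neighbourhood E v \<subseteq> V" using simple_graphD(2)[OF sg] by (auto simp: neighbourhood_def)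
    then have "\<forall>x\<in>{u \<in> neighbourhood E v. c u = i}. \<forall>y\<in>{u \<in> neighbourhood E v. c u = i}. x = y"
      using c by (auto dest: inj_onD)
    moreover have "finite {u \<in> neighbourhood E v. c u = i}" using simple_graphD(5)[OF sg] by simp
    ultimately have "card {u \<in> neighbourhood E v. c u = i} \<le> Suc 0" by (simp only: card_le_Suc0_iff_eq)
    then show "card {u \<in> neighbourhood E v. c u = i} \<le> k" using k by simp
  qed
  then have "\<exists>n c. frugal_colouring k V E c \<and> card (c ` V) = n" by blast
  then have "\<exists>c. frugal_colouring k V E c \<and> card (c ` V) = frugal_chromatic_number k V E"
    unfolding frugal_chromatic_number_def by (rule LeastI_ex)
  then show thesis using that by blast
qed

section \<open>Assembling the colouring of the square\<close>

text \<open>Bounding the colours themselves rather than their number allows them to be permuted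
  within \<open>{..<q}\<close> and to be paired arithmetically.\<close>

lemma cyclic_colouring_relabel:
  assumes "plane_graph W A" "cyclic_colouring W A c" "card (c ` W) \<le> q"
  obtains c' where "cyclic_colouring W A c'" "\<forall>x\<in>W. c' x < q"
proof -
  have "finite (c ` W)" using plane_graph_finite[OF assms(1)] by simp
  then obtain h where h: "bij_betw h (c ` W) {0..<card (c ` W)}" using ex_bij_betw_finite_nat by blast
  have "inj_on (h \<circ> c) (face_vertices W F)" if "F \<in> faces W A" for F
  proof (rule comp_inj_on)
    show "inj_on c (face_vertices W F)" using assms(2) that by (simp add: cyclic_colouring_def)
    have "c ` face_vertices W F \<subseteq> c ` W" by (auto simp: face_vertices_def)
    then show "inj_on h (c ` face_vertices W F)" using h inj_on_subset by (auto simp: bij_betw_def)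
  qed
  moreover have "(h \<circ> c) x < q" if "x \<in> W" for x
  proof -
    have "h (c x) \<in> {0..<card (c ` W)}" using h that by (auto simp: bij_betw_def)
    then show ?thesis using assms(3) by simp
  qed
  ultimately show thesis using that[of "h \<circ> c"] by (simp add: cyclic_colouring_def)
qed

text \<open>Every class of an optimal \<open>k\<close>-frugal colouring is refined by its own
  \<open>q\<close> colours. Two neighbours of \<open>v\<close> in the same class are leaves of the
  star at \<open>v\<close> in the star system of that class, so the refinement tells them
  apart.\<close>

lemma frugal_chromatic_number_1_le:
  assumes pl: "planar_graph V E" and k: "k \<ge> 3"
    and hyp: "\<And>W A. plane_graph W A \<Longrightarrow> max_face_size W A \<le> k \<Longrightarrow>
                 \<exists>c. cyclic_colouring W A c \<and> (\<forall>x\<in>W. c x < q)"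
  shows "frugal_chromatic_number 1 V E \<le> frugal_chromatic_number k V E * q"
proof -
  obtain f A where sg: "simple_graph V E" and f: "inj_on f V" and pg: "plane_graph (f ` V) A"
    and fE: "(\<lambda>e. f ` e) ` E = ends (f ` V) A"
    using pl by (auto simp: planar_graph_def)
  obtain c0 where c0: "frugal_colouring k V E c0" and n: "card (c0 ` V) = frugal_chromatic_number k V E"
    using frugal_chromatic_number_attained[OF sg] k by (metis one_le_numeral order_trans)
  have proper: "c0 u \<noteq> c0 v" if "{u, v} \<in> E" for u v
    using c0 that by (auto simp: frugal_colouring_def proper_colouring_def)
  \<comment> \<open>\<open>D i\<close> is a colour class, transported to the plane, and
    \<open>G i\<close> keeps the edges that meet it. A class is independent, so every edge of
    \<open>G i\<close> is a spoke; vertices away from the class become stars without leaves.\<close>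
  define D where "D = (\<lambda>i. f ` {x \<in> V. c0 x = i})"
  define G where "G = (\<lambda>i. {e \<in> (\<lambda>e. f ` e) ` E. e \<inter> D i \<noteq> {}})"
  have edge: "{u, v} \<in> E" if e: "{f u, f v} \<in> (\<lambda>e. f ` e) ` E" and uv: "u \<in> V" "v \<in> V" for u v
  proof -
    obtain e where e: "e \<in> E" "{f u, f v} = f ` e" using e by auto
    have "e \<subseteq> V" using e(1) sg by (auto simp: simple_graph_def)
    moreover have "f ` e = f ` {u, v}" using e(2) by simp
    ultimately have "e = {u, v}" using inj_on_image_eq_iff[OF f, of e "{u, v}"] uv by simp
    then show ?thesis using e(1) by simp
  qed
  have nb: "neighbourhood (G i) (f v) \<subseteq> f ` {u \<in> neighbourhood E v. c0 u = i}"
    if v: "v \<in> V" "c0 v \<noteq> i" for v i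
  proof
    fix z assume "z \<in> neighbourhood (G i) (f v)"
    then have z: "{z, f v} \<in> (\<lambda>e. f ` e) ` E" "{z, f v} \<inter> D i \<noteq> {}" by (auto simp: neighbourhood_def G_def)
    have "f v \<notin> D i" using v f by (auto simp: D_def inj_on_eq_iff)
    then have "z \<in> D i" using z(2) by blast
    then obtain u where u: "u \<in> V" "c0 u = i" "z = f u" by (auto simp: D_def)
    then have "{u, v} \<in> E" using edge z(1) v(1) by blast
    then show "z \<in> f ` {u \<in> neighbourhood E v. c0 u = i}" using u by (auto simp: neighbourhood_def)
  qed
  have sys: "star_system k (f ` V) (G i) (D i)" for i
    unfolding star_system_def
  proof (intro conjI ballI)
    have "drawable (f ` V) (ends (f ` V) A)" using pg unfolding drawable_def by blast
    then show "drawable (f ` V) (G i)" unfolding fE[symmetric]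
      by (rule drawable_mono) (use sg in \<open>auto simp: G_def simple_graph_def\<close>)
    show "D i \<subseteq> f ` V" by (auto simp: D_def)
    show "e \<inter> D i \<noteq> {}" if "e \<in> G i" for e using that by (simp add: G_def)
    fix z assume "z \<in> f ` V - D i"
    then obtain v where v: "v \<in> V" "z = f v" "c0 v \<noteq> i" by (auto simp: D_def)
    have fin: "finite {u \<in> neighbourhood E v. c0 u = i}" using simple_graphD(5)[OF sg] by simp
    have "card (neighbourhood (G i) z) \<le> card (f ` {u \<in> neighbourhood E v. c0 u = i})"
      using nb[OF v(1,3)] v(2) fin by (simp add: card_mono)
    also have "\<dots> \<le> card {u \<in> neighbourhood E v. c0 u = i}" using fin by (rule card_image_le)
    also have "\<dots> \<le> k" using c0 v(1) by (auto simp: frugal_colouring_def)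
    finally show "card (neighbourhood (G i) z) \<le> k" .
  qed
  have "\<forall>i. \<exists>d. star_colouring q (f ` V) (G i) (D i) d"
    using star_system_colourable[OF hyp k sys] by blast
  then obtain d where d: "\<And>i. star_colouring q (f ` V) (G i) (D i) (d i)" by metis
  \<comment> \<open>Pairs of colours are coded in base \<open>q\<close>; on \<open>V\<close> the
    second digit is below \<open>q\<close>, so division recovers the first.\<close>
  define c where "c = (\<lambda>x. c0 x * q + d (c0 x) (f x))"
  have dlt: "d (c0 x) (f x) < q" if "x \<in> V" for x
    using d[of "c0 x"] that by (auto simp: star_colouring_def D_def)
  have c_eq: "c0 x = c0 y \<and> d (c0 x) (f x) = d (c0 y) (f y)" if "x \<in> V" "y \<in> V" "c x = c y" for x y
  proof -
    have "c z div q = c0 z" if "z \<in> V" for z using dlt[OF that] by (auto simp: c_def)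
    then have "c0 x = c0 y" using that by metis
    then show ?thesis using that(3) by (simp add: c_def)
  qed
  have frugal: "frugal_colouring 1 V E c"
    unfolding frugal_colouring_def proper_colouring_def
  proof (intro conjI allI impI ballI)
    fix u v assume e: "{u, v} \<in> E"
    then show "c u \<noteq> c v" using c_eq proper simple_graphD(2,3)[OF sg e] by blast
  next
    fix v i assume v: "v \<in> V"
    have "x = y" if xy: "{x, v} \<in> E" "{y, v} \<in> E" "c x = c y" for x y
    proof -
      have V: "x \<in> V" "y \<in> V" using simple_graphD(2)[OF sg] xy by auto
      note ce = c_eq[OF V xy(3)]
      have ne: "c0 v \<noteq> c0 x" using proper[OF xy(1)] by simp
      \<comment> \<open>Being adjacent to \<open>x\<close>, the vertex \<open>v\<close> is outside
        the class of \<open>x\<close> and hence a star centre for that class.\<close>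
      have "f v \<in> f ` V - D (c0 x)" using v ne f by (auto simp: D_def inj_on_eq_iff)
      then have inj: "inj_on (d (c0 x)) (neighbourhood (G (c0 x)) (f v))"
        using d[of "c0 x"] by (auto simp: star_colouring_def)
      have "{f x, f v} \<in> (\<lambda>e. f ` e) ` E" "{f y, f v} \<in> (\<lambda>e. f ` e) ` E"
        using imageI[OF xy(1), of "\<lambda>e. f ` e"] imageI[OF xy(2), of "\<lambda>e. f ` e"] by simp_all
      moreover have "f x \<in> D (c0 x)" "f y \<in> D (c0 x)" using V ce by (auto simp: D_def)
      ultimately have "f x \<in> neighbourhood (G (c0 x)) (f v)" "f y \<in> neighbourhood (G (c0 x)) (f v)"
        by (auto simp: neighbourhood_def G_def)
      then have "f x = f y" using inj ce by (auto dest: inj_onD)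
      then show "x = y" using f V by (auto dest: inj_onD)
    qed
    moreover have "finite {u \<in> neighbourhood E v. c u = i}" using simple_graphD(5)[OF sg] by simp
    ultimately show "card {u \<in> neighbourhood E v. c u = i} \<le> 1"
      by (auto simp: card_le_Suc0_iff_eq neighbourhood_def)
  qed
  have "frugal_chromatic_number 1 V E \<le> card (c ` V)"
    unfolding frugal_chromatic_number_def using frugal by (intro Least_le) blast
  also have "\<dots> \<le> card ((\<lambda>(i, j). i * q + j) ` (c0 ` V \<times> {..<q}))"
  proof (rule card_mono)
    show "finite ((\<lambda>(i, j). i * q + j) ` (c0 ` V \<times> {..<q}))" using simple_graphD(1)[OF sg] by simp
    show "c ` V \<subseteq> (\<lambda>(i, j). i * q + j) ` (c0 ` V \<times> {..<q})"
    proof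
      fix z assume "z \<in> c ` V"
      then obtain x where "x \<in> V" "z = c x" by blast
      then show "z \<in> (\<lambda>(i, j). i * q + j) ` (c0 ` V \<times> {..<q})"
        using dlt by (intro image_eqI[of _ _ "(c0 x, d (c0 x) (f x))"]) (auto simp: c_def)
    qed
  qed
  also have "\<dots> \<le> card (c0 ` V \<times> {..<q})" using simple_graphD(1)[OF sg] by (intro card_image_le) auto
  also have "\<dots> = frugal_chromatic_number k V E * q" using n by (simp add: card_cartesian_product)
  finally show ?thesis .
qed

theorem theorem14:
  fixes k :: nat and V :: "'a set" and E :: "'a set set"
  assumes "k \<ge> 4" and "even k"
    and "\<And>W A. plane_graph W A \<Longrightarrow> max_face_size W A \<le> k \<Longrightarrow>
           \<exists>c. cyclic_colouring W A c \<and> real (card (c ` W)) \<le> 3 / 2 * real k"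
    and "planar_graph V E"
    and "int (frugal_chromatic_number k V E) \<le> \<lfloor>(real (max_degree V E) - 1) / real k\<rfloor> + 3"
  shows "chromatic_number V (square_edges V E) = frugal_chromatic_number 1 V E \<and>
         real (frugal_chromatic_number 1 V E)
           \<le> real_of_int \<lfloor>3 / 2 * real (max_degree V E)\<rfloor> + 9 / 2 * real k - 1"
proof
  show "chromatic_number V (square_edges V E) = frugal_chromatic_number 1 V E"
    using assms(4) by (intro chromatic_number_square) (simp add: planar_graph_def)
  define q where "q = 3 * k div 2"
  \<comment> \<open>Evenness of \<open>k\<close> makes the division exact.\<close>
  have q: "real q = 3 / 2 * real k" using assms(2) by (auto simp: q_def elim!: evenE)
  have hyp: "\<exists>c. cyclic_colouring W A c \<and> (\<forall>x\<in>W. c x < q)"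
    if pg: "plane_graph W A" and sz: "max_face_size W A \<le> k" for W A
  proof -
    obtain c where c: "cyclic_colouring W A c" "real (card (c ` W)) \<le> 3 / 2 * real k"
      using assms(3)[OF pg sz] by blast
    then have "card (c ` W) \<le> q" using q by linarith
    then show ?thesis using cyclic_colouring_relabel[OF pg c(1)] by metis
  qed
  define D where "D = max_degree V E"
  define n where "n = frugal_chromatic_number k V E"
  have "frugal_chromatic_number 1 V E \<le> n * q"
    unfolding n_def using assms(1) by (intro frugal_chromatic_number_1_le[OF assms(4) _ hyp]) auto
  then have "real (frugal_chromatic_number 1 V E) \<le> real n * real q" by (simp flip: of_nat_mult)
  also have "\<dots> \<le> ((real D - 1) / real k + 3) * real q"
  proof (rule mult_right_mono)
    have "int n \<le> \<lfloor>(real D - 1) / real k\<rfloor> + 3" using assms(5) by (simp add: n_def D_def)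
    then show "real n \<le> (real D - 1) / real k + 3" by linarith
  qed simp
  also have "\<dots> = 3 / 2 * real D - 3 / 2 + 9 / 2 * real k"
    using assms(1) unfolding q by (simp add: field_simps)
  \<comment> \<open>Rounding \<open>3 / 2 * D\<close> down loses at most \<open>1 / 2\<close>, which
    turns \<open>- 3 / 2\<close> into \<open>- 1\<close>.\<close>
  also have "\<dots> \<le> real_of_int \<lfloor>3 / 2 * real D\<rfloor> + 9 / 2 * real k - 1"
  proof -
    have "\<lfloor>3 / 2 * real D\<rfloor> = int (3 * D div 2)"
      by (metis floor_divide_of_nat_eq of_nat_mult of_nat_numeral times_divide_eq_left)
    moreover have "3 * D \<le> 2 * (3 * D div 2) + 1" by linarith
    then have "3 * real D \<le> 2 * real (3 * D div 2) + 1" by linarith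
    ultimately show ?thesis by simp
  qed
  finally show "real (frugal_chromatic_number 1 V E)
      \<le> real_of_int \<lfloor>3 / 2 * real (max_degree V E)\<rfloor> + 9 / 2 * real k - 1"
    by (simp add: D_def)
qed

end
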